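(* Let $\mathcal{A}$ be a hypersolvable and not supersolvable complex hyperplane arrangement, $p=p(\mathcal{A})$, with the notation $X,Y,\pi_p=\pi_p(X),\mathsf{R},\widehat{\mathsf{R}},\partial_{p+2},\Pi_{p+1}$ of the context. Let $D_{p+2}:H_{p+2}(Y)\otimes\widehat{\mathsf{R}}\to H_{p+1}(Y,X)\otimes\widehat{\mathsf{R}}$ be an $\widehat{\mathsf{R}}$-linear map such that $\pi_p\otimes_{\mathsf{R}}\widehat{\mathsf{R}}\cong\operatorname{coker}(D_{p+2})$ over $\widehat{\mathsf{R}}$, $\operatorname{gr}_F^\bullet(D_{p+2})=0$, and $E_1^\bullet(D_{p+2}):H_{p+2}(Y)\otimes\operatorname{gr}_I^\bullet\mathsf{R}\to H_{p+1}(Y,X)\otimes\operatorname{gr}_I^{\bullet+1}\mathsf{R}$ is given on the free generators $H_{p+2}(Y)\otimes 1$ by $(\Pi_{p+1}\otimes\mathrm{id})\circ\partial_{p+2}$. Let $q\ge 2$ and $\mathsf{R}_q=\mathsf{R}/I^q=\widehat{\mathsf{R}}/F^q$. Then $\pi_p/I^q\cdot\pi_p$ is isomorphic over $\mathsf{R}_q$ with \[ \operatorname{coker}\bigl(D_{p+2}\otimes_{\widehat{\mathsf{R}}}\mathsf{R}_q: H_{p+2}(Y)\otimes\mathsf{R}_q\to H_{p+1}(Y,X)\otimes\mathsf{R}_q\bigr). \] Furthermore, $\operatorname{gr}_I^\bullet(D_{p+2}\otimes_{\widehat{\mathsf{R}}}\mathsf{R}_q)=0$, and the induced map \[ E_1^s(D_{p+2}\otimes_{\widehat{\mathsf{R}}}\mathsf{R}_q):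 H_{p+2}(Y)\otimes\operatorname{gr}_I^s\mathsf{R}_q\to H_{p+1}(Y,X)\otimes\operatorname{gr}_I^{s+1}\mathsf{R}_q \] is equal to $E_1^s(D_{p+2})$ for $s<q-1$, and it is $0$ for $s=q-1$ (where $\operatorname{gr}_I^s\mathsf{R}_q=\operatorname{gr}_I^s\mathsf{R}$ for $s<q$ and $\operatorname{gr}_I^s\mathsf{R}_q=0$ for $s\ge q$).
   Context: Arrangements are finite, central (all hyperplanes are linear), in a finite-dimensional complex vector space; $L(\mathcal{A})$ is the intersection lattice; a set of hyperplanes has rank equal to the codimension of its intersection, and is dependent if its rank is less than its cardinality. $M'(\mathcal{A})$ is the complement in the ambient vector space of the union of the hyperplanes. All homology is with $\mathbb{Z}$-coefficients and $\otimes$ means $\otimes_{\mathbb{Z}}$ unless indicated. Supersolvable (= fiber-type): $L(\mathcal{A})$ has a maximal chain of modular elements. Hypersolvable: for $\emptyset\ne\mathcal{B}\subsetneq\mathcal{A}$, the pair $(\mathcal{A},\mathcal{B})$ is a solvable extension if (I) for all $a\in\mathcal{A}\setminus\mathcal{B}$ and distinct $\alpha,\beta\in\mathcal{B}$, $\operatorname{rank}\{a,\alpha,\beta\}=3$; (II) for all distinct $a,b\in\mathcal{A}\setminus\mathcal{B}$ there is a (necessarily unique) $f(a,b)\in\mathcal{B}$ with $\operatorname{rank}\{a,b,f(a,b)\}=2$; (III) for all distinct $a,b,c\in\mathcal{A}\setminus\mathcal{B}$, $\operatorname{rank}\{f(a,b),f(a,c),f(b,c)\}\le 2$. $\mathcal{A}$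 is hypersolvable if there is a chain $\mathcal{A}_1\subset\cdots\subset\mathcal{A}_\ell=\mathcal{A}$ with $|\mathcal{A}_1|=1$ and each $(\mathcal{A}_{i+1},\mathcal{A}_i)$ a solvable extension. Orlik–Solomon algebras: $\Lambda^\bullet$ is the exterior algebra over $\mathbb{Z}$ on the set $\mathcal{A}$; $\mathcal{I}\subseteq\Lambda$ is the Orlik–Solomon ideal (generated by $\delta(e_C)$, $C\subseteq\mathcal{A}$ dependent, where $e_C$ is the exterior monomial of $C$ and $\delta$ is the degree $-1$ graded derivation with $\delta(H)=1$ for every generator $H\in\mathcal{A}$); $\mathcal{I}_2$ is the ideal generated by the degree-2 component $\mathcal{I}^2$; $\operatorname{A}^\bullet(\mathcal{A})=\Lambda/\mathcal{I}$ (isomorphic to $H^\bullet(M'(\mathcal{A}))$), $\overline{\operatorname{A}}^\bullet(\mathcal{A})=\Lambda/\mathcal{I}_2$. Define $p(\mathcal{A})=\sup\{s\mid \operatorname{rank}\operatorname{A}^t(\mathcal{A})=\operatorname{rank}\overline{\operatorname{A}}^t(\mathcal{A})\ \forall t\le s\}$. For $\mathcal{A}$ hypersolvable and not supersolvable, $2\le p(\mathcal{A})<\operatorname{rank}(\mathcal{A})$ and $\pi_p(M'(\mathcal{A}))$ is the first non-zero higher homotopy group. Supersolvable deformation (known to exist): if $\mathcal{A}$ in $V$ is hypersolvable and not supersolvable, $p=p(\mathcal{A})$, there are a supersolvable arrangement $\widehat{\mathcal{A}}$ in a vector space $W\supseteq V$, such that $H\mapsto H\cap V$ is a bijection $\widehat{\mathcal{A}}\to\mathcal{A}$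 and $\operatorname{codim}_V(Z\cap V)=\operatorname{codim}_W(Z)$ for all $Z\in L(\widehat{\mathcal{A}})$ with $\operatorname{codim}_W Z\le p+1$. Put $X=M'(\mathcal{A})$, $Y=M'(\widehat{\mathcal{A}})$, $j:X\hookrightarrow Y$ the inclusion. Then $j$ induces an isomorphism on fundamental groups (both denoted $\pi_1$) and on $H_1$ (both denoted $H_1$). There are split exact sequences of finitely generated free abelian groups $0\to H_\bullet(X)\xrightarrow{j_\bullet}H_\bullet(Y)\xrightarrow{\Pi_\bullet}H_\bullet(Y,X)\to 0$. One has $H^\bullet(Y)=\operatorname{A}^\bullet(\widehat{\mathcal{A}})=\overline{\operatorname{A}}^\bullet(\mathcal{A})$ and $H^\bullet(X)=\operatorname{A}^\bullet(\mathcal{A})$, with $j^\bullet$ the canonical surjection $\Lambda/\mathcal{I}_2\to\Lambda/\mathcal{I}$; so the dual of $\Pi_\bullet$ is the inclusion $\mathcal{I}/\mathcal{I}_2\hookrightarrow\Lambda/\mathcal{I}_2$. The map $\partial_{\bullet}:H_{\bullet}(Y)\to H_{\bullet-1}(Y)\otimes H_1$ is the homomorphism whose dual is, up to sign, the multiplication $\overline{\operatorname{A}}^{\bullet-1}(\mathcal{A})\otimes\overline{\operatorname{A}}^1(\mathcal{A})\to\overline{\operatorname{A}}^{\bullet}(\mathcal{A})$. (It is the linear part, i.e. the restriction to $H_\bullet(Y)\otimes 1$ of the map induced on $I$-adic associated gradeds, of the differential of the $\pi_1$-equivariant cellular chain complex $H_\bullet(Y)\otimes\mathbb{Z}\pi_1$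 of the universal cover of $Y$, for a minimal cell structure on $Y$.) Completion: $\mathsf{R}=\mathbb{Z}\pi_1$, $I$ its augmentation ideal, $\operatorname{gr}_I^q\mathsf{R}=I^q/I^{q+1}$ (so $\operatorname{gr}^0_I\mathsf{R}=\mathbb{Z}$, $\operatorname{gr}_I^1\mathsf{R}=H_1$), $\widehat{\mathsf{R}}=\varprojlim\mathsf{R}/I^q$ with filtration $F^q=\ker(\widehat{\mathsf{R}}\to\mathsf{R}/I^q)$, so $\operatorname{gr}_F^q\widehat{\mathsf{R}}=\operatorname{gr}_I^q\mathsf{R}$. Modules are right modules, $\pi_p/I^q\cdot\pi_p$ denotes $\pi_p\otimes_{\mathsf{R}}\mathsf{R}_q$; a right $\widehat{\mathsf{R}}$-module $M$ carries the filtration $\{M\cdot F^q\}_q$ and $\operatorname{gr}_F^\bullet M$ is its associated graded; for $M=H\otimes\widehat{\mathsf{R}}$ with $H$ finitely generated free abelian, $\operatorname{gr}_F^\bullet M=H\otimes\operatorname{gr}_I^\bullet\mathsf{R}$. For an $\widehat{\mathsf{R}}$-linear $f:M\to N$, $\operatorname{gr}_F^\bullet(f)$ is the induced map; $\operatorname{gr}_F^\bullet(f)=0$ iff $f(M\cdot F^q)\subseteq N\cdot F^{q+1}$ for all $q$, and then $E_1^\bullet(f):\operatorname{gr}_F^\bullet M\to\operatorname{gr}_F^{\bullet+1}N$ denotes the map induced by $f$. The same notations $\operatorname{gr}_I^\bullet$, $E_1^\bullet$ are used for $\mathsf{R}_q$-modules with their $I$-adic filtrations $\{M\cdot I^s\}_s$.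 It is known (another result of the same paper) that a map $D_{p+2}$ with the properties required in the claim exists. *)

theory Defs
  imports
    "HOL-Complex_Analysis.Complex_Analysis"
    "HOL-Homology.Homology"
    "HOL-Algebra.Lattice"
    "HOL-Algebra.QuotRing"
    "HOL-Algebra.Ideal_Product"
    "HOL-Library.Extended_Nat"
begin

section \<open>Arrangements\<close>

text \<open>
  The ambient space of an arrangement is a complex linear subspace \<open>V\<close> of some \<open>complex ^ 'n\<close>;
  this makes room for a pair of ambient spaces \<open>V \<subseteq> W\<close>.
\<close>

definition arrangement :: "(complex ^ 'n) set \<Rightarrow> (complex ^ 'n) set set \<Rightarrow> bool" where
  "arrangement V A \<longleftrightarrow>
     vec.subspace V \<and> finite A \<and>
     (\<forall>H\<in>A. vec.subspace H \<and> H \<subseteq> V \<and> vec.dim H + 1 = vec.dim V)"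

definition codim_in :: "(complex ^ 'n) set \<Rightarrow> (complex ^ 'n) set \<Rightarrow> nat" where
  "codim_in V Z = vec.dim V - vec.dim Z"

definition arr_rank :: "(complex ^ 'n) set \<Rightarrow> (complex ^ 'n) set set \<Rightarrow> nat" where
  "arr_rank V B = codim_in V (V \<inter> \<Inter>B)"

definition arr_dependent :: "(complex ^ 'n) set \<Rightarrow> (complex ^ 'n) set set \<Rightarrow> bool" where
  "arr_dependent V B \<longleftrightarrow> arr_rank V B < card B"

definition arr_complement :: "(complex ^ 'n) set \<Rightarrow> (complex ^ 'n) set set \<Rightarrow> (complex ^ 'n) set" where
  "arr_complement V A = V - \<Union>A"

text \<open>The intersection lattice is ordered by reverse inclusion, so \<open>V\<close> is its bottom element.\<close>

definition intersection_lattice ::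
    "(complex ^ 'n) set \<Rightarrow> (complex ^ 'n) set set \<Rightarrow> (complex ^ 'n) set gorder" where
  "intersection_lattice V A =
     \<lparr>carrier = {V \<inter> \<Inter>B |B. B \<subseteq> A}, eq = (=), le = (\<lambda>X Y. Y \<subseteq> X)\<rparr>"

text \<open>\<open>x\<close> forms a modular pair with every \<open>y\<close>.\<close>

definition modular_element :: "('a, 'b) gorder_scheme \<Rightarrow> 'a \<Rightarrow> bool" where
  "modular_element L x \<longleftrightarrow> x \<in> carrier L \<and>
     (\<forall>y\<in>carrier L. \<forall>z\<in>carrier L. z \<sqsubseteq>\<^bsub>L\<^esub> y \<longrightarrow>
        join L z (meet L x y) = meet L (join L z x) y)"

definition lattice_chain :: "('a, 'b) gorder_scheme \<Rightarrow> 'a set \<Rightarrow> bool" where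
  "lattice_chain L C \<longleftrightarrow> C \<subseteq> carrier L \<and> (\<forall>x\<in>C. \<forall>y\<in>C. x \<sqsubseteq>\<^bsub>L\<^esub> y \<or> y \<sqsubseteq>\<^bsub>L\<^esub> x)"

definition maximal_lattice_chain :: "('a, 'b) gorder_scheme \<Rightarrow> 'a set \<Rightarrow> bool" where
  "maximal_lattice_chain L C \<longleftrightarrow>
     lattice_chain L C \<and> (\<forall>C'. lattice_chain L C' \<and> C \<subseteq> C' \<longrightarrow> C' = C)"

definition supersolvable :: "(complex ^ 'n) set \<Rightarrow> (complex ^ 'n) set set \<Rightarrow> bool" where
  "supersolvable V A \<longleftrightarrow>
     (\<exists>C. maximal_lattice_chain (intersection_lattice V A) C \<and>
          (\<forall>x\<in>C. modular_element (intersection_lattice V A) x))"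

definition solvable_extension ::
    "(complex ^ 'n) set \<Rightarrow> (complex ^ 'n) set set \<Rightarrow> (complex ^ 'n) set set \<Rightarrow> bool" where
  "solvable_extension V A B \<longleftrightarrow>
     B \<noteq> {} \<and> B \<subset> A \<and>
     (\<forall>a\<in>A - B. \<forall>\<alpha>\<in>B. \<forall>\<beta>\<in>B. \<alpha> \<noteq> \<beta> \<longrightarrow> arr_rank V {a, \<alpha>, \<beta>} = 3) \<and>
     (\<exists>f. (\<forall>a\<in>A - B. \<forall>b\<in>A - B. a \<noteq> b \<longrightarrow> f a b \<in> B \<and> arr_rank V {a, b, f a b} = 2) \<and>
          (\<forall>a\<in>A - B. \<forall>b\<in>A - B. \<forall>c\<in>A - B. a \<noteq> b \<and> a \<noteq> c \<and> b \<noteq> c \<longrightarrow>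
             arr_rank V {f a b, f a c, f b c} \<le> 2))"

definition hypersolvable :: "(complex ^ 'n) set \<Rightarrow> (complex ^ 'n) set set \<Rightarrow> bool" where
  "hypersolvable V A \<longleftrightarrow>
     (\<exists>l As. 1 \<le> l \<and> card (As 1) = 1 \<and> As l = A \<and>
        (\<forall>i\<in>{1..<l::nat}. solvable_extension V (As (Suc i)) (As i)))"

section \<open>Linear extension and tensor products of abelian groups\<close>

text \<open>
  Abelian groups are multiplicative HOL-Algebra monoid records, as the homology groups are.
  A formal \<open>\<int>\<close>-linear combination is an element of \<open>_ \<Rightarrow>\<^sub>0 int\<close>, as for singular chains.
\<close>

definition free_ext :: "('b, 'z) monoid_scheme \<Rightarrow> ('a \<Rightarrow> 'b) \<Rightarrow> ('a \<Rightarrow>\<^sub>0 int) \<Rightarrow> 'b" where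
  "free_ext G f t = finprod G (\<lambda>x. f x [^]\<^bsub>G\<^esub> Poly_Mapping.lookup t x) (Poly_Mapping.keys t)"

text \<open>Throughout, a map defined on a coset is given by its common value on representatives.\<close>

definition coset_map :: "('b, 'z) monoid_scheme \<Rightarrow> 'b set \<Rightarrow> ('a \<Rightarrow> 'b) \<Rightarrow> 'a set \<Rightarrow> 'b set" where
  "coset_map N K f c = the_elem ((\<lambda>x. K #>\<^bsub>N\<^esub> f x) ` c)"

definition bilinear_rels ::
    "('m, 'y) monoid_scheme \<Rightarrow> ('n, 'z) monoid_scheme \<Rightarrow> ('m \<times> 'n \<Rightarrow>\<^sub>0 int) set" where
  "bilinear_rels M N =
     {frag_of (m \<otimes>\<^bsub>M\<^esub> m', n) - frag_of (m, n) - frag_of (m', n) |m m' n.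
        m \<in> carrier M \<and> m' \<in> carrier M \<and> n \<in> carrier N} \<union>
     {frag_of (m, n \<otimes>\<^bsub>N\<^esub> n') - frag_of (m, n) - frag_of (m, n') |m n n'.
        m \<in> carrier M \<and> n \<in> carrier N \<and> n' \<in> carrier N}"

text \<open>
  The set \<open>B\<close> holds the balancing relations \<open>m \<sqdot> s \<otimes> n = m \<otimes> s \<sqdot> n\<close>; it is empty for the tensor
  product over \<open>\<int>\<close>.
\<close>

definition tensor_rels where
  "tensor_rels M N B =
     generate (free_Abelian_group (carrier M \<times> carrier N)) (bilinear_rels M N \<union> B)"

definition tensor_group ::
    "('m, 'y) monoid_scheme \<Rightarrow> ('n, 'z) monoid_scheme \<Rightarrow> ('m \<times> 'n \<Rightarrow>\<^sub>0 int) set \<Rightarrow>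
     ('m \<times> 'n \<Rightarrow>\<^sub>0 int) set monoid" where
  "tensor_group M N B =
     free_Abelian_group (carrier M \<times> carrier N) Mod tensor_rels M N B"

definition tens ::
    "('m, 'y) monoid_scheme \<Rightarrow> ('n, 'z) monoid_scheme \<Rightarrow> ('m \<times> 'n \<Rightarrow>\<^sub>0 int) set \<Rightarrow>
     'm \<Rightarrow> 'n \<Rightarrow> ('m \<times> 'n \<Rightarrow>\<^sub>0 int) set" where
  "tens M N B m n =
     tensor_rels M N B #>\<^bsub>free_Abelian_group (carrier M \<times> carrier N)\<^esub> frag_of (m, n)"

text \<open>The homomorphism out of a tensor product given by a (balanced) bilinear map \<open>f\<close>.\<close>

definition tensor_lift ::
    "('g, 'z) monoid_scheme \<Rightarrow> ('m \<Rightarrow> 'n \<Rightarrow> 'g) \<Rightarrow> ('m \<times> 'n \<Rightarrow>\<^sub>0 int) set \<Rightarrow> 'g" where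
  "tensor_lift G f c = the_elem (free_ext G (\<lambda>(m, n). f m n) ` c)"

abbreviation ztensor where "ztensor M N \<equiv> tensor_group M N {}"

definition ztensor_map where
  "ztensor_map M' N' f g = tensor_lift (ztensor M' N') (\<lambda>m n. tens M' N' {} (f m) (g n))"

section \<open>Rings\<close>

definition add_group :: "('r, 'z) ring_scheme \<Rightarrow> 'r monoid" where
  "add_group R = \<lparr>carrier = carrier R, monoid.mult = add R, one = zero R\<rparr>"

definition monoid_ring :: "('g, 'z) monoid_scheme \<Rightarrow> ('g \<Rightarrow>\<^sub>0 int) ring" where
  "monoid_ring G =
     \<lparr>carrier = {c. Poly_Mapping.keys c \<subseteq> carrier G},
      monoid.mult = (\<lambda>x y. frag_extend (\<lambda>g. frag_extend (\<lambda>h. frag_of (g \<otimes>\<^bsub>G\<^esub> h)) y) x),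
      one = frag_of \<one>\<^bsub>G\<^esub>, zero = 0, add = (+)\<rparr>"

definition augmentation_ideal :: "('g, 'z) monoid_scheme \<Rightarrow> ('g \<Rightarrow>\<^sub>0 int) set" where
  "augmentation_ideal G =
     {c \<in> carrier (monoid_ring G). (\<Sum>g\<in>Poly_Mapping.keys c. Poly_Mapping.lookup c g) = 0}"

primrec ideal_pow :: "('r, 'z) ring_scheme \<Rightarrow> 'r set \<Rightarrow> nat \<Rightarrow> 'r set" where
  "ideal_pow R I 0 = carrier R"
| "ideal_pow R I (Suc n) = ideal_prod R (ideal_pow R I n) I"

text \<open>
  The inverse limit of the \<open>R / I^q\<close>: a coset of \<open>I^(q+1)\<close> maps to the coset of \<open>I^q\<close> containing it.
\<close>

definition adic_completion :: "('r, 'z) ring_scheme \<Rightarrow> 'r set \<Rightarrow> (nat \<Rightarrow> 'r set) ring" where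
  "adic_completion R I =
     \<lparr>carrier = {x. \<forall>q. x q \<in> carrier (R Quot ideal_pow R I q) \<and> x (Suc q) \<subseteq> x q},
      monoid.mult = (\<lambda>x y q. x q \<otimes>\<^bsub>R Quot ideal_pow R I q\<^esub> y q),
      one = (\<lambda>q. \<one>\<^bsub>R Quot ideal_pow R I q\<^esub>),
      zero = (\<lambda>q. \<zero>\<^bsub>R Quot ideal_pow R I q\<^esub>),
      add = (\<lambda>x y q. x q \<oplus>\<^bsub>R Quot ideal_pow R I q\<^esub> y q)\<rparr>"

definition completion_filt :: "('r, 'z) ring_scheme \<Rightarrow> 'r set \<Rightarrow> nat \<Rightarrow> (nat \<Rightarrow> 'r set) set" where
  "completion_filt R I q =
     {x \<in> carrier (adic_completion R I). x q = \<zero>\<^bsub>R Quot ideal_pow R I q\<^esub>}"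

definition to_quot :: "('r, 'z) ring_scheme \<Rightarrow> 'r set \<Rightarrow> nat \<Rightarrow> 'r \<Rightarrow> 'r set" where
  "to_quot R I q r = ideal_pow R I q +>\<^bsub>R\<^esub> r"

definition to_completion :: "('r, 'z) ring_scheme \<Rightarrow> 'r set \<Rightarrow> 'r \<Rightarrow> nat \<Rightarrow> 'r set" where
  "to_completion R I r = (\<lambda>q. to_quot R I q r)"

definition quot_filt :: "('r, 'z) ring_scheme \<Rightarrow> 'r set \<Rightarrow> nat \<Rightarrow> nat \<Rightarrow> 'r set set" where
  "quot_filt R I q s = to_quot R I q ` ideal_pow R I s"

definition gr_ring :: "('r, 'z) ring_scheme \<Rightarrow> (nat \<Rightarrow> 'r set) \<Rightarrow> nat \<Rightarrow> 'r set monoid" where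
  "gr_ring S F s = (add_group S)\<lparr>carrier := F s\<rparr> Mod F (Suc s)"

text \<open>The map induced on associated gradeds by a map \<open>\<eta>\<close> into the ring \<open>S\<close> filtered by \<open>F\<close>.\<close>

definition gr_ring_map ::
    "('s, 'z) ring_scheme \<Rightarrow> (nat \<Rightarrow> 's set) \<Rightarrow> ('r \<Rightarrow> 's) \<Rightarrow> nat \<Rightarrow> 'r set \<Rightarrow> 's set" where
  "gr_ring_map S F \<eta> s = coset_map (add_group S) (F (Suc s)) \<eta>"

section \<open>Right modules\<close>

record ('m, 'r) rmodule = "'m monoid" +
  ract :: "'m \<Rightarrow> 'r \<Rightarrow> 'm"

definition with_action :: "('m, 'z) monoid_scheme \<Rightarrow> ('m \<Rightarrow> 'r \<Rightarrow> 'm) \<Rightarrow> ('m, 'r) rmodule" where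
  "with_action G a =
     \<lparr>carrier = carrier G, monoid.mult = monoid.mult G, one = one G, ract = a\<rparr>"

definition rlinear ::
    "('r, 'z) ring_scheme \<Rightarrow> ('m, 'r) rmodule \<Rightarrow> ('n, 'r) rmodule \<Rightarrow> ('m \<Rightarrow> 'n) \<Rightarrow> bool" where
  "rlinear S M N f \<longleftrightarrow>
     f \<in> hom M N \<and> (\<forall>m\<in>carrier M. \<forall>r\<in>carrier S. f (ract M m r) = ract N (f m) r)"

definition rmod_iso ::
    "('r, 'z) ring_scheme \<Rightarrow> ('m, 'r) rmodule \<Rightarrow> ('n, 'r) rmodule \<Rightarrow> bool" where
  "rmod_iso S M N \<longleftrightarrow> (\<exists>f. rlinear S M N f \<and> bij_betw f (carrier M) (carrier N))"

definition rmod_quot :: "('m, 'r) rmodule \<Rightarrow> 'm set \<Rightarrow> ('m set, 'r) rmodule" where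
  "rmod_quot N K = with_action (N Mod K) (\<lambda>c r. coset_map N K (\<lambda>x. ract N x r) c)"

definition rmod_coker ::
    "('m, 'r) rmodule \<Rightarrow> ('n, 'r) rmodule \<Rightarrow> ('m \<Rightarrow> 'n) \<Rightarrow> ('n set, 'r) rmodule" where
  "rmod_coker M N f = rmod_quot N (f ` carrier M)"

text \<open>\<open>H \<otimes> T\<close> over \<open>\<int>\<close>, for an abelian group \<open>H\<close> and a ring \<open>T\<close>.\<close>

definition ext_scalars where
  "ext_scalars H T =
     with_action (ztensor H (add_group T))
       (\<lambda>c t. tensor_lift (ztensor H (add_group T))
                 (\<lambda>h u. tens H (add_group T) {} h (u \<otimes>\<^bsub>T\<^esub> t)) c)"

text \<open>\<open>M \<otimes>\<^sub>S T\<close>, for a right \<open>S\<close>-module \<open>M\<close> and a ring homomorphism \<open>\<phi>\<close> from \<open>S\<close> to \<open>T\<close>.\<close>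

definition balanced_rels where
  "balanced_rels S M \<phi> T =
     {frag_of (ract M m s, t) - frag_of (m, \<phi> s \<otimes>\<^bsub>T\<^esub> t) |m s t.
        m \<in> carrier M \<and> s \<in> carrier S \<and> t \<in> carrier T}"

definition base_change where
  "base_change S M \<phi> T =
     (let B = balanced_rels S M \<phi> T; N = tensor_group M (add_group T) B in
      with_action N (\<lambda>c t. tensor_lift N (\<lambda>m u. tens M (add_group T) B m (u \<otimes>\<^bsub>T\<^esub> t)) c))"

definition base_change_map where
  "base_change_map S N \<phi> T f =
     (let B = balanced_rels S N \<phi> T in
      tensor_lift (tensor_group N (add_group T) B) (\<lambda>m t. tens N (add_group T) B (f m) t))"

text \<open>
  The canonical isomorphism \<open>(H \<otimes> S) \<otimes>\<^sub>S T \<cong> H \<otimes> T\<close>, \<open>h \<otimes> s \<otimes> t \<mapsto> h \<otimes> \<phi> s t\<close>, and the base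
  change of a map \<open>f : H \<otimes> S \<rightarrow> H' \<otimes> S\<close> read as a map \<open>H \<otimes> T \<rightarrow> H' \<otimes> T\<close> through it.
\<close>

definition free_base_change_iso where
  "free_base_change_iso H \<phi> T =
     tensor_lift (ext_scalars H T)
       (\<lambda>m t. ract (ext_scalars H T) (ztensor_map H (add_group T) id \<phi> m) t)"

definition free_base_change_map where
  "free_base_change_map S \<phi> T H H' f =
     free_base_change_iso H' \<phi> T \<circ>
     base_change_map S (ext_scalars H' S) \<phi> T f \<circ>
     inv_into (carrier (base_change S (ext_scalars H S) \<phi> T)) (free_base_change_iso H \<phi> T)"

subsection \<open>Filtrations and associated graded maps\<close>

text \<open>The filtration \<open>M \<sqdot> F^s\<close> of a module \<open>M\<close> induced by a filtration \<open>F\<close> of the ring by ideals.\<close>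

definition mod_filt :: "('m, 'r) rmodule \<Rightarrow> (nat \<Rightarrow> 'r set) \<Rightarrow> nat \<Rightarrow> 'm set" where
  "mod_filt M F s = generate M {ract M m r |m r. m \<in> carrier M \<and> r \<in> F s}"

definition gr_mod :: "('m, 'r) rmodule \<Rightarrow> (nat \<Rightarrow> 'r set) \<Rightarrow> nat \<Rightarrow> 'm set monoid" where
  "gr_mod M F s = M\<lparr>carrier := mod_filt M F s\<rparr> Mod mod_filt M F (Suc s)"

definition gr_map ::
    "('n, 'r) rmodule \<Rightarrow> (nat \<Rightarrow> 'r set) \<Rightarrow> ('m \<Rightarrow> 'n) \<Rightarrow> nat \<Rightarrow> 'm set \<Rightarrow> 'n set" where
  "gr_map N F f s = coset_map N (mod_filt N F (Suc s)) f"

definition gr_map_zero ::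
    "('m, 'r) rmodule \<Rightarrow> ('n, 'r) rmodule \<Rightarrow> (nat \<Rightarrow> 'r set) \<Rightarrow> ('m \<Rightarrow> 'n) \<Rightarrow> bool" where
  "gr_map_zero M N F f \<longleftrightarrow> 
     (\<forall>s. \<forall>c\<in>carrier (gr_mod M F s). gr_map N F f s c = \<one>\<^bsub>gr_mod N F s\<^esub>)"

text \<open>If \<open>gr_map_zero M N F f\<close>, then \<open>f\<close> induces \<open>E1_map N F f s : gr^s M \<rightarrow> gr^(s+1) N\<close>.\<close>

definition E1_map ::
    "('n, 'r) rmodule \<Rightarrow> (nat \<Rightarrow> 'r set) \<Rightarrow> ('m \<Rightarrow> 'n) \<Rightarrow> nat \<Rightarrow> 'm set \<Rightarrow> 'n set" where
  "E1_map N F f s = coset_map N (mod_filt N F (Suc (Suc s))) f"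

text \<open>The canonical map \<open>H \<otimes> gr^s S \<rightarrow> gr^s (H \<otimes> S)\<close>, an isomorphism when \<open>H\<close> is free.\<close>

definition gr_tensor_map where
  "gr_tensor_map S F H s =
     tensor_lift (gr_mod (ext_scalars H S) F s)
       (\<lambda>h c. coset_map (ext_scalars H S) (mod_filt (ext_scalars H S) F (Suc s))
                (\<lambda>r. tens H (add_group S) {} h r) c)"

text \<open>
  For a filtered ring \<open>S\<close> with a map \<open>\<eta> : R \<rightarrow> S\<close> such that \<open>gr^s R = gr^s S\<close>: the identification of
  \<open>H \<otimes> gr^s R\<close> with \<open>gr^s (H \<otimes> S)\<close>, and the map \<open>E1^s f\<close> read as a map
  \<open>H \<otimes> gr^s R \<rightarrow> H' \<otimes> gr^(s+1) R\<close> through it.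
\<close>

definition gr_ident where
  "gr_ident S F \<eta> H s =
     gr_tensor_map S F H s \<circ> ztensor_map H (gr_ring S F s) id (gr_ring_map S F \<eta> s)"

definition E1_tensor where
  "E1_tensor R I S F \<eta> H H' f s =
     inv_into (carrier (ztensor H' (gr_ring R (ideal_pow R I) (Suc s)))) (gr_ident S F \<eta> H' (Suc s)) \<circ>
     E1_map (ext_scalars H' S) F f s \<circ>
     gr_ident S F \<eta> H s"

section \<open>Orlik-Solomon algebras\<close>

text \<open>
  The exterior algebra on a set \<open>S\<close> as a quotient of the tensor algebra, i.e. of the monoid ring of
  words in \<open>S\<close>; \<open>ext_mon S w\<close> is the exterior monomial of the word \<open>w\<close>.
\<close>

definition tensor_algebra :: "'h set \<Rightarrow> ('h list \<Rightarrow>\<^sub>0 int) ring" where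
  "tensor_algebra S = monoid_ring \<lparr>carrier = lists S, monoid.mult = (@), one = []\<rparr>"

definition ext_rels :: "'h set \<Rightarrow> ('h list \<Rightarrow>\<^sub>0 int) set" where
  "ext_rels S =
     Idl\<^bsub>tensor_algebra S\<^esub>
       ({frag_of [a, a] |a. a \<in> S} \<union>
        {frag_of [a, b] + frag_of [b, a] |a b. a \<in> S \<and> b \<in> S})"

definition ext_algebra :: "'h set \<Rightarrow> ('h list \<Rightarrow>\<^sub>0 int) set ring" where
  "ext_algebra S = tensor_algebra S Quot ext_rels S"

definition ext_class :: "'h set \<Rightarrow> ('h list \<Rightarrow>\<^sub>0 int) \<Rightarrow> ('h list \<Rightarrow>\<^sub>0 int) set" where
  "ext_class S t = ext_rels S +>\<^bsub>tensor_algebra S\<^esub> t"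

definition ext_mon :: "'h set \<Rightarrow> 'h list \<Rightarrow> ('h list \<Rightarrow>\<^sub>0 int) set" where
  "ext_mon S w = ext_class S (frag_of w)"

definition ext_degree :: "'h set \<Rightarrow> nat \<Rightarrow> ('h list \<Rightarrow>\<^sub>0 int) set set" where
  "ext_degree S k = ext_class S ` {t. Poly_Mapping.keys t \<subseteq> {w \<in> lists S. length w = k}}"

text \<open>The degree \<open>-1\<close> graded derivation of the exterior algebra sending each generator to \<open>1\<close>.\<close>

definition word_deriv :: "'h list \<Rightarrow> 'h list \<Rightarrow>\<^sub>0 int" where
  "word_deriv w = (\<Sum>i<length w. frag_cmul ((-1) ^ i) (frag_of (take i w @ drop (Suc i) w)))"

definition ext_deriv :: "'h set \<Rightarrow> ('h list \<Rightarrow>\<^sub>0 int) set \<Rightarrow> ('h list \<Rightarrow>\<^sub>0 int) set" where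
  "ext_deriv S c = the_elem ((\<lambda>t. ext_class S (frag_extend word_deriv t)) ` c)"

text \<open>All orderings of a dependent set are used; they give the same generator up to sign.\<close>

definition os_ideal where
  "os_ideal V A =
     Idl\<^bsub>ext_algebra A\<^esub> {ext_deriv A (ext_mon A w) |w.
        distinct w \<and> set w \<subseteq> A \<and> arr_dependent V (set w)}"

definition os_ideal2 where
  "os_ideal2 V A = Idl\<^bsub>ext_algebra A\<^esub> (os_ideal V A \<inter> ext_degree A 2)"

definition quot_degree where
  "quot_degree A J k =
     (add_group (ext_algebra A Quot J))
       \<lparr>carrier := (\<lambda>x. J +>\<^bsub>ext_algebra A\<^esub> x) ` ext_degree A k\<rparr>"

definition ab_rank :: "('g, 'z) monoid_scheme \<Rightarrow> nat" where
  "ab_rank G = Sup {card S |S. finite S \<and> S \<subseteq> carrier G \<and>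
     (\<forall>c :: 'g \<Rightarrow> int. finprod G (\<lambda>x. x [^]\<^bsub>G\<^esub> c x) S = \<one>\<^bsub>G\<^esub> \<longrightarrow> (\<forall>x\<in>S. c x = 0))}"

definition os_invariant :: "(complex ^ 'n) set \<Rightarrow> (complex ^ 'n) set set \<Rightarrow> enat" where
  "os_invariant V A = Sup {enat s |s. \<forall>t\<le>s.
     ab_rank (quot_degree A (os_ideal V A) t) = ab_rank (quot_degree A (os_ideal2 V A) t)}"

section \<open>Supersolvable deformations\<close>

definition supersolvable_deformation where
  "supersolvable_deformation V A W Ah p \<longleftrightarrow>
     arrangement W Ah \<and> supersolvable W Ah \<and> V \<subseteq> W \<and>
     bij_betw (\<lambda>H. H \<inter> V) Ah A \<and>
     (\<forall>Z\<in>carrier (intersection_lattice W Ah). codim_in W Z \<le> p + 1 \<longrightarrow>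
        codim_in V (Z \<inter> V) = codim_in W Z)"

definition lifted_hyperplane where
  "lifted_hyperplane V Ah H = inv_into Ah (\<lambda>K. K \<inter> V) H"

section \<open>Homotopy groups\<close>

definition fundamental_group :: "'a::topological_space set \<Rightarrow> 'a \<Rightarrow> (real \<Rightarrow> 'a) set monoid" where
  "fundamental_group X x0 =
     \<lparr>carrier = {{h. homotopic_paths X g h} |g.
        path g \<and> path_image g \<subseteq> X \<and> pathstart g = x0 \<and> pathfinish g = x0},
      monoid.mult = (\<lambda>a b. {h. \<exists>f\<in>a. \<exists>g\<in>b. homotopic_paths X (f +++ g) h}),
      one = {h. homotopic_paths X (\<lambda>_. x0) h}\<rparr>"

text \<open>The \<open>n\<close>-cube inside the product topology on \<open>nat \<Rightarrow> real\<close>, like the library's standard simplices.\<close>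

definition std_cube :: "nat \<Rightarrow> (nat \<Rightarrow> real) set" where
  "std_cube n = {x. (\<forall>i<n. 0 \<le> x i \<and> x i \<le> 1) \<and> (\<forall>i\<ge>n. x i = 0)}"

definition cube_boundary :: "nat \<Rightarrow> (nat \<Rightarrow> real) set" where
  "cube_boundary n = {x \<in> std_cube n. \<exists>i<n. x i = 0 \<or> x i = 1}"

definition cube_homotopic where
  "cube_homotopic n X x0 =
     homotopic_with (\<lambda>f. \<forall>x\<in>cube_boundary n. f x = x0)
       (subtopology (powertop_real UNIV) (std_cube n)) (top_of_set X)"

definition cube_concat :: "((nat \<Rightarrow> real) \<Rightarrow> 'a) \<Rightarrow> ((nat \<Rightarrow> real) \<Rightarrow> 'a) \<Rightarrow> (nat \<Rightarrow> real) \<Rightarrow> 'a" where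
  "cube_concat f g x =
     (if x 0 \<le> 1/2 then f (x(0 := 2 * x 0)) else g (x(0 := 2 * x 0 - 1)))"

definition homotopy_group ::
    "nat \<Rightarrow> 'a::topological_space set \<Rightarrow> 'a \<Rightarrow> ((nat \<Rightarrow> real) \<Rightarrow> 'a) set monoid" where
  "homotopy_group n X x0 =
     \<lparr>carrier = {{h. cube_homotopic n X x0 f h} |f.
        continuous_map (subtopology (powertop_real UNIV) (std_cube n)) (top_of_set X) f \<and>
        (\<forall>x\<in>cube_boundary n. f x = x0)},
      monoid.mult = (\<lambda>a b. {h. \<exists>f\<in>a. \<exists>g\<in>b. cube_homotopic n X x0 (cube_concat f g) h}),
      one = {h. cube_homotopic n X x0 (\<lambda>x. x0) h}\<rparr>"

text \<open>
  The right action of the fundamental group: \<open>f\<close> is put on the concentric cube of half the size, and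
  the loop \<open>g\<close> runs outwards on the radial segments from there to the boundary. This is the class
  at the end of a free homotopy starting at \<open>f\<close> that moves the boundary along \<open>g\<close>.
\<close>

definition cube_act ::
    "nat \<Rightarrow> ((nat \<Rightarrow> real) \<Rightarrow> 'a) \<Rightarrow> (real \<Rightarrow> 'a) \<Rightarrow> (nat \<Rightarrow> real) \<Rightarrow> 'a" where
  "cube_act n f g x =
     (let r = Max ((\<lambda>i. \<bar>2 * x i - 1\<bar>) ` {..<n}) in
      if r \<le> 1/2 then f (\<lambda>i. if i < n then 2 * x i - 1/2 else 0) else g (2 * r - 1))"

definition homotopy_act where
  "homotopy_act n X x0 a b = {h. \<exists>f\<in>a. \<exists>g\<in>b. cube_homotopic n X x0 (cube_act n f g) h}"

definition homotopy_module ::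
    "nat \<Rightarrow> 'a::topological_space set \<Rightarrow> 'a \<Rightarrow>
     (((nat \<Rightarrow> real) \<Rightarrow> 'a) set, (real \<Rightarrow> 'a) set \<Rightarrow>\<^sub>0 int) rmodule" where
  "homotopy_module n X x0 =
     with_action (homotopy_group n X x0)
       (\<lambda>a r. free_ext (homotopy_group n X x0) (homotopy_act n X x0 a) r)"

section \<open>Homology and the linear part of the boundary\<close>

abbreviation homol where "homol k Y \<equiv> homology_group (int k) (top_of_set Y)"

abbreviation rel_homol where "rel_homol k Y X \<equiv> relative_homology_group (int k) (top_of_set Y) X"

abbreviation rel_proj where
  "rel_proj k Y X \<equiv> hom_induced (int k) (top_of_set Y) {} (top_of_set Y) X id"

definition path_simplex :: "(real \<Rightarrow> 'a) \<Rightarrow> (nat \<Rightarrow> real) \<Rightarrow> 'a" where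
  "path_simplex g = restrict (\<lambda>x. g (x 1)) (standard_simplex 1)"

definition hurewicz :: "'a::topological_space set \<Rightarrow> (real \<Rightarrow> 'a) set \<Rightarrow> 'a chain set" where
  "hurewicz Y a =
     the_elem ((\<lambda>g. homologous_rel_set 1 (top_of_set Y) {} (frag_of (path_simplex g))) ` a)"

text \<open>
  The isomorphism \<open>I / I^2 \<cong> H\<^sub>1 Y\<close>, \<open>[a] - 1 \<mapsto> hurewicz Y a\<close>, where \<open>I\<close> is the augmentation ideal of
  the group ring of the fundamental group of a subspace of \<open>Y\<close> with the same fundamental group.
\<close>

definition gr1_to_H1 where
  "gr1_to_H1 Y c = the_elem (free_ext (homol 1 Y) (hurewicz Y) ` c)"

text \<open>Integral singular cochains, as functions on singular simplices, and their cup product.\<close>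

definition cochain_eval :: "(((nat \<Rightarrow> real) \<Rightarrow> 'a) \<Rightarrow> int) \<Rightarrow> 'a chain \<Rightarrow> int" where
  "cochain_eval \<phi> z = (\<Sum>\<sigma>\<in>Poly_Mapping.keys z. Poly_Mapping.lookup z \<sigma> * \<phi> \<sigma>)"

definition cup :: "nat \<Rightarrow> nat \<Rightarrow> (((nat \<Rightarrow> real) \<Rightarrow> 'a) \<Rightarrow> int) \<Rightarrow> (((nat \<Rightarrow> real) \<Rightarrow> 'a) \<Rightarrow> int) \<Rightarrow>
    ((nat \<Rightarrow> real) \<Rightarrow> 'a) \<Rightarrow> int" where
  "cup k l \<phi> \<psi> \<sigma> =
     \<phi> (restrict \<sigma> (standard_simplex k)) *
     \<psi> (restrict (\<lambda>x. \<sigma> (\<lambda>i. if i < k then 0 else x (i - k))) (standard_simplex l))"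

primrec cup_word :: "('h \<Rightarrow> ((nat \<Rightarrow> real) \<Rightarrow> 'a) \<Rightarrow> int) \<Rightarrow> 'h list \<Rightarrow> ((nat \<Rightarrow> real) \<Rightarrow> 'a) \<Rightarrow> int" where
  "cup_word c [] = (\<lambda>_. 1)"
| "cup_word c (h # w) = cup 1 (length w) (c h) (cup_word c w)"

definition class_eval :: "(((nat \<Rightarrow> real) \<Rightarrow> 'a) \<Rightarrow> int) \<Rightarrow> 'a chain set \<Rightarrow> int" where
  "class_eval \<phi> x = the_elem (cochain_eval \<phi> ` x)"

text \<open>
  \<open>c\<close> is an integral cocycle on \<open>Y\<close> in the class of \<open>d\<alpha> / (2\<pi>\<i> \<alpha>)\<close>, where \<open>\<alpha>\<close> is a linear form
  defining the hyperplane \<open>H\<close> of \<open>W\<close>.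
\<close>

definition log_cocycle ::
    "(complex ^ 'n) set \<Rightarrow> (complex ^ 'n) set \<Rightarrow> (complex ^ 'n) set \<Rightarrow>
     (((nat \<Rightarrow> real) \<Rightarrow> complex ^ 'n) \<Rightarrow> int) \<Rightarrow> bool" where
  "log_cocycle W Y H c \<longleftrightarrow>
     (\<forall>\<sigma>. singular_simplex 2 (top_of_set Y) \<sigma> \<longrightarrow> 
        cochain_eval c (chain_boundary 2 (frag_of \<sigma>)) = 0) \<and>
     (\<exists>\<alpha>. Vector_Spaces.linear (*s) (*) \<alpha> \<and> {x \<in> W. \<alpha> x = 0} = H \<and>
        (\<forall>g. path g \<and> path_image g \<subseteq> Y \<and> pathfinish g = pathstart g \<longrightarrow>
           of_int (c (path_simplex g)) = winding_number (\<alpha> \<circ> g) 0))"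

text \<open>
  The identification of the degree \<open>k\<close> part of the quadratic Orlik-Solomon algebra of \<open>A\<close> with
  \<open>H^k Y = Hom (H\<^sub>k Y, \<int>)\<close>: the algebra isomorphism sending each generator \<open>H\<close> to the class of the
  logarithmic form of the hyperplane of \<open>Ah\<close> lifting \<open>H\<close>. An element \<open>u\<close> of the quotient algebra
  is a set of elements of the exterior algebra, hence \<open>\<Union>u\<close> is its set of representatives in
  the tensor algebra.
\<close>

definition os_cohomology where
  "os_cohomology V W Ah k u x =
     (let c = (\<lambda>H. SOME c. log_cocycle W (arr_complement W Ah) (lifted_hyperplane V Ah H) c) in
      the_elem ((\<lambda>t. \<Sum>w\<in>Poly_Mapping.keys t. Poly_Mapping.lookup t w * class_eval (cup_word c w) x) `
                {t \<in> \<Union>u. Poly_Mapping.keys t \<subseteq> {w. length w = k}}))"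

text \<open>\<open>d : H\<^sub>k\<^sub>+\<^sub>1 Y \<rightarrow> H\<^sub>k Y \<otimes> H\<^sub>1 Y\<close> is, up to sign, dual to the multiplication of the quadratic
  Orlik-Solomon algebra.\<close>

definition dual_to_multiplication where
  "dual_to_multiplication V A W Ah k d \<longleftrightarrow>
     (let Y = arr_complement W Ah; J = os_ideal2 V A; \<theta> = os_cohomology V W Ah in
      d \<in> hom (homol (Suc k) Y) (ztensor (homol k Y) (homol 1 Y)) \<and>
      (\<exists>\<epsilon>\<in>{1, -1}. \<forall>u\<in>carrier (quot_degree A J k). \<forall>v\<in>carrier (quot_degree A J 1).
         \<forall>x\<in>carrier (homol (Suc k) Y).
           tensor_lift integer_group (\<lambda>a b. \<theta> k u a * \<theta> 1 v b) (d x) =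
           \<epsilon> * \<theta> (Suc k) (u \<otimes>\<^bsub>ext_algebra A Quot J\<^esub> v) x))"

end

theory Submission
  imports Defs
begin

text \<open>
  Call a semilinear surjection \<open>\<pi>: M \<rightarrow> M'\<close> over a surjective ring map \<open>S \<rightarrow> S'\<close> with kernel \<open>J\<close> a reduction
  if its kernel is \<open>M \<sqdot> J\<close>. For the projection from the completion to \<open>R / I^q\<close>, both \<open>H \<otimes> S \<rightarrow> H \<otimes> S'\<close> and
  \<open>\<pi>\<^sub>p \<otimes> S \<rightarrow> \<pi>\<^sub>p \<otimes> S'\<close> are reductions, and reductions pass to cokernels. A reduction of \<open>M\<close> is determined
  by \<open>M\<close> up to isomorphism, so the presentation of \<open>\<pi>\<^sub>p \<otimes> S\<close> as \<open>coker D\<close> descends to \<open>R / I^q\<close>. The statements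
  on associated gradeds hold because the reductions map \<open>M \<sqdot> F^s\<close> onto \<open>M' \<sqdot> F'^s\<close> and their kernel lies in
  \<open>M \<sqdot> F^s\<close> for \<open>s \<le> q\<close>.

  Topology enters only through the fact that \<open>\<pi>\<^sub>p\<close> is an abelian group with an action of the group ring,
  which needs \<open>p \<ge> 2\<close>: the Orlik-Solomon ideal is generated in degrees at least 2.
\<close>

subsection \<open>Tensor products of abelian groups\<close>

text \<open>The textbook route iterates base change and invokes associativity and right exactness of
  the tensor product. Here one computation of a kernel replaces both: for a surjection \<rho> with
  kernel J, an arbitrary set-theoretic section of \<rho> gives a map back from the tensor product
  over the target to the quotient of the tensor product over the source by the span of J, and this
  forces the kernel to be exactly that span. The argument covers H \<otimes> S and the balanced
  product alike, because balancing is a set of identified pairs of pure tensors that lifts along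
  \<rho>.

  The encoding shapes the rest. Maps on quotients are given by the common value on a coset, so each
  must be shown constant on cosets before it can be computed. Inverses of canonical identifications
  are taken by \<open>inv_into\<close>, so the arguments follow whichever preimage is chosen.
  Finally, R / I^q is a filtered quotient both of R and of the completion: the first view identifies
  the graded pieces of the ring, the second carries D.\<close>

lemma coset_const:
  assumes "group G" "subgroup N G" "h \<in> hom G L" "group L" "\<And>n. n \<in> N \<Longrightarrow> h n = \<one>\<^bsub>L\<^esub>"
    and "x \<in> carrier G" "y \<in> N #>\<^bsub>G\<^esub> x"
  shows "h y = h x"
proof -
  obtain n where n: "n \<in> N" "y = n \<otimes>\<^bsub>G\<^esub> x"
    using assms(7) by (auto simp: r_coset_def)
  have "n \<in> carrier G"
    using n(1) assms(2) subgroup.mem_carrier by metis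
  moreover have "h x \<in> carrier L"
    using assms by (meson hom_in_carrier)
  ultimately show ?thesis
    using n assms by (simp add: hom_mult group.is_monoid monoid.l_one)
qed

lemma the_elem_coset:
  assumes "group G" "subgroup N G" "x \<in> carrier G" "\<And>y. y \<in> N #>\<^bsub>G\<^esub> x \<Longrightarrow> h y = h x"
  shows "the_elem (h ` (N #>\<^bsub>G\<^esub> x)) = h x"
proof -
  have "h ` (N #>\<^bsub>G\<^esub> x) = (\<lambda>_. h x) ` (N #>\<^bsub>G\<^esub> x)"
    by (rule image_cong[OF refl assms(4)])
  also have "\<dots> = {h x}"
    using group.rcos_self[OF assms(1,3,2)] by auto
  finally have "h ` (N #>\<^bsub>G\<^esub> x) = {h x}" .
  then show ?thesis by simp
qed

lemma coset_hom:
  assumes "comm_group G" "subgroup N G"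
  shows "(\<lambda>x. N #>\<^bsub>G\<^esub> x) \<in> hom G (G Mod N)"
  using comm_group.subgroup_imp_normal[OF assms] normal.r_coset_hom_Mod by blast

lemma induced_hom:
  assumes "comm_group G" "subgroup N G" "h \<in> hom G L" "group L" "\<And>n. n \<in> N \<Longrightarrow> h n = \<one>\<^bsub>L\<^esub>"
  shows "(\<lambda>c. the_elem (h ` c)) \<in> hom (G Mod N) L"
    and "x \<in> carrier G \<Longrightarrow> the_elem (h ` (N #>\<^bsub>G\<^esub> x)) = h x"
proof -
  interpret comm_group G by fact
  note nor = subgroup_imp_normal[OF assms(2)]
  have e: "the_elem (h ` (N #>\<^bsub>G\<^esub> x)) = h x" if "x \<in> carrier G" for x
    by (rule the_elem_coset[OF group_axioms assms(2) that])
       (rule coset_const[OF group_axioms assms(2-5) that])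
  then show "x \<in> carrier G \<Longrightarrow> the_elem (h ` (N #>\<^bsub>G\<^esub> x)) = h x" .
  show "(\<lambda>c. the_elem (h ` c)) \<in> hom (G Mod N) L"
  proof (rule homI)
    fix c assume "c \<in> carrier (G Mod N)"
    then show "the_elem (h ` c) \<in> carrier L"
      using e assms(3) by (auto simp: carrier_FactGroup hom_in_carrier)
  next
    fix c d assume "c \<in> carrier (G Mod N)" "d \<in> carrier (G Mod N)"
    then obtain x y where xy: "x \<in> carrier G" "y \<in> carrier G" "c = N #>\<^bsub>G\<^esub> x" "d = N #>\<^bsub>G\<^esub> y"
      by (auto simp: carrier_FactGroup)
    show "the_elem (h ` (c \<otimes>\<^bsub>G Mod N\<^esub> d)) = the_elem (h ` c) \<otimes>\<^bsub>L\<^esub> the_elem (h ` d)"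
      using xy e[OF xy(1)] e[OF xy(2)] e[of "x \<otimes>\<^bsub>G\<^esub> y"] assms(3) normal.rcos_sum[OF nor xy(1,2)]
      by (simp add: hom_mult)
  qed
qed

lemma free_ext_hom:
  assumes "comm_group G" "\<And>x. x \<in> S \<Longrightarrow> f x \<in> carrier G"
  shows "free_ext G f \<in> hom (free_Abelian_group S) G"
    and "x \<in> S \<Longrightarrow> free_ext G f (frag_of x) = f x"
proof -
  interpret comm_group G by fact
  let ?g = "\<lambda>t x. f x [^]\<^bsub>G\<^esub> Poly_Mapping.lookup t x"
  \<comment> \<open>The product over \<open>keys\<close> may be taken over any larger finite set,
    the extra exponents being 0. So \<open>s\<close>, \<open>t\<close> and \<open>s + t\<close> can
    all be multiplied over the union of the supports, although cancellation may shrink the support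
    of the sum.\<close>
  have ext: "free_ext G f t = finprod G (?g t) A"
    if "finite A" "A \<subseteq> S" "Poly_Mapping.keys t \<subseteq> A" for t A
    unfolding free_ext_def
    by (rule finprod_mono_neutral_cong_left)
       (use that assms in \<open>auto simp: in_keys_iff\<close>)
  show "free_ext G f \<in> hom (free_Abelian_group S) G"
  proof (rule homI)
    fix s assume "s \<in> carrier (free_Abelian_group S)"
    then show "free_ext G f s \<in> carrier G"
      unfolding free_ext_def using assms(2) by (auto intro!: finprod_closed)
  next
    fix s t assume st: "s \<in> carrier (free_Abelian_group S)" "t \<in> carrier (free_Abelian_group S)"
    let ?A = "Poly_Mapping.keys s \<union> Poly_Mapping.keys t"
    have "free_ext G f (s + t) = finprod G (?g (s + t)) ?A"
      using st keys_add[of s t] by (intro ext) auto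
    also have "\<dots> = finprod G (\<lambda>x. ?g s x \<otimes>\<^bsub>G\<^esub> ?g t x) ?A"
      using st assms(2) by (intro finprod_cong') (auto simp: lookup_add int_pow_mult)
    also have "\<dots> = finprod G (?g s) ?A \<otimes>\<^bsub>G\<^esub> finprod G (?g t) ?A"
      using st assms(2) by (intro finprod_multf) auto
    also have "\<dots> = free_ext G f s \<otimes>\<^bsub>G\<^esub> free_ext G f t"
      using st ext[of ?A s] ext[of ?A t] by simp
    finally show "free_ext G f (s \<otimes>\<^bsub>free_Abelian_group S\<^esub> t) = free_ext G f s \<otimes>\<^bsub>G\<^esub> free_ext G f t"
      by simp
  qed
  show "free_ext G f (frag_of x) = f x" if "x \<in> S"
    using that assms(2)[OF that] by (simp add: free_ext_def keys_frag_of finprod_singleton)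
qed

lemma hom_diff_free:
  assumes "group G" "h \<in> hom (free_Abelian_group S) G" "Poly_Mapping.keys x \<subseteq> S" "Poly_Mapping.keys y \<subseteq> S"
  shows "h (x - y) = h x \<otimes>\<^bsub>G\<^esub> inv\<^bsub>G\<^esub> h y"
proof -
  interpret group_hom "free_Abelian_group S" G h
    using assms by (simp add: group_hom.intro group_hom_axioms.intro)
  have "h (x - y) = h (x \<otimes>\<^bsub>free_Abelian_group S\<^esub> inv\<^bsub>free_Abelian_group S\<^esub> y)"
    using assms by simp
  also have "\<dots> = h x \<otimes>\<^bsub>G\<^esub> h (inv\<^bsub>free_Abelian_group S\<^esub> y)"
    by (rule hom_mult) (use assms in auto)
  also have "h (inv\<^bsub>free_Abelian_group S\<^esub> y) = inv\<^bsub>G\<^esub> h y"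
    by (rule hom_inv) (use assms in auto)
  finally show ?thesis .
qed

lemma hom_free_eq:
  assumes "group G" "h \<in> hom (free_Abelian_group S) G" "k \<in> hom (free_Abelian_group S) G"
    and "\<And>x. x \<in> S \<Longrightarrow> h (frag_of x) = k (frag_of x)" and "Poly_Mapping.keys t \<subseteq> S"
  shows "h t = k t"
  using assms(5)
proof (rule free_Abelian_group_induct)
  show "h 0 = k 0"
    using hom_one[OF assms(2)] hom_one[OF assms(3)] assms(1) by simp
  show "h (x - y) = k (x - y)"
    if "Poly_Mapping.keys x \<subseteq> S" "Poly_Mapping.keys y \<subseteq> S" "h x = k x" "h y = k y" for x y
    using that hom_diff_free[OF assms(1,2)] hom_diff_free[OF assms(1,3)] by simp
qed (use assms in auto)

lemma hom_generate_trivial: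
  assumes "group G" "group L" "h \<in> hom G L" "T \<subseteq> carrier G" "\<And>t. t \<in> T \<Longrightarrow> h t = \<one>\<^bsub>L\<^esub>"
    and "x \<in> generate G T"
  shows "h x = \<one>\<^bsub>L\<^esub>"
proof -
  interpret group_hom G L h
    using assms by (simp add: group_hom.intro group_hom_axioms.intro)
  have "generate G T \<subseteq> kernel G L h"
    by (rule G.generate_subgroup_incl[OF _ subgroup_kernel]) (use assms in \<open>auto simp: kernel_def\<close>)
  then show ?thesis using assms(6) by (auto simp: kernel_def)
qed

text \<open>
  The relations \<open>B\<close> of \<open>tensor_group\<close> identify generators in pairs; \<open>E\<close> is the set of these pairs.
\<close>

definition pair_rels :: "(('m \<times> 'n) \<times> ('m \<times> 'n)) set \<Rightarrow> ('m \<times> 'n \<Rightarrow>\<^sub>0 int) set" where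
  "pair_rels E = {frag_of (m, n) - frag_of (m', n') |m n m' n'. ((m, n), (m', n')) \<in> E}"

text \<open>Closure under the two operations puts the bilinear relations into the free abelian group
  on \<open>carrier M \<times> carrier N\<close>. The tensor group is abelian as a quotient of that
  free group, so the locale serves alike for homology groups, homotopy groups, additive groups of
  rings and graded pieces.\<close>

locale tensor_pair =
  fixes M :: "('m, 'y) monoid_scheme" and N :: "('n, 'z) monoid_scheme"
    and E :: "(('m \<times> 'n) \<times> ('m \<times> 'n)) set"
  assumes M_closed: "m \<in> carrier M \<Longrightarrow> m' \<in> carrier M \<Longrightarrow> m \<otimes>\<^bsub>M\<^esub> m' \<in> carrier M"
    and N_closed: "n \<in> carrier N \<Longrightarrow> n' \<in> carrier N \<Longrightarrow> n \<otimes>\<^bsub>N\<^esub> n' \<in> carrier N"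
    and E_carrier: "E \<subseteq> (carrier M \<times> carrier N) \<times> (carrier M \<times> carrier N)"
begin

abbreviation "B \<equiv> pair_rels E"
abbreviation "FG \<equiv> free_Abelian_group (carrier M \<times> carrier N)"
abbreviation "TG \<equiv> tensor_group M N B"
abbreviation "tn \<equiv> tens M N B"
abbreviation "cls t \<equiv> tensor_rels M N B #>\<^bsub>FG\<^esub> t"

lemma rels_carrier: "bilinear_rels M N \<union> B \<subseteq> carrier FG"
proof -
  have 2: "Poly_Mapping.keys (frag_of a - frag_of b) \<subseteq> carrier M \<times> carrier N"
    if "a \<in> carrier M \<times> carrier N" "b \<in> carrier M \<times> carrier N" for a b
    using keys_diff[of "frag_of a" "frag_of b"] that by (auto simp: keys_frag_of)
  have 3: "Poly_Mapping.keys (frag_of a - frag_of b - frag_of c) \<subseteq> carrier M \<times> carrier N"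
    if "a \<in> carrier M \<times> carrier N" "b \<in> carrier M \<times> carrier N" "c \<in> carrier M \<times> carrier N" for a b c
    using keys_diff[of "frag_of a - frag_of b" "frag_of c"] 2[OF that(1,2)] that(3)
    by (auto simp: keys_frag_of)
  show ?thesis
  proof
    fix r assume "r \<in> bilinear_rels M N \<union> B"
    then show "r \<in> carrier FG"
      unfolding bilinear_rels_def pair_rels_def carrier_free_Abelian_group_iff
      using E_carrier by (elim UnE CollectE exE conjE; hypsubst; intro 2 3) (auto intro: M_closed N_closed)
  qed
qed

lemma FG_comm: "comm_group FG"
  by (rule abelian_free_Abelian_group)

lemma rels_subgroup: "subgroup (tensor_rels M N B) FG"
  unfolding tensor_rels_def
  by (rule group.generate_is_subgroup[OF group_free_Abelian_group rels_carrier])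

lemma TG_comm: "comm_group TG"
  unfolding tensor_group_def by (rule comm_group.abelian_FactGroup[OF FG_comm rels_subgroup])

lemma TG_group: "group TG"
  by (rule comm_group.axioms(2)[OF TG_comm])

lemma coset_TG_hom: "(\<lambda>t. cls t) \<in> hom FG TG"
  unfolding tensor_group_def by (rule coset_hom[OF FG_comm rels_subgroup])

lemma carrier_TG: "carrier TG = (\<lambda>t. cls t) ` carrier FG"
  by (simp add: tensor_group_def carrier_FactGroup)

lemma tens_closed: "m \<in> carrier M \<Longrightarrow> n \<in> carrier N \<Longrightarrow> tn m n \<in> carrier TG"
  unfolding tens_def by (rule hom_in_carrier[OF coset_TG_hom]) simp

lemma coset_rel:
  assumes "r \<in> bilinear_rels M N \<union> B"
  shows "cls r = \<one>\<^bsub>TG\<^esub>"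
proof -
  have "r \<in> tensor_rels M N B"
    unfolding tensor_rels_def using assms by (auto intro: generate.incl)
  then show ?thesis
    using subgroup.rcos_const[OF rels_subgroup group_free_Abelian_group]
    by (simp add: tensor_group_def)
qed

text \<open>Turns a relation written as a difference into an equation of classes. \<open>b\<close>
  may be a combination of several generators, which is what the three-term bilinear relations
  require.\<close>

lemma coset_diff:
  assumes "a \<in> carrier M \<times> carrier N" "b \<in> carrier FG"
    and "cls (b - frag_of a) = \<one>\<^bsub>TG\<^esub>"
  shows "cls b = tn (fst a) (snd a)"
proof -
  interpret TG: group TG by (rule TG_group)
  have "cls b \<otimes>\<^bsub>TG\<^esub> inv\<^bsub>TG\<^esub> (tn (fst a) (snd a)) = \<one>\<^bsub>TG\<^esub>"
    using hom_diff_free[OF TG_group coset_TG_hom, of b "frag_of a"] assms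
    by (simp add: tens_def keys_frag_of del: set_mult_consistent)
  moreover have "cls b \<in> carrier TG"
    using assms(2) carrier_TG by blast
  moreover have "tn (fst a) (snd a) \<in> carrier TG"
    using assms(1) by (auto intro: tens_closed)
  ultimately show ?thesis
    by (metis TG.inv_closed TG.inv_equality TG.inv_inv)
qed

lemma tens_rel:
  assumes "((m, n), (m', n')) \<in> E"
  shows "tn m n = tn m' n'"
proof -
  have "frag_of (m, n) - frag_of (m', n') \<in> B"
    using assms by (auto simp: pair_rels_def)
  moreover have "(m, n) \<in> carrier M \<times> carrier N" "(m', n') \<in> carrier M \<times> carrier N"
    using assms E_carrier by auto
  ultimately show ?thesis
    using coset_diff[of "(m', n')" "frag_of (m, n)"] coset_rel[of "frag_of (m, n) - frag_of (m', n')"]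
    by (simp add: tens_def keys_frag_of)
qed

text \<open>Additivity in either argument is a relation of the shape c - a - b, so one argument
  serves both.\<close>

lemma coset_bilinear:
  assumes "frag_of c - frag_of a - frag_of b \<in> bilinear_rels M N"
    and "a \<in> carrier M \<times> carrier N" "b \<in> carrier M \<times> carrier N" "c \<in> carrier M \<times> carrier N"
  shows "cls (frag_of c) = cls (frag_of a) \<otimes>\<^bsub>TG\<^esub> cls (frag_of b)"
proof -
  have k: "Poly_Mapping.keys (frag_of c - frag_of a) \<subseteq> carrier M \<times> carrier N"
    using keys_diff[of "frag_of c" "frag_of a"] assms by (auto simp: keys_frag_of)
  have "cls (frag_of c - frag_of a - frag_of b) = \<one>\<^bsub>TG\<^esub>"
    using assms(1) by (intro coset_rel) auto
  then have "cls (frag_of c - frag_of a) = cls (frag_of b)"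
    using coset_diff[of b "frag_of c - frag_of a"] assms(3) k by (simp add: tens_def)
  then show ?thesis
    using hom_mult[OF coset_TG_hom, of "frag_of a" "frag_of c - frag_of a"] k assms(2) by (simp add: keys_frag_of)
qed

lemma tens_add_left:
  assumes "m \<in> carrier M" "m' \<in> carrier M" "n \<in> carrier N"
  shows "tn (m \<otimes>\<^bsub>M\<^esub> m') n = tn m n \<otimes>\<^bsub>TG\<^esub> tn m' n"
  unfolding tens_def
  by (rule coset_bilinear) (use assms M_closed in \<open>auto simp: bilinear_rels_def\<close>)

lemma tens_add_right:
  assumes "m \<in> carrier M" "n \<in> carrier N" "n' \<in> carrier N"
  shows "tn m (n \<otimes>\<^bsub>N\<^esub> n') = tn m n \<otimes>\<^bsub>TG\<^esub> tn m n'"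
  unfolding tens_def
  by (rule coset_bilinear) (use assms N_closed in \<open>auto simp: bilinear_rels_def\<close>)

lemma tensor_hom_eq:
  assumes "group L" "h \<in> hom TG L" "k \<in> hom TG L"
    and "\<And>m n. m \<in> carrier M \<Longrightarrow> n \<in> carrier N \<Longrightarrow> h (tn m n) = k (tn m n)"
    and "c \<in> carrier TG"
  shows "h c = k c"
proof -
  obtain t where t: "Poly_Mapping.keys t \<subseteq> carrier M \<times> carrier N" "c = cls t"
    using assms(5) carrier_TG by auto
  have "(h \<circ> (\<lambda>t. cls t)) t = (k \<circ> (\<lambda>t. cls t)) t"
    by (rule hom_free_eq[OF assms(1) hom_compose[OF coset_TG_hom assms(2)]
            hom_compose[OF coset_TG_hom assms(3)] _ t(1)])
       (use assms(4) in \<open>auto simp: tens_def\<close>)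
  then show ?thesis using t by simp
qed

text \<open>Meant for \<open>U\<close> the image of a homomorphism, where it reduces surjectivity
  onto a tensor product to pure tensors.\<close>

lemma tensor_subgroup:
  assumes "subgroup U TG" "\<And>m n. m \<in> carrier M \<Longrightarrow> n \<in> carrier N \<Longrightarrow> tn m n \<in> U"
  shows "carrier TG \<subseteq> U"
proof
  fix c assume "c \<in> carrier TG"
  then obtain t where t: "Poly_Mapping.keys t \<subseteq> carrier M \<times> carrier N" "c = cls t"
    using carrier_TG by auto
  interpret TG: group TG by (rule TG_group)
  from t(1) have "cls t \<in> U"
  proof (rule free_Abelian_group_induct)
    show "cls 0 \<in> U"
      using hom_one[OF coset_TG_hom] subgroup.one_closed[OF assms(1)] by (simp add: TG_group)
  next
    fix x y assume a: "Poly_Mapping.keys x \<subseteq> carrier M \<times> carrier N" "Poly_Mapping.keys y \<subseteq> carrier M \<times> carrier N"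
      "cls x \<in> U" "cls y \<in> U"
    show "cls (x - y) \<in> U"
      unfolding hom_diff_free[OF TG_group coset_TG_hom a(1,2)]
      by (intro subgroup.m_closed[OF assms(1)] subgroup.m_inv_closed[OF assms(1)] a)
  next
    fix a assume "a \<in> carrier M \<times> carrier N"
    then show "cls (frag_of a) \<in> U"
      using assms(2)[of "fst a" "snd a"] by (auto simp: tens_def)
  qed
  then show "c \<in> U" using t by simp
qed

text \<open>The universal property. Bilinearity makes the linear extension of \<open>f\<close> kill
  the bilinear relations, and agreement on the pairs in \<open>E\<close> makes it kill
  \<open>B\<close>. It is then constant on the cosets, so the \<open>the_elem\<close> in the
  definition of the lift returns its value on any representative.\<close>

lemma tensor_lift:
  assumes "comm_group L"
    and cl: "\<And>m n. m \<in> carrier M \<Longrightarrow> n \<in> carrier N \<Longrightarrow> f m n \<in> carrier L"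
    and left: "\<And>m m' n. m \<in> carrier M \<Longrightarrow> m' \<in> carrier M \<Longrightarrow> n \<in> carrier N \<Longrightarrow>
      f (m \<otimes>\<^bsub>M\<^esub> m') n = f m n \<otimes>\<^bsub>L\<^esub> f m' n"
    and right: "\<And>m n n'. m \<in> carrier M \<Longrightarrow> n \<in> carrier N \<Longrightarrow> n' \<in> carrier N \<Longrightarrow>
      f m (n \<otimes>\<^bsub>N\<^esub> n') = f m n \<otimes>\<^bsub>L\<^esub> f m n'"
    and rel: "\<And>m n m' n'. ((m, n), (m', n')) \<in> E \<Longrightarrow> f m n = f m' n'"
  shows "tensor_lift L f \<in> hom TG L"
    and "m \<in> carrier M \<Longrightarrow> n \<in> carrier N \<Longrightarrow> tensor_lift L f (tn m n) = f m n"
proof -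
  interpret L: comm_group L by fact
  let ?F = "free_ext L (\<lambda>(m, n). f m n)"
  have F: "?F \<in> hom FG L"
    by (rule free_ext_hom) (use assms in auto)
  have Fx: "?F (frag_of (m, n)) = f m n" if "m \<in> carrier M" "n \<in> carrier N" for m n
    using free_ext_hom(2)[OF assms(1), of "carrier M \<times> carrier N" "\<lambda>(m, n). f m n" "(m, n)"] that cl by auto
  have gen: "?F r = \<one>\<^bsub>L\<^esub>" if "r \<in> bilinear_rels M N \<union> B" for r
  proof -
    have d: "?F (frag_of (m, n) - frag_of (m', n')) = f m n \<otimes>\<^bsub>L\<^esub> inv\<^bsub>L\<^esub> f m' n'"
      if "m \<in> carrier M" "n \<in> carrier N" "m' \<in> carrier M" "n' \<in> carrier N" for m n m' n'
      using hom_diff_free[OF L.is_group F, of "frag_of (m, n)" "frag_of (m', n')"] that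
      by (simp add: keys_frag_of Fx)
    have d3: "?F (frag_of (m, n) - frag_of (m', n') - frag_of (m'', n'')) =
        f m n \<otimes>\<^bsub>L\<^esub> inv\<^bsub>L\<^esub> f m' n' \<otimes>\<^bsub>L\<^esub> inv\<^bsub>L\<^esub> f m'' n''"
      if "m \<in> carrier M" "n \<in> carrier N" "m' \<in> carrier M" "n' \<in> carrier N"
        "m'' \<in> carrier M" "n'' \<in> carrier N" for m n m' n' m'' n''
      using hom_diff_free[OF L.is_group F, of "frag_of (m, n) - frag_of (m', n')" "frag_of (m'', n'')"] that
        keys_diff[of "frag_of (m, n)" "frag_of (m', n')"]
      by (auto simp: keys_frag_of Fx d)
    \<comment> \<open>On a bilinear relation the linear extension of \<open>f\<close> takes the
      value of a commutator, trivial because \<open>L\<close> is abelian.\<close>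
    have canc: "x \<otimes>\<^bsub>L\<^esub> y \<otimes>\<^bsub>L\<^esub> inv\<^bsub>L\<^esub> x \<otimes>\<^bsub>L\<^esub> inv\<^bsub>L\<^esub> y = \<one>\<^bsub>L\<^esub>"
      if "x \<in> carrier L" "y \<in> carrier L" for x y
    proof -
      have "x \<otimes>\<^bsub>L\<^esub> y \<otimes>\<^bsub>L\<^esub> inv\<^bsub>L\<^esub> x \<otimes>\<^bsub>L\<^esub> inv\<^bsub>L\<^esub> y = (x \<otimes>\<^bsub>L\<^esub> y) \<otimes>\<^bsub>L\<^esub> inv\<^bsub>L\<^esub> (x \<otimes>\<^bsub>L\<^esub> y)"
        using that by (simp add: L.m_assoc L.inv_mult)
      then show ?thesis using that by simp
    qed
    from that consider
        (l) m m' n where "r = frag_of (m \<otimes>\<^bsub>M\<^esub> m', n) - frag_of (m, n) - frag_of (m', n)"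
            "m \<in> carrier M" "m' \<in> carrier M" "n \<in> carrier N"
      | (r) m n n' where "r = frag_of (m, n \<otimes>\<^bsub>N\<^esub> n') - frag_of (m, n) - frag_of (m, n')"
            "m \<in> carrier M" "n \<in> carrier N" "n' \<in> carrier N"
      | (b) m n m' n' where "r = frag_of (m, n) - frag_of (m', n')" "((m, n), (m', n')) \<in> E"
      unfolding bilinear_rels_def pair_rels_def by (elim UnE CollectE exE conjE) metis+
    then show ?thesis
    proof cases
      case l
      then show ?thesis using d3 M_closed left canc cl by simp
    next
      case r
      then show ?thesis using d3 N_closed right canc cl by simp
    next
      case b
      moreover have "m \<in> carrier M" "n \<in> carrier N" "m' \<in> carrier M" "n' \<in> carrier N"
        using b E_carrier by auto
      ultimately show ?thesis using d rel[OF b(2)] cl by simp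
    qed
  qed
  have ker: "?F r = \<one>\<^bsub>L\<^esub>" if "r \<in> tensor_rels M N B" for r
    using hom_generate_trivial[OF group_free_Abelian_group L.is_group F rels_carrier gen] that
    unfolding tensor_rels_def by blast
  show "tensor_lift L f \<in> hom TG L"
    using induced_hom(1)[OF FG_comm rels_subgroup F L.is_group ker]
    unfolding tensor_lift_def[abs_def] tensor_group_def .
  show "tensor_lift L f (tn m n) = f m n" if "m \<in> carrier M" "n \<in> carrier N"
    using induced_hom(2)[OF FG_comm rels_subgroup F L.is_group ker, of "frag_of (m, n)"] that
    unfolding tensor_lift_def tens_def by (simp add: Fx)
qed

end

section \<open>Induced maps on quotients and factorisation through surjections\<close>

lemma image_coset:
  assumes "h \<in> hom G L" "C \<subseteq> carrier G" "x \<in> carrier G"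
  shows "h ` (C #>\<^bsub>G\<^esub> x) = h ` C #>\<^bsub>L\<^esub> h x"
proof -
  have "h (c \<otimes>\<^bsub>G\<^esub> x) = h c \<otimes>\<^bsub>L\<^esub> h x" if "c \<in> C" for c
    using that assms(2,3) by (intro hom_mult[OF assms(1)]) auto
  then show ?thesis by (simp add: r_coset_def image_UN)
qed

lemma coset_map_coset:
  assumes "comm_group G" "subgroup A G" "comm_group N" "subgroup K N" "f \<in> hom G N" "f ` A \<subseteq> K"
  shows "coset_map N K f \<in> hom (G Mod A) (N Mod K)"
    and "x \<in> carrier G \<Longrightarrow> coset_map N K f (A #>\<^bsub>G\<^esub> x) = K #>\<^bsub>N\<^esub> f x"
proof -
  have h: "(\<lambda>x. K #>\<^bsub>N\<^esub> f x) \<in> hom G (N Mod K)"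
    using hom_compose[OF assms(5) coset_hom[OF assms(3,4)]] by (simp add: comp_def)
  have g: "group (N Mod K)"
    using comm_group.abelian_FactGroup[OF assms(3,4)] by (rule comm_group.axioms(2))
  have k: "K #>\<^bsub>N\<^esub> f a = \<one>\<^bsub>N Mod K\<^esub>" if "a \<in> A" for a
    using subgroup.rcos_const[OF assms(4) comm_group.axioms(2)[OF assms(3)]] that assms(6) by auto
  show "coset_map N K f \<in> hom (G Mod A) (N Mod K)"
    using induced_hom(1)[OF assms(1,2) h g k] by (simp add: coset_map_def[abs_def])
  show "x \<in> carrier G \<Longrightarrow> coset_map N K f (A #>\<^bsub>G\<^esub> x) = K #>\<^bsub>N\<^esub> f x"
    using induced_hom(2)[OF assms(1,2) h g k] by (simp add: coset_map_def)
qed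

lemma group_homI: "group G \<Longrightarrow> group L \<Longrightarrow> h \<in> hom G L \<Longrightarrow> group_hom G L h"
  by (simp add: group_hom.intro group_hom_axioms.intro)

text \<open>\<open>g\<close> is \<open>k\<close> applied to a chosen preimage under
  \<open>h\<close>. Since the kernel of \<open>h\<close> lies in that of \<open>k\<close>, the
  choice does not affect the value, and multiplicativity is inherited.\<close>

lemma hom_factor:
  assumes "group G" "group L" "group L'" "h \<in> hom G L" "h ` carrier G = carrier L" "k \<in> hom G L'"
    and "\<And>x. x \<in> carrier G \<Longrightarrow> h x = \<one>\<^bsub>L\<^esub> \<Longrightarrow> k x = \<one>\<^bsub>L'\<^esub>"
  obtains g where "g \<in> hom L L'" "\<And>x. x \<in> carrier G \<Longrightarrow> g (h x) = k x"
proof -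
  interpret h: group_hom G L h by (rule group_homI[OF assms(1,2,4)])
  interpret k: group_hom G L' k by (rule group_homI[OF assms(1,3,6)])
  have eq: "k x = k y" if "x \<in> carrier G" "y \<in> carrier G" "h x = h y" for x y
  proof -
    have "h (x \<otimes>\<^bsub>G\<^esub> inv\<^bsub>G\<^esub> y) = \<one>\<^bsub>L\<^esub>" using that by simp
    then have "k (x \<otimes>\<^bsub>G\<^esub> inv\<^bsub>G\<^esub> y) = \<one>\<^bsub>L'\<^esub>" using that assms(7) by simp
    then have "k x \<otimes>\<^bsub>L'\<^esub> inv\<^bsub>L'\<^esub> k y = \<one>\<^bsub>L'\<^esub>" using that by simp
    then show ?thesis using that k.H.inv_equality by fastforce
  qed
  define g where "g z = k (inv_into (carrier G) h z)" for z
  have g: "g (h x) = k x" if "x \<in> carrier G" for x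
    unfolding g_def using that by (intro eq) (auto intro: inv_into_into f_inv_into_f)
  have "g \<in> hom L L'"
  proof (rule homI)
    fix z assume "z \<in> carrier L"
    then obtain x where "x \<in> carrier G" "z = h x" using assms(5) by auto
    then show "g z \<in> carrier L'" using g by simp
  next
    fix z w assume "z \<in> carrier L" "w \<in> carrier L"
    then obtain x y where "x \<in> carrier G" "z = h x" "y \<in> carrier G" "w = h y"
      using assms(5) by (metis imageE)
    then show "g (z \<otimes>\<^bsub>L\<^esub> w) = g z \<otimes>\<^bsub>L'\<^esub> g w"
      using g[of "x \<otimes>\<^bsub>G\<^esub> y"] g by simp
  qed
  then show thesis using g that by blast
qed

subsection \<open>Right modules and their reductions\<close>

lemma with_action_simps [simp]:
  "carrier (with_action G a) = carrier G" "monoid.mult (with_action G a) = monoid.mult G"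
  "one (with_action G a) = one G" "ract (with_action G a) = a"
  by (simp_all add: with_action_def)

lemma hom_with_action [simp]:
  "hom (with_action G a) L = hom G L" "hom L (with_action G a) = hom L G"
  by (simp_all add: hom_def)

lemma group_with_action [simp]: "group (with_action G a) \<longleftrightarrow> group G"
  by (simp only: Group.group_def group_axioms_def Group.monoid_def Units_def with_action_simps)

lemma comm_group_with_action [simp]: "comm_group (with_action G a) \<longleftrightarrow> comm_group G"
  by (simp only: comm_group_def comm_monoid_def comm_monoid_axioms_def Group.monoid_def
      group_with_action with_action_simps)

text \<open>Each scalar acts by an additive endomorphism. The laws for 1 and for products of scalars
  are established separately for tensor products, in \<open>act_one\<close> and
  \<open>act_assoc\<close>.\<close>

definition acted_group :: "('r, 'z) ring_scheme \<Rightarrow> ('m, 'r) rmodule \<Rightarrow> bool" where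
  "acted_group S M \<longleftrightarrow> comm_group M \<and>
     (\<forall>m\<in>carrier M. \<forall>r\<in>carrier S. ract M m r \<in> carrier M) \<and>
     (\<forall>m\<in>carrier M. \<forall>m'\<in>carrier M. \<forall>r\<in>carrier S.
        ract M (m \<otimes>\<^bsub>M\<^esub> m') r = ract M m r \<otimes>\<^bsub>M\<^esub> ract M m' r)"

lemma acted_groupD:
  assumes "acted_group S M"
  shows "comm_group M" "group M"
    and "\<lbrakk>m \<in> carrier M; r \<in> carrier S\<rbrakk> \<Longrightarrow> ract M m r \<in> carrier M"
    and "r \<in> carrier S \<Longrightarrow> (\<lambda>m. ract M m r) \<in> hom M M"
proof -
  show "comm_group M" using assms by (simp add: acted_group_def)
  then show "group M" by (rule comm_group.axioms(2))
  show "\<lbrakk>m \<in> carrier M; r \<in> carrier S\<rbrakk> \<Longrightarrow> ract M m r \<in> carrier M" for m r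
    using assms by (simp add: acted_group_def)
  then show "r \<in> carrier S \<Longrightarrow> (\<lambda>m. ract M m r) \<in> hom M M"
    using assms by (intro homI) (simp_all add: acted_group_def)
qed

text \<open>The submodule M \<sqdot> J when J is an ideal. For \<open>J = F s\<close> it is
  literally \<open>mod_filt M F s\<close>, so kernels of reductions and steps of filtrations obey
  the same lemmas.\<close>

definition act_span :: "('m, 'r) rmodule \<Rightarrow> 'r set \<Rightarrow> 'm set" where
  "act_span M J = generate M {ract M m r |m r. m \<in> carrier M \<and> r \<in> J}"

definition reduction ::
    "('r, 'y) ring_scheme \<Rightarrow> 'r set \<Rightarrow> ('r \<Rightarrow> 's) \<Rightarrow> ('m, 'r) rmodule \<Rightarrow> ('n, 's) rmodule \<Rightarrow> ('m \<Rightarrow> 'n) \<Rightarrow> bool"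
  where
  "reduction S J \<rho> M M' \<pi> \<longleftrightarrow> \<pi> \<in> hom M M' \<and> \<pi> ` carrier M = carrier M' \<and>
     (\<forall>m\<in>carrier M. \<forall>r\<in>carrier S. \<pi> (ract M m r) = ract M' (\<pi> m) (\<rho> r)) \<and>
     kernel M M' \<pi> = act_span M J"

lemma act_gens_carrier:
  assumes "acted_group S M" "J \<subseteq> carrier S"
  shows "{ract M m r |m r. m \<in> carrier M \<and> r \<in> J} \<subseteq> carrier M"
  by (intro subsetI, elim CollectE exE conjE, hypsubst, intro acted_groupD(3)[OF assms(1)])
     (auto intro: subsetD[OF assms(2)])

lemma act_span_subgroup:
  assumes "acted_group S M" "J \<subseteq> carrier S"
  shows "subgroup (act_span M J) M"
  unfolding act_span_def
  by (rule group.generate_is_subgroup[OF acted_groupD(2)[OF assms(1)] act_gens_carrier[OF assms]])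

lemma act_span_incl: "m \<in> carrier M \<Longrightarrow> r \<in> J \<Longrightarrow> ract M m r \<in> act_span M J"
  unfolding act_span_def by (rule generate.incl) blast

lemma act_span_least:
  assumes "group M" "subgroup U M" "\<And>m r. m \<in> carrier M \<Longrightarrow> r \<in> J \<Longrightarrow> ract M m r \<in> U"
  shows "act_span M J \<subseteq> U"
  unfolding act_span_def
  by (rule group.generate_subgroup_incl[OF assms(1) _ assms(2)], intro subsetI,
      elim CollectE exE conjE, hypsubst, rule assms(3))

text \<open>The image of a generated subgroup is generated by the images of the generators, and
  surjectivity of \<pi> makes these exhaust the generators on the other side. With \<rho> the
  identity it applies to linear isomorphisms and to projections onto cokernels.\<close>

lemma act_span_image:
  assumes "acted_group S M" "acted_group S' M'" "J \<subseteq> carrier S" "\<pi> \<in> hom M M'"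
    and "\<pi> ` carrier M = carrier M'"
    and "\<And>m r. m \<in> carrier M \<Longrightarrow> r \<in> carrier S \<Longrightarrow> \<pi> (ract M m r) = ract M' (\<pi> m) (\<rho> r)"
  shows "\<pi> ` act_span M J = act_span M' (\<rho> ` J)"
proof -
  interpret group_hom M M' \<pi>
    by (rule group_homI[OF assms(1,2)[THEN acted_groupD(2)] assms(4)])
  have "\<pi> ` {ract M m r |m r. m \<in> carrier M \<and> r \<in> J} = {ract M' m r |m r. m \<in> carrier M' \<and> r \<in> \<rho> ` J}"
    (is "?l = ?r")
  proof
    show "?l \<subseteq> ?r"
    proof
      fix x assume "x \<in> ?l"
      then obtain m r where "m \<in> carrier M" "r \<in> J" "x = \<pi> (ract M m r)" by auto
      then have "x = ract M' (\<pi> m) (\<rho> r)" "\<pi> m \<in> carrier M'" "\<rho> r \<in> \<rho> ` J"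
        using assms(3,5,6) by auto
      then show "x \<in> ?r" by blast
    qed
    show "?r \<subseteq> ?l"
    proof
      fix x assume "x \<in> ?r"
      then obtain m' r where "m' \<in> carrier M'" "r \<in> J" "x = ract M' m' (\<rho> r)"
        by blast
      moreover from this obtain m where "m \<in> carrier M" "m' = \<pi> m"
        using assms(5) by (metis imageE)
      ultimately have "m \<in> carrier M" "r \<in> J" "x = ract M' (\<pi> m) (\<rho> r)"
        by simp_all
      then have "x = \<pi> (ract M m r)" using assms(3,6) by auto
      then show "x \<in> ?l" using \<open>m \<in> carrier M\<close> \<open>r \<in> J\<close> by blast
    qed
  qed
  then show ?thesis
    unfolding act_span_def using generate_img[OF act_gens_carrier[OF assms(1,3)]] by simp
qed

lemma rlinear_act_span:
  assumes "acted_group S M" "acted_group S N" "J \<subseteq> carrier S" "rlinear S M N f"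
  shows "f ` act_span M J \<subseteq> act_span N J"
proof -
  interpret group_hom M N f
    by (rule group_homI[OF assms(1,2)[THEN acted_groupD(2)]]) (use assms(4) in \<open>simp add: rlinear_def\<close>)
  have "f (ract M m r) = ract N (f m) r" "f m \<in> carrier N" if "m \<in> carrier M" "r \<in> J" for m r
    using that assms(3,4) unfolding rlinear_def by (auto intro: hom_in_carrier)
  then have "f ` {ract M m r |m r. m \<in> carrier M \<and> r \<in> J} \<subseteq> {ract N m r |m r. m \<in> carrier N \<and> r \<in> J}"
    by blast
  then show ?thesis
    unfolding act_span_def generate_img[OF act_gens_carrier[OF assms(1,3)], symmetric]
    by (rule H.mono_generate)
qed

lemma reductionD:
  assumes "reduction S J \<rho> M M' \<pi>"
  shows "\<pi> \<in> hom M M'" "\<pi> ` carrier M = carrier M'"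
    and "\<lbrakk>m \<in> carrier M; r \<in> carrier S\<rbrakk> \<Longrightarrow> \<pi> (ract M m r) = ract M' (\<pi> m) (\<rho> r)"
    and "m \<in> carrier M \<Longrightarrow> \<pi> m = \<one>\<^bsub>M'\<^esub> \<longleftrightarrow> m \<in> act_span M J"
    and "kernel M M' \<pi> = act_span M J"
proof -
  show "m \<in> carrier M \<Longrightarrow> \<pi> m = \<one>\<^bsub>M'\<^esub> \<longleftrightarrow> m \<in> act_span M J"
    using assms unfolding reduction_def kernel_def by blast
qed (use assms in \<open>auto simp: reduction_def\<close>)

lemma reduction_eq_iff:
  assumes "reduction S J \<rho> M M' \<pi>" "group M" "group M'" "x \<in> carrier M" "y \<in> carrier M"
  shows "\<pi> x = \<pi> y \<longleftrightarrow> x \<otimes>\<^bsub>M\<^esub> inv\<^bsub>M\<^esub> y \<in> act_span M J"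
proof -
  interpret group_hom M M' \<pi>
    by (rule group_homI[OF assms(2,3) reductionD(1)[OF assms(1)]])
  have "\<pi> (x \<otimes>\<^bsub>M\<^esub> inv\<^bsub>M\<^esub> y) = \<pi> x \<otimes>\<^bsub>M'\<^esub> inv\<^bsub>M'\<^esub> \<pi> y"
    using assms(4,5) by simp
  moreover have "\<pi> x \<otimes>\<^bsub>M'\<^esub> inv\<^bsub>M'\<^esub> \<pi> y = \<one>\<^bsub>M'\<^esub> \<longleftrightarrow> \<pi> x = \<pi> y"
    using assms(4,5) H.inv_solve_right'[of "\<one>\<^bsub>M'\<^esub>" "\<pi> x" "\<pi> y"] by auto
  ultimately show ?thesis
    using reductionD(4)[OF assms(1), of "x \<otimes>\<^bsub>M\<^esub> inv\<^bsub>M\<^esub> y"] assms(4,5) by auto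
qed

text \<open>The isomorphism f carries C \<sqdot> J onto E \<sqdot> J, so \<sigma> \<circ> f and
  \<pi> have the same kernel. Hence \<sigma> \<circ> f factors through \<pi> by an injective map g,
  which is onto because f and \<sigma> are. Linearity of g over S' is checked on lifts, since \<rho>
  is onto.\<close>

lemma reduction_iso:
  assumes "acted_group S C" "acted_group S E" "acted_group S' C'" "acted_group S' E'"
    and "J \<subseteq> carrier S" "\<rho> ` carrier S = carrier S'"
    and \<pi>: "reduction S J \<rho> C C' \<pi>" and \<sigma>: "reduction S J \<rho> E E' \<sigma>" and "rmod_iso S C E"
  shows "rmod_iso S' C' E'"
proof -
  note grp = assms(1-4)[THEN acted_groupD(2)]
  obtain f where f: "rlinear S C E f" "bij_betw f (carrier C) (carrier E)"
    using assms(9) by (auto simp: rmod_iso_def)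
  have fh: "f \<in> hom C E" using f(1) by (simp add: rlinear_def)
  interpret f: group_hom C E f
    by (rule group_homI[OF grp(1,2) fh])
  have k: "\<sigma> \<circ> f \<in> hom C E'" using hom_compose[OF fh reductionD(1)[OF \<sigma>]] .
  have span: "f ` act_span C J = act_span E J"
    using act_span_image[OF assms(1,2,5) fh _, of "\<lambda>r. r"] f by (simp add: rlinear_def bij_betw_def)
  have ker: "(\<sigma> \<circ> f) x = \<one>\<^bsub>E'\<^esub> \<longleftrightarrow> \<pi> x = \<one>\<^bsub>C'\<^esub>" if x: "x \<in> carrier C" for x
  proof -
    have "(\<sigma> \<circ> f) x = \<one>\<^bsub>E'\<^esub> \<longleftrightarrow> f x \<in> f ` act_span C J"
      using reductionD(4)[OF \<sigma>] x span by simp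
    also have "\<dots> \<longleftrightarrow> x \<in> act_span C J"
      using f(2) x subgroup.subset[OF act_span_subgroup[OF assms(1,5)]]
      by (auto simp: bij_betw_def inj_on_def)
    finally show ?thesis using reductionD(4)[OF \<pi> x] by simp
  qed
  obtain g where g: "g \<in> hom C' E'" "\<And>x. x \<in> carrier C \<Longrightarrow> g (\<pi> x) = (\<sigma> \<circ> f) x"
    using hom_factor[OF grp(1,3,4) reductionD(1,2)[OF \<pi>] k] ker by blast
  interpret g: group_hom C' E' g
    by (rule group_homI[OF grp(3,4) g(1)])
  have surj: "\<exists>x\<in>carrier C. c = \<pi> x" if "c \<in> carrier C'" for c
    using that reductionD(2)[OF \<pi>] by blast
  have inj: "inj_on g (carrier C')"
    unfolding g.inj_on_one_iff using surj g(2) ker by force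
  have "g ` carrier C' = \<sigma> ` f ` carrier C"
    unfolding reductionD(2)[OF \<pi>, symmetric] image_image using g(2) by (intro image_cong) auto
  also have "\<dots> = carrier E'"
    using f(2) reductionD(2)[OF \<sigma>] by (simp add: bij_betw_def)
  finally have bij: "bij_betw g (carrier C') (carrier E')" using inj by (simp add: bij_betw_def)
  have "g (ract C' c r) = ract E' (g c) r" if "c \<in> carrier C'" "r \<in> carrier S'" for c r
  proof -
    obtain x s where x: "x \<in> carrier C" "c = \<pi> x" "s \<in> carrier S" "r = \<rho> s"
      using surj[OF \<open>c \<in> carrier C'\<close>] assms(6) \<open>r \<in> carrier S'\<close> by (metis imageE)
    have "g (ract C' c r) = g (\<pi> (ract C x s))"
      using x reductionD(3)[OF \<pi>] by simp
    also have "\<dots> = \<sigma> (f (ract C x s))"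
      using g(2) acted_groupD(3)[OF assms(1)] x by simp
    also have "f (ract C x s) = ract E (f x) s"
      using f(1) x by (simp add: rlinear_def)
    also have "\<sigma> (ract E (f x) s) = ract E' (g c) r"
      using x reductionD(3)[OF \<sigma>] g(2) by simp
    finally show ?thesis .
  qed
  then show ?thesis
    using g(1) bij unfolding rmod_iso_def rlinear_def by blast
qed

lemma rlinear_image_subgroup:
  assumes "group M" "group N" "rlinear S M N f"
  shows "subgroup (f ` carrier M) N"
proof -
  interpret group_hom M N f
    by (rule group_homI[OF assms(1,2)]) (use assms(3) in \<open>simp add: rlinear_def\<close>)
  show ?thesis by (rule img_is_subgroup)
qed

lemma coker_simps:
  "carrier (rmod_coker M N f) = (\<lambda>x. f ` carrier M #>\<^bsub>N\<^esub> x) ` carrier N"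
  "one (rmod_coker M N f) = f ` carrier M"
  by (simp_all add: rmod_coker_def rmod_quot_def carrier_FactGroup)

lemma coker_hom:
  assumes "acted_group S M" "acted_group S N" "rlinear S M N f"
  shows "(\<lambda>x. f ` carrier M #>\<^bsub>N\<^esub> x) \<in> hom N (rmod_coker M N f)"
  unfolding rmod_coker_def rmod_quot_def
  using coset_hom[OF acted_groupD(1)[OF assms(2)]
      rlinear_image_subgroup[OF assms(1,2)[THEN acted_groupD(2)] assms(3)]]
  by simp

lemma coker_ract:
  assumes "acted_group S M" "acted_group S N" "rlinear S M N f" "x \<in> carrier N" "r \<in> carrier S"
  shows "ract (rmod_coker M N f) (f ` carrier M #>\<^bsub>N\<^esub> x) r = f ` carrier M #>\<^bsub>N\<^esub> ract N x r"
proof -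
  have "(\<lambda>x. ract N x r) ` f ` carrier M \<subseteq> f ` carrier M"
    using assms acted_groupD(3)[OF assms(1)] unfolding rlinear_def by (force simp: image_iff)
  then show ?thesis
    unfolding rmod_coker_def rmod_quot_def with_action_simps
    by (intro coset_map_coset(2) acted_groupD(1)[OF assms(2)] acted_groupD(4)[OF assms(2,5)] assms(4)
          rlinear_image_subgroup[OF assms(1,2)[THEN acted_groupD(2)] assms(3)])
qed

lemma coker_acted:
  assumes "acted_group S M" "acted_group S N" "rlinear S M N f"
  shows "acted_group S (rmod_coker M N f)"
proof -
  let ?C = "rmod_coker M N f" and ?q = "\<lambda>x. f ` carrier M #>\<^bsub>N\<^esub> x"
  note hom = coker_hom[OF assms] and act = coker_ract[OF assms]
  have "comm_group ?C"
    unfolding rmod_coker_def rmod_quot_def comm_group_with_action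
    by (rule comm_group.abelian_FactGroup[OF acted_groupD(1)[OF assms(2)]
          rlinear_image_subgroup[OF acted_groupD(2)[OF assms(1)] acted_groupD(2)[OF assms(2)] assms(3)]])
  moreover have "ract ?C (?q x \<otimes>\<^bsub>?C\<^esub> ?q y) r = ract ?C (?q x) r \<otimes>\<^bsub>?C\<^esub> ract ?C (?q y) r"
    if "x \<in> carrier N" "y \<in> carrier N" "r \<in> carrier S" for x y r
  proof -
    have "x \<otimes>\<^bsub>N\<^esub> y \<in> carrier N"
      using that acted_groupD(2)[OF assms(2)] by (simp add: group.is_monoid monoid.m_closed)
    then have "ract ?C (?q x \<otimes>\<^bsub>?C\<^esub> ?q y) r = ?q (ract N (x \<otimes>\<^bsub>N\<^esub> y) r)"
      using that act by (simp flip: hom_mult[OF hom])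
    also have "\<dots> = ?q (ract N x r) \<otimes>\<^bsub>?C\<^esub> ?q (ract N y r)"
      using that acted_groupD(3)[OF assms(2)] hom_mult[OF acted_groupD(4)[OF assms(2)]]
      by (simp add: hom_mult[OF hom])
    finally show ?thesis using that act by simp
  qed
  moreover have "ract ?C (?q x) r \<in> carrier ?C" if "x \<in> carrier N" "r \<in> carrier S" for x r
    using act that acted_groupD(3)[OF assms(2)] hom_in_carrier[OF hom] by simp
  ultimately show ?thesis
    unfolding acted_group_def by (auto simp: coker_simps(1))
qed

text \<open>On cokernels the induced map is the direct image of cosets, because \<sigma> carries the
  image of f onto that of f'. If it kills the class of x, then \<sigma> x = \<sigma> (f m) for some
  m, so x - f m lies in N \<sqdot> J. As x and x - f m have the same class in the cokernel, that
  class lies in the span of J there.\<close>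

lemma coker_reduction:
  assumes "acted_group S M" "acted_group S N" "acted_group S' M'" "acted_group S' N'"
    and J: "J \<subseteq> carrier S" and \<rho>: "\<rho> ` carrier S \<subseteq> carrier S'"
    and \<pi>: "reduction S J \<rho> M M' \<pi>" and \<sigma>: "reduction S J \<rho> N N' \<sigma>"
    and f: "rlinear S M N f" and f': "rlinear S' M' N' f'"
    and comm: "\<And>m. m \<in> carrier M \<Longrightarrow> f' (\<pi> m) = \<sigma> (f m)"
  shows "reduction S J \<rho> (rmod_coker M N f) (rmod_coker M' N' f') (\<lambda>c. \<sigma> ` c)"
proof -
  let ?C = "rmod_coker M N f" and ?C' = "rmod_coker M' N' f'"
  let ?q = "\<lambda>x. f ` carrier M #>\<^bsub>N\<^esub> x" and ?q' = "\<lambda>x. f' ` carrier M' #>\<^bsub>N'\<^esub> x"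
  note grp = assms(1-4)[THEN acted_groupD(2)]
  note sg = rlinear_image_subgroup[OF grp(1,2) f] and sg' = rlinear_image_subgroup[OF grp(3,4) f']
  interpret N: group N by (rule grp)
  interpret \<sigma>: group_hom N N' \<sigma>
    by (rule group_homI[OF grp(2,4) reductionD(1)[OF \<sigma>]])
  note hom = coker_hom[OF assms(1,2) f] and hom' = coker_hom[OF assms(3,4) f']
  note act = coker_acted[OF assms(1,2) f] and act' = coker_acted[OF assms(3,4) f']
  have im: "\<sigma> ` f ` carrier M = f' ` carrier M'"
    unfolding reductionD(2)[OF \<pi>, symmetric] using comm by (auto simp: image_iff)
  have q: "\<sigma> ` ?q x = ?q' (\<sigma> x)" if "x \<in> carrier N" for x
    using image_coset[OF reductionD(1)[OF \<sigma>] subgroup.subset[OF sg] that] im by simp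
  have h: "(\<lambda>c. \<sigma> ` c) \<in> hom ?C ?C'"
  proof (rule homI)
    fix c assume "c \<in> carrier ?C"
    then show "\<sigma> ` c \<in> carrier ?C'" using q by (auto simp: coker_simps(1))
  next
    fix c d assume "c \<in> carrier ?C" "d \<in> carrier ?C"
    then obtain x y where xy: "x \<in> carrier N" "y \<in> carrier N" "c = ?q x" "d = ?q y"
      by (auto simp: coker_simps(1))
    then have "c \<otimes>\<^bsub>?C\<^esub> d = ?q (x \<otimes>\<^bsub>N\<^esub> y)" by (simp add: hom_mult[OF hom])
    then show "\<sigma> ` (c \<otimes>\<^bsub>?C\<^esub> d) = \<sigma> ` c \<otimes>\<^bsub>?C'\<^esub> \<sigma> ` d"
      using xy by (simp add: q hom_mult[OF hom'])
  qed
  have "(\<lambda>c. \<sigma> ` c) ` carrier ?C = carrier ?C'"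
    unfolding coker_simps(1) image_image reductionD(2)[OF \<sigma>, symmetric] by (intro image_cong refl q)
  moreover have "\<sigma> ` ract ?C (?q x) r = ract ?C' (\<sigma> ` ?q x) (\<rho> r)"
    if "x \<in> carrier N" "r \<in> carrier S" for x r
  proof -
    have "\<rho> r \<in> carrier S'" using that \<rho> by auto
    then show ?thesis
      using that coker_ract[OF assms(1,2) f] coker_ract[OF assms(3,4) f'] acted_groupD(3)[OF assms(2)]
      by (simp add: q reductionD(3)[OF \<sigma>])
  qed
  moreover have "kernel ?C ?C' (\<lambda>c. \<sigma> ` c) = act_span ?C J"
  proof
    have qspan: "?q ` act_span N J = act_span ?C ((\<lambda>r. r) ` J)"
      by (rule act_span_image[OF assms(2) act J hom])
         (simp_all add: coker_simps(1) coker_ract[OF assms(1,2) f])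
    show "kernel ?C ?C' (\<lambda>c. \<sigma> ` c) \<subseteq> act_span ?C J"
    proof
      fix c assume "c \<in> kernel ?C ?C' (\<lambda>c. \<sigma> ` c)"
      then obtain x where x: "x \<in> carrier N" "c = ?q x" "?q' (\<sigma> x) = f' ` carrier M'"
        using q by (auto simp: kernel_def coker_simps)
      then have "\<sigma> x \<in> f' ` carrier M'"
        using \<sigma>.H.coset_join1[OF _ _ sg'] by simp
      then obtain m where m: "m \<in> carrier M" "\<sigma> x = \<sigma> (f m)"
      proof -
        obtain n where "n \<in> f ` carrier M" "\<sigma> x = \<sigma> n"
          using \<open>\<sigma> x \<in> f' ` carrier M'\<close> unfolding im[symmetric] by blast
        then show thesis using that by blast
      qed
      have fm: "f m \<in> carrier N" using f m(1) by (auto simp: rlinear_def hom_in_carrier)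
      have "x \<otimes>\<^bsub>N\<^esub> inv\<^bsub>N\<^esub> f m \<in> act_span N J"
        using reduction_eq_iff[OF \<sigma> grp(2,4) x(1) fm] m by simp
      then have "?q (x \<otimes>\<^bsub>N\<^esub> inv\<^bsub>N\<^esub> f m) \<in> act_span ?C J"
        using qspan by auto
      moreover have "?q (x \<otimes>\<^bsub>N\<^esub> inv\<^bsub>N\<^esub> f m) = ?q x"
      proof -
        have "inv\<^bsub>N\<^esub> f m \<in> f ` carrier M"
          using subgroup.m_inv_closed[OF sg] m by blast
        then have "?q (inv\<^bsub>N\<^esub> f m) = \<one>\<^bsub>?C\<^esub>"
          using subgroup.rcos_const[OF sg grp(2)] by (simp add: coker_simps)
        then show ?thesis
          using x fm hom_mult[OF hom, of x "inv\<^bsub>N\<^esub> f m"]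
            hom_in_carrier[OF hom x(1)] by (simp add: group.is_monoid monoid.r_one acted_groupD(2)[OF act])
      qed
      ultimately show "c \<in> act_span ?C J" using x by simp
    qed
    show "act_span ?C J \<subseteq> kernel ?C ?C' (\<lambda>c. \<sigma> ` c)"
    proof
      fix c assume "c \<in> act_span ?C J"
      then obtain x where x: "x \<in> act_span N J" "c = ?q x" using qspan by auto
      have xc: "x \<in> carrier N" using x(1) subgroup.subset[OF act_span_subgroup[OF assms(2) J]] by auto
      have "\<sigma> x = \<one>\<^bsub>N'\<^esub>" using reductionD(4)[OF \<sigma> xc] x(1) by simp
      then have "\<sigma> ` c = \<one>\<^bsub>?C'\<^esub>"
        using q[OF xc] x(2) \<sigma>.H.coset_mult_one[OF subgroup.subset[OF sg']] by (simp add: coker_simps)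
      then show "c \<in> kernel ?C ?C' (\<lambda>c. \<sigma> ` c)"
        using x xc hom_in_carrier[OF hom] by (simp add: kernel_def)
    qed
  qed
  ultimately show ?thesis
    using h unfolding reduction_def by (auto simp: coker_simps(1))
qed

subsection \<open>Extension of scalars\<close>

lemma add_group_simps [simp]:
  "carrier (add_group R) = carrier R" "monoid.mult (add_group R) = add R" "one (add_group R) = zero R"
  by (simp_all add: add_group_def)

lemma comm_group_cong:
  assumes "carrier G = carrier L" "monoid.mult G = monoid.mult L" "one G = one L"
  shows "comm_group G \<longleftrightarrow> comm_group L"
  by (simp only: comm_group_def comm_monoid_def comm_monoid_axioms_def Group.monoid_def
      Group.group_def group_axioms_def Units_def assms)

lemma (in ring) add_group_comm: "comm_group (add_group R)"
  using a_comm_group comm_group_cong[of "add_group R" "add_monoid R"] by simp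

lemma (in ring) inv_add_group: "inv\<^bsub>add_group R\<^esub> x = \<ominus> x"
  unfolding a_inv_def m_inv_def by simp

text \<open>The common shape of \<open>ext_scalars\<close> (no further relations) and
  \<open>base_change\<close> (balancing relations), so that one proof treats both.\<close>

definition right_tensor where
  "right_tensor M T B =
     with_action (tensor_group M (add_group T) B)
       (\<lambda>c t. tensor_lift (tensor_group M (add_group T) B) (\<lambda>m u. tens M (add_group T) B m (u \<otimes>\<^bsub>T\<^esub> t)) c)"

lemma hom_right_tensor [simp]:
  "hom (right_tensor M T B) L = hom (tensor_group M (add_group T) B) L"
  "hom L (right_tensor M T B) = hom L (tensor_group M (add_group T) B)"
  by (simp_all add: right_tensor_def)

lemma right_tensor_simps [simp]:
  "carrier (right_tensor M T B) = carrier (tensor_group M (add_group T) B)"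
  "monoid.mult (right_tensor M T B) = monoid.mult (tensor_group M (add_group T) B)"
  "one (right_tensor M T B) = one (tensor_group M (add_group T) B)"
  "comm_group (right_tensor M T B) \<longleftrightarrow> comm_group (tensor_group M (add_group T) B)"
  "group (right_tensor M T B) \<longleftrightarrow> group (tensor_group M (add_group T) B)"
  by (simp_all add: right_tensor_def)

lemma m_inv_right_tensor [simp]:
  "m_inv (right_tensor M T B) = m_inv (tensor_group M (add_group T) B)"
  by (intro ext) (simp only: m_inv_def right_tensor_simps)

text \<open>By \<open>E_right\<close> the identified pairs are stable under right multiplication in
  the second factor. This lets m \<otimes> u \<mapsto> m \<otimes> u t respect them, so that T acts
  on the quotient.\<close>

locale scalar_tensor = tensor_pair M "add_group T" E + ring T
  for M :: "('m, 'y) monoid_scheme" and T :: "('r, 'z) ring_scheme" (structure) and E +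
  assumes E_right: "((m, u), (m', u')) \<in> E \<Longrightarrow> t \<in> carrier T \<Longrightarrow> ((m, u \<otimes> t), (m', u' \<otimes> t)) \<in> E"
begin

abbreviation "TM \<equiv> right_tensor M T B"

lemma act:
  assumes "t \<in> carrier T"
  shows "(\<lambda>c. ract TM c t) \<in> hom TG TG"
    and "m \<in> carrier M \<Longrightarrow> u \<in> carrier T \<Longrightarrow> ract TM (tn m u) t = tn m (u \<otimes> t)"
proof -
  have cl: "tn m (u \<otimes> t) \<in> carrier TG" if "m \<in> carrier M" "u \<in> carrier (add_group T)" for m u
    using that assms by (intro tens_closed) auto
  have left: "tn (m \<otimes>\<^bsub>M\<^esub> m') (u \<otimes> t) = tn m (u \<otimes> t) \<otimes>\<^bsub>TG\<^esub> tn m' (u \<otimes> t)"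
    if "m \<in> carrier M" "m' \<in> carrier M" "u \<in> carrier (add_group T)" for m m' u
    using that assms by (intro tens_add_left) auto
  have right: "tn m ((u \<otimes>\<^bsub>add_group T\<^esub> u') \<otimes> t) = tn m (u \<otimes> t) \<otimes>\<^bsub>TG\<^esub> tn m (u' \<otimes> t)"
    if "m \<in> carrier M" "u \<in> carrier (add_group T)" "u' \<in> carrier (add_group T)" for m u u'
    using tens_add_right[of m "u \<otimes> t" "u' \<otimes> t"] that assms by (simp add: l_distr)
  have rel: "tn m (u \<otimes> t) = tn m' (u' \<otimes> t)" if "((m, u), (m', u')) \<in> E" for m u m' u'
    by (rule tens_rel[OF E_right[OF that assms]])
  note lift = tensor_lift[OF TG_comm cl left right rel, simplified]
  show "(\<lambda>c. ract TM c t) \<in> hom TG TG"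
    using lift(1) by (simp add: right_tensor_def)
  show "m \<in> carrier M \<Longrightarrow> u \<in> carrier T \<Longrightarrow> ract TM (tn m u) t = tn m (u \<otimes> t)"
    using lift(2) by (simp add: right_tensor_def)
qed

lemma TM_acted: "acted_group T TM"
  unfolding acted_group_def right_tensor_simps
  using TG_comm hom_in_carrier[OF act(1)] hom_mult[OF act(1)] by auto

lemma tens_hom: "m \<in> carrier M \<Longrightarrow> (\<lambda>u. tn m u) \<in> hom (add_group T) TG"
  by (rule homI) (use tens_closed tens_add_right in auto)

lemma tens_zero: "m \<in> carrier M \<Longrightarrow> tn m \<zero> = \<one>\<^bsub>TG\<^esub>"
  using hom_one[OF tens_hom] TG_group comm_group.axioms(2)[OF add_group_comm] by simp

lemma tens_minus:
  assumes "m \<in> carrier M" "u \<in> carrier T" "v \<in> carrier T"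
  shows "tn m (u \<ominus> v) = tn m u \<otimes>\<^bsub>TG\<^esub> inv\<^bsub>TG\<^esub> tn m v"
proof -
  interpret group_hom "add_group T" TG "\<lambda>u. tn m u"
    by (rule group_homI[OF comm_group.axioms(2)[OF add_group_comm] TG_group tens_hom[OF assms(1)]])
  have "tn m (u \<oplus> (\<ominus> v)) = tn m u \<otimes>\<^bsub>TG\<^esub> tn m (\<ominus> v)"
    using hom_mult[of u "\<ominus> v"] assms by simp
  also have "tn m (\<ominus> v) = inv\<^bsub>TG\<^esub> tn m v"
    using hom_inv[of v] assms by (simp add: inv_add_group)
  finally show ?thesis by (simp add: minus_eq)
qed

lemma act_one:
  assumes "c \<in> carrier TG"
  shows "ract TM c \<one> = c"
proof -
  have "ract TM c \<one> = (\<lambda>c. c) c"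
    by (rule tensor_hom_eq[OF TG_group act(1) _ _ assms])
       (auto simp: act(2) hom_def)
  then show ?thesis .
qed

lemma act_assoc:
  assumes "c \<in> carrier TG" "s \<in> carrier T" "t \<in> carrier T"
  shows "ract TM (ract TM c s) t = ract TM c (s \<otimes> t)"
proof -
  have "((\<lambda>c. ract TM c t) \<circ> (\<lambda>c. ract TM c s)) c = (\<lambda>c. ract TM c (s \<otimes> t)) c"
    by (rule tensor_hom_eq[OF TG_group hom_compose[OF act(1) act(1)] act(1) _ assms(1)])
       (use assms in \<open>auto simp: act(2) m_assoc\<close>)
  then show ?thesis by simp
qed

lemma act_add:
  assumes "c \<in> carrier TG" "s \<in> carrier T" "t \<in> carrier T"
  shows "ract TM c (s \<oplus> t) = ract TM c s \<otimes>\<^bsub>TG\<^esub> ract TM c t"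
proof -
  interpret TG: comm_group TG by (rule TG_comm)
  have h: "(\<lambda>c. ract TM c s \<otimes>\<^bsub>TG\<^esub> ract TM c t) \<in> hom TG TG"
    by (rule homI)
       (simp_all add: hom_in_carrier[OF act(1)] hom_mult[OF act(1)] assms TG.m_ac)
  show ?thesis
    by (rule tensor_hom_eq[OF TG_group act(1) h _ assms(1)])
       (use assms tens_add_right in \<open>auto simp: act(2) r_distr\<close>)
qed

lemma act_zero:
  assumes "c \<in> carrier TG"
  shows "ract TM c \<zero> = \<one>\<^bsub>TG\<^esub>"
proof -
  have h: "(\<lambda>c. \<one>\<^bsub>TG\<^esub>) \<in> hom TG TG"
    using TG_group by (auto intro!: homI simp: group.is_monoid monoid.l_one)
  show ?thesis
    by (rule tensor_hom_eq[OF TG_group act(1) h _ assms])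
       (auto simp: act(2) tens_zero)
qed

end

text \<open>\<open>E_map\<close> lets \<rho> descend to the tensor products. \<open>E_lift\<close>,
  by which every identification over S' comes from one over S, keeps the kernel from exceeding the
  span of the kernel of \<rho>.\<close>

locale tensor_reduction =
  S: scalar_tensor M S E + S': scalar_tensor M S' E'
  for M :: "('m, 'y) monoid_scheme" and S :: "('r, 'z) ring_scheme" and E
    and S' :: "('s, 'w) ring_scheme" and E' +
  fixes \<rho> :: "'r \<Rightarrow> 's"
  assumes hom: "\<rho> \<in> ring_hom S S'" and surj: "\<rho> ` carrier S = carrier S'"
    and E_map: "((m, u), (m', u')) \<in> E \<Longrightarrow> ((m, \<rho> u), (m', \<rho> u')) \<in> E'"
    and E_lift: "((m, v), (m', v')) \<in> E' \<Longrightarrow> \<exists>u u'. v = \<rho> u \<and> v' = \<rho> u' \<and> ((m, u), (m', u')) \<in> E"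
begin

definition "proj = tensor_lift S'.TG (\<lambda>m u. S'.tn m (\<rho> u))"
definition "J = {r \<in> carrier S. \<rho> r = \<zero>\<^bsub>S'\<^esub>}"

lemma \<rho>_simps:
  "r \<in> carrier S \<Longrightarrow> \<rho> r \<in> carrier S'"
  "\<lbrakk>r \<in> carrier S; s \<in> carrier S\<rbrakk> \<Longrightarrow> \<rho> (r \<oplus>\<^bsub>S\<^esub> s) = \<rho> r \<oplus>\<^bsub>S'\<^esub> \<rho> s"
  "\<lbrakk>r \<in> carrier S; s \<in> carrier S\<rbrakk> \<Longrightarrow> \<rho> (r \<otimes>\<^bsub>S\<^esub> s) = \<rho> r \<otimes>\<^bsub>S'\<^esub> \<rho> s"
  "\<rho> \<one>\<^bsub>S\<^esub> = \<one>\<^bsub>S'\<^esub>"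
  using hom ring_hom_closed ring_hom_add ring_hom_mult ring_hom_one by metis+

lemma J_carrier: "J \<subseteq> carrier S"
  by (auto simp: J_def)

lemma proj:
  shows "proj \<in> hom S.TG S'.TG"
    and "m \<in> carrier M \<Longrightarrow> u \<in> carrier S \<Longrightarrow> proj (S.tn m u) = S'.tn m (\<rho> u)"
proof -
  have cl: "S'.tn m (\<rho> u) \<in> carrier S'.TG" if "m \<in> carrier M" "u \<in> carrier (add_group S)" for m u
    using that \<rho>_simps by (intro S'.tens_closed) auto
  have left: "S'.tn (m \<otimes>\<^bsub>M\<^esub> m') (\<rho> u) = S'.tn m (\<rho> u) \<otimes>\<^bsub>S'.TG\<^esub> S'.tn m' (\<rho> u)"
    if "m \<in> carrier M" "m' \<in> carrier M" "u \<in> carrier (add_group S)" for m m' u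
    using that \<rho>_simps by (intro S'.tens_add_left) auto
  have right: "S'.tn m (\<rho> (u \<otimes>\<^bsub>add_group S\<^esub> u')) = S'.tn m (\<rho> u) \<otimes>\<^bsub>S'.TG\<^esub> S'.tn m (\<rho> u')"
    if "m \<in> carrier M" "u \<in> carrier (add_group S)" "u' \<in> carrier (add_group S)" for m u u'
    using S'.tens_add_right[of m "\<rho> u" "\<rho> u'"] that \<rho>_simps by simp
  have rel: "S'.tn m (\<rho> u) = S'.tn m' (\<rho> u')" if "((m, u), (m', u')) \<in> E" for m u m' u'
    by (rule S'.tens_rel[OF E_map[OF that]])
  note lift = S.tensor_lift[OF S'.TG_comm cl left right rel, simplified, folded proj_def]
  show "proj \<in> hom S.TG S'.TG" by (rule lift(1))
  show "m \<in> carrier M \<Longrightarrow> u \<in> carrier S \<Longrightarrow> proj (S.tn m u) = S'.tn m (\<rho> u)" by (rule lift(2))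
qed

lemma proj_surj: "proj ` carrier S.TG = carrier S'.TG"
proof
  interpret group_hom S.TG S'.TG proj by (rule group_homI[OF S.TG_group S'.TG_group proj(1)])
  show "proj ` carrier S.TG \<subseteq> carrier S'.TG" by auto
  show "carrier S'.TG \<subseteq> proj ` carrier S.TG"
  proof (rule S'.tensor_subgroup[OF img_is_subgroup])
    fix m v assume m: "m \<in> carrier M" and "v \<in> carrier (add_group S')"
    then obtain u where "u \<in> carrier S" "v = \<rho> u" using surj by auto
    then show "S'.tn m v \<in> proj ` carrier S.TG"
      using m S.tens_closed[of m u] proj(2)[of m u, symmetric] by auto
  qed
qed

lemma proj_act:
  assumes "c \<in> carrier S.TG" "r \<in> carrier S"
  shows "proj (ract S.TM c r) = ract S'.TM (proj c) (\<rho> r)"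
proof -
  have "(proj \<circ> (\<lambda>c. ract S.TM c r)) c = ((\<lambda>c. ract S'.TM c (\<rho> r)) \<circ> proj) c"
    by (rule S.tensor_hom_eq[OF S'.TG_group hom_compose[OF S.act(1) proj(1)]
            hom_compose[OF proj(1) S'.act(1)] _ assms(1)])
       (use assms in \<open>auto simp: S.act(2) S'.act(2) proj(2) \<rho>_simps\<close>)
  then show ?thesis by simp
qed

text \<open>For the inclusion in the span U of J, a map from the tensor product over S' to the
  quotient by U is built from m \<otimes> v \<mapsto> [m \<otimes> l v], with l a section of \<rho>.
  Its composite with \<open>proj\<close> agrees with the quotient map on pure tensors, hence
  everywhere, so whatever \<open>proj\<close> kills lies in U.\<close>

lemma proj_kernel: "kernel S.TG S'.TG proj = act_span S.TM J"
proof
  let ?U = "act_span S.TM J"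
  have U: "subgroup ?U S.TG"
    using act_span_subgroup[OF S.TM_acted J_carrier] subgroup.subset
    by (simp add: subgroup_def)
  show "kernel S.TG S'.TG proj \<subseteq> ?U"
  proof
    fix c assume "c \<in> kernel S.TG S'.TG proj"
    then have c: "c \<in> carrier S.TG" "proj c = \<one>\<^bsub>S'.TG\<^esub>" by (auto simp: kernel_def)
    interpret TG: comm_group S.TG by (rule S.TG_comm)
    interpret h: ring_hom_ring S S' \<rho>
      by (rule ring_hom_ringI2[OF S.ring_axioms S'.ring_axioms hom])
    note Qc = comm_group.abelian_FactGroup[OF S.TG_comm U]
    have Qg: "group (S.TG Mod ?U)" by (rule comm_group.axioms(2)[OF Qc])
    note q = coset_hom[OF S.TG_comm U]
    \<comment> \<open>m \<otimes> u and m \<otimes> u' differ by (m \<otimes> 1)(u - u'), which is a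
      generator of the span: modulo U, the lift of an element of S' may be chosen freely.\<close>
    have eq: "?U #>\<^bsub>S.TG\<^esub> S.tn m u = ?U #>\<^bsub>S.TG\<^esub> S.tn m u'"
      if m: "m \<in> carrier M" and u: "u \<in> carrier S" "u' \<in> carrier S" "\<rho> u = \<rho> u'" for m u u'
    proof -
      have "\<rho> (u \<ominus>\<^bsub>S\<^esub> u') = \<rho> u \<ominus>\<^bsub>S'\<^esub> \<rho> u'"
        using u by (simp add: a_minus_def \<rho>_simps)
      then have "u \<ominus>\<^bsub>S\<^esub> u' \<in> J"
        using u \<rho>_simps by (simp add: J_def S'.r_right_minus_eq)
      then have "ract S.TM (S.tn m \<one>\<^bsub>S\<^esub>) (u \<ominus>\<^bsub>S\<^esub> u') \<in> ?U"
        using S.tens_closed[of m "\<one>\<^bsub>S\<^esub>"] m by (intro act_span_incl) auto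
      then have "S.tn m u \<otimes>\<^bsub>S.TG\<^esub> inv\<^bsub>S.TG\<^esub> S.tn m u' \<in> ?U"
        using S.act(2)[of "u \<ominus>\<^bsub>S\<^esub> u'" m "\<one>\<^bsub>S\<^esub>"] m u by (simp add: S.tens_minus)
      then show ?thesis
        using m u S.tens_closed[of m u] S.tens_closed[of m u']
        by (intro sym[OF TG.repr_independence[OF _ _ U]]) (auto intro: subgroup.rcos_module_rev[OF U TG.is_group])
    qed
    \<comment> \<open>An arbitrary section, additive only modulo J. Additivity of \<open>k\<close>
      in the second argument is therefore checked on preimages of the two arguments and of their
      sum, not on \<open>l\<close> itself.\<close>
    define l where "l v = inv_into (carrier S) \<rho> v" for v
    have l: "l v \<in> carrier S" "\<rho> (l v) = v" if "v \<in> carrier S'" for v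
      using that surj unfolding l_def by (auto intro: inv_into_into f_inv_into_f)
    define k where "k m v = ?U #>\<^bsub>S.TG\<^esub> S.tn m (l v)" for m v
    have k: "k m (\<rho> u) = ?U #>\<^bsub>S.TG\<^esub> S.tn m u" if "m \<in> carrier M" "u \<in> carrier S" for m u
      unfolding k_def using that l \<rho>_simps by (intro eq) auto
    have ksurj: "\<exists>u. u \<in> carrier S \<and> v = \<rho> u" if "v \<in> carrier (add_group S')" for v
      using that surj by auto
    have cl: "k m v \<in> carrier (S.TG Mod ?U)" if "m \<in> carrier M" "v \<in> carrier (add_group S')" for m v
      unfolding k_def using that l by (intro hom_in_carrier[OF q] S.tens_closed) auto
    have left: "k (m \<otimes>\<^bsub>M\<^esub> m') v = k m v \<otimes>\<^bsub>S.TG Mod ?U\<^esub> k m' v"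
      if "m \<in> carrier M" "m' \<in> carrier M" "v \<in> carrier (add_group S')" for m m' v
      unfolding k_def using that l S.tens_add_left[of m m' "l v"] S.tens_closed
      by (simp add: hom_mult[OF q, symmetric] del: mult_FactGroup)
    have right: "k m (v \<otimes>\<^bsub>add_group S'\<^esub> w) = k m v \<otimes>\<^bsub>S.TG Mod ?U\<^esub> k m w"
      if m: "m \<in> carrier M" and v: "v \<in> carrier (add_group S')" and w: "w \<in> carrier (add_group S')" for m v w
    proof -
      obtain u x where u: "u \<in> carrier S" "v = \<rho> u" "x \<in> carrier S" "w = \<rho> x"
        using ksurj[OF v] ksurj[OF w] by auto
      have "k m (\<rho> (u \<oplus>\<^bsub>S\<^esub> x)) = ?U #>\<^bsub>S.TG\<^esub> (S.tn m u \<otimes>\<^bsub>S.TG\<^esub> S.tn m x)"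
        using m u S.tens_add_right[of m u x] k[of m "u \<oplus>\<^bsub>S\<^esub> x"] by (simp del: h.hom_add)
      also have "\<dots> = k m v \<otimes>\<^bsub>S.TG Mod ?U\<^esub> k m w"
        using m u k S.tens_closed by (simp add: hom_mult[OF q] del: mult_FactGroup)
      finally show ?thesis using u \<rho>_simps by simp
    qed
    have rel: "k m v = k m' v'" if mv: "((m, v), (m', v')) \<in> E'" for m v m' v'
    proof -
      obtain u u' where u: "v = \<rho> u" "v' = \<rho> u'" "((m, u), (m', u')) \<in> E"
        using E_lift[OF mv] by auto
      then have "m \<in> carrier M" "u \<in> carrier S" "m' \<in> carrier M" "u' \<in> carrier S"
        using S.E_carrier by auto
      then show ?thesis using u k S.tens_rel[OF u(3)] by simp
    qed
    note lift = S'.tensor_lift[OF Qc cl left right rel, simplified]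
    have "(tensor_lift (S.TG Mod ?U) k \<circ> proj) c = ?U #>\<^bsub>S.TG\<^esub> c"
      by (rule S.tensor_hom_eq[OF Qg hom_compose[OF proj(1) lift(1)] q _ c(1)])
         (simp add: proj(2) lift(2) \<rho>_simps k)
    then have "?U #>\<^bsub>S.TG\<^esub> c = \<one>\<^bsub>S.TG Mod ?U\<^esub>"
      using c(2) hom_one[OF lift(1) S'.TG_group Qg] by simp
    then show "c \<in> ?U" using TG.coset_join1[OF _ c(1) U] by simp
  qed
  show "act_span S.TM J \<subseteq> kernel S.TG S'.TG proj"
  proof -
    interpret group_hom S.TG S'.TG proj by (rule group_homI[OF S.TG_group S'.TG_group proj(1)])
    have "subgroup (kernel S.TG S'.TG proj) S.TM"
      using subgroup_kernel by (simp add: subgroup_def)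
    then show ?thesis
    proof (rule act_span_least[rotated])
      show "group S.TM" using S.TG_group by simp
      fix m r assume "m \<in> carrier S.TM" "r \<in> J"
      then show "ract S.TM m r \<in> kernel S.TG S'.TG proj"
        using proj_act[of m r] hom_in_carrier[OF S.act(1)] hom_in_carrier[OF proj(1)]
        by (auto simp: kernel_def J_def S'.act_zero)
    qed
  qed
qed

lemma reduction: "reduction S J \<rho> S.TM S'.TM proj"
proof -
  have "kernel S.TM S'.TM proj = kernel S.TG S'.TG proj" by (simp add: kernel_def)
  then show ?thesis
    unfolding reduction_def using proj(1) proj_surj proj_act proj_kernel by simp
qed

end

section \<open>Extension of scalars and base change as instances\<close>

definition balance_pairs where
  "balance_pairs S M \<phi> T =
     {((ract M m s, t), (m, \<phi> s \<otimes>\<^bsub>T\<^esub> t)) |m s t. m \<in> carrier M \<and> s \<in> carrier S \<and> t \<in> carrier T}"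

lemma B_empty: "pair_rels {} = {}"
  by (simp add: pair_rels_def)

lemma B_balance_pairs: "pair_rels (balance_pairs S M \<phi> T) = balanced_rels S M \<phi> T"
proof (intro equalityI subsetI)
  fix x assume "x \<in> balanced_rels S M \<phi> T"
  then obtain m s t where x: "x = frag_of (ract M m s, t) - frag_of (m, \<phi> s \<otimes>\<^bsub>T\<^esub> t)"
      "m \<in> carrier M" "s \<in> carrier S" "t \<in> carrier T"
    unfolding balanced_rels_def by blast
  then have "((ract M m s, t), (m, \<phi> s \<otimes>\<^bsub>T\<^esub> t)) \<in> balance_pairs S M \<phi> T"
    unfolding balance_pairs_def by blast
  then show "x \<in> pair_rels (balance_pairs S M \<phi> T)"
    unfolding pair_rels_def using x(1) by blast
next
  fix x assume "x \<in> pair_rels (balance_pairs S M \<phi> T)"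
  then show "x \<in> balanced_rels S M \<phi> T"
    unfolding pair_rels_def balance_pairs_def balanced_rels_def by auto
qed

lemma ext_scalars_eq: "ext_scalars H T = right_tensor H T {}"
  by (simp add: ext_scalars_def right_tensor_def)

lemma base_change_eq: "base_change S M \<phi> T = right_tensor M T (balanced_rels S M \<phi> T)"
  by (simp add: base_change_def right_tensor_def Let_def)

lemma tensor_pair_empty:
  assumes "\<And>m m'. m \<in> carrier M \<Longrightarrow> m' \<in> carrier M \<Longrightarrow> m \<otimes>\<^bsub>M\<^esub> m' \<in> carrier M"
    and "\<And>n n'. n \<in> carrier N \<Longrightarrow> n' \<in> carrier N \<Longrightarrow> n \<otimes>\<^bsub>N\<^esub> n' \<in> carrier N"
  shows "tensor_pair M N {}"
  using assms by (simp add: tensor_pair_def)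

lemma comm_group_m_closed:
  "comm_group M \<Longrightarrow> m \<in> carrier M \<Longrightarrow> m' \<in> carrier M \<Longrightarrow> m \<otimes>\<^bsub>M\<^esub> m' \<in> carrier M"
  by (meson comm_group.axioms(2) group.is_monoid monoid.m_closed)

lemma scalar_tensor_empty:
  assumes "comm_group H" "ring T"
  shows "scalar_tensor H T {}"
proof -
  interpret ring T by fact
  show ?thesis
    by (intro scalar_tensor.intro scalar_tensor_axioms.intro tensor_pair_empty ring_axioms)
       (auto intro: comm_group_m_closed[OF assms(1)])
qed

lemma scalar_tensor_balance:
  assumes "\<And>m m'. m \<in> carrier M \<Longrightarrow> m' \<in> carrier M \<Longrightarrow> m \<otimes>\<^bsub>M\<^esub> m' \<in> carrier M"
    and "\<And>m s. m \<in> carrier M \<Longrightarrow> s \<in> carrier S \<Longrightarrow> ract M m s \<in> carrier M"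
    and "ring T" "\<phi> ` carrier S \<subseteq> carrier T"
  shows "scalar_tensor M T (balance_pairs S M \<phi> T)"
proof -
  interpret ring T by fact
  have \<phi>: "\<phi> s \<in> carrier T" if "s \<in> carrier S" for s using that assms(4) by auto
  show ?thesis
  proof (intro scalar_tensor.intro scalar_tensor_axioms.intro tensor_pair.intro ring_axioms)
    show "balance_pairs S M \<phi> T \<subseteq> (carrier M \<times> carrier (add_group T)) \<times> carrier M \<times> carrier (add_group T)"
      unfolding balance_pairs_def using \<phi> assms(2) by auto
  next
    fix m u m' u' t assume "((m, u), (m', u')) \<in> balance_pairs S M \<phi> T" and t: "t \<in> carrier T"
    then obtain s where s: "m = ract M m' s" "u' = \<phi> s \<otimes>\<^bsub>T\<^esub> u" "m' \<in> carrier M" "s \<in> carrier S" "u \<in> carrier T"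
      by (auto simp: balance_pairs_def)
    then have "u' \<otimes>\<^bsub>T\<^esub> t = \<phi> s \<otimes>\<^bsub>T\<^esub> (u \<otimes>\<^bsub>T\<^esub> t)" using t \<phi> by (simp add: m_assoc)
    then show "((m, u \<otimes>\<^bsub>T\<^esub> t), (m', u' \<otimes>\<^bsub>T\<^esub> t)) \<in> balance_pairs S M \<phi> T"
      unfolding balance_pairs_def using s t by auto
  qed (use assms(1) in auto)
qed

lemma ext_scalars_acted: "comm_group H \<Longrightarrow> ring T \<Longrightarrow> acted_group T (ext_scalars H T)"
  using scalar_tensor.TM_acted[OF scalar_tensor_empty] unfolding ext_scalars_eq B_empty .

section \<open>Reductions along a surjective ring homomorphism\<close>

locale scalar_quotient = S: ring S + T: ring T
  for S :: "('r, 'y) ring_scheme" and T :: "('s, 'z) ring_scheme" +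
  fixes \<phi> :: "'r \<Rightarrow> 's"
  assumes hom: "\<phi> \<in> ring_hom S T" and surj: "\<phi> ` carrier S = carrier T"
begin

definition "ker = {r \<in> carrier S. \<phi> r = \<zero>\<^bsub>T\<^esub>}"

lemma ker_carrier: "ker \<subseteq> carrier S"
  by (auto simp: ker_def)

lemma tensor_reduction_empty:
  assumes "comm_group H"
  shows "tensor_reduction H S {} T {} \<phi>"
  by (intro tensor_reduction.intro tensor_reduction_axioms.intro scalar_tensor_empty
        assms S.ring_axioms T.ring_axioms hom surj) auto

lemma ext_scalars_reduction:
  assumes "comm_group H"
  shows "reduction S ker \<phi> (ext_scalars H S) (ext_scalars H T) (ztensor_map H (add_group T) id \<phi>)"
    and "h \<in> carrier H \<Longrightarrow> s \<in> carrier S \<Longrightarrow>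
      ztensor_map H (add_group T) id \<phi> (tens H (add_group S) {} h s) = tens H (add_group T) {} h (\<phi> s)"
proof -
  interpret tensor_reduction H S "{}" T "{}" \<phi> by (rule tensor_reduction_empty[OF assms])
  have "proj = ztensor_map H (add_group T) id \<phi>"
    by (simp add: proj_def ztensor_map_def B_empty)
  then show "reduction S ker \<phi> (ext_scalars H S) (ext_scalars H T) (ztensor_map H (add_group T) id \<phi>)"
    and "h \<in> carrier H \<Longrightarrow> s \<in> carrier S \<Longrightarrow>
      ztensor_map H (add_group T) id \<phi> (tens H (add_group S) {} h s) = tens H (add_group T) {} h (\<phi> s)"
    using reduction proj(2) by (simp_all add: B_empty ext_scalars_eq J_def ker_def)
qed

text \<open>Both base changes start from R, along \<psi> and along its composite with \<phi>, so no
  iterated tensor product occurs. A balancing relation over T is given by a scalar r of R and some v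
  in T; any u with \<phi> u = v yields a relation over S above it, since \<open>\<psi>' r\<close>
  times v is the image of \<open>\<psi> r\<close> times u.\<close>

lemma base_change_reduction:
  assumes M: "\<And>m m'. m \<in> carrier M \<Longrightarrow> m' \<in> carrier M \<Longrightarrow> m \<otimes>\<^bsub>M\<^esub> m' \<in> carrier M"
      "\<And>m r. m \<in> carrier M \<Longrightarrow> r \<in> carrier R \<Longrightarrow> ract M m r \<in> carrier M"
    and \<psi>: "\<psi> ` carrier R \<subseteq> carrier S" and \<psi>': "\<And>r. r \<in> carrier R \<Longrightarrow> \<psi>' r = \<phi> (\<psi> r)"
  shows "acted_group S (base_change R M \<psi> S)" and "acted_group T (base_change R M \<psi>' T)"
    and "\<exists>\<pi>. reduction S ker \<phi> (base_change R M \<psi> S) (base_change R M \<psi>' T) \<pi>"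
proof -
  have *: "\<phi> s \<in> carrier T" if "s \<in> carrier S" for s using that surj by auto
  interpret B: scalar_tensor M S "balance_pairs R M \<psi> S"
    by (rule scalar_tensor_balance[OF M S.ring_axioms \<psi>])
  have \<psi>T: "\<psi>' ` carrier R \<subseteq> carrier T" using \<psi> \<psi>' * by auto
  interpret B': scalar_tensor M T "balance_pairs R M \<psi>' T"
    by (rule scalar_tensor_balance[OF M T.ring_axioms \<psi>T])
  show "acted_group S (base_change R M \<psi> S)" "acted_group T (base_change R M \<psi>' T)"
    using B.TM_acted B'.TM_acted by (simp_all add: base_change_eq B_balance_pairs)
  interpret tensor_reduction M S "balance_pairs R M \<psi> S" T "balance_pairs R M \<psi>' T" \<phi>
  proof
    fix m u m' u' assume "((m, u), (m', u')) \<in> balance_pairs R M \<psi> S"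
    then obtain r where r: "m = ract M m' r" "u' = \<psi> r \<otimes>\<^bsub>S\<^esub> u" "m' \<in> carrier M" "r \<in> carrier R" "u \<in> carrier S"
      by (auto simp: balance_pairs_def)
    moreover have "\<psi> r \<in> carrier S" using r \<psi> by auto
    then have "\<phi> u' = \<psi>' r \<otimes>\<^bsub>T\<^esub> \<phi> u" using r \<psi>' ring_hom_mult[OF hom] by simp
    ultimately show "((m, \<phi> u), (m', \<phi> u')) \<in> balance_pairs R M \<psi>' T"
      using * by (auto simp: balance_pairs_def)
  next
    fix m v m' v' assume "((m, v), (m', v')) \<in> balance_pairs R M \<psi>' T"
    then obtain r where r: "m = ract M m' r" "v' = \<psi>' r \<otimes>\<^bsub>T\<^esub> v" "m' \<in> carrier M" "r \<in> carrier R" "v \<in> carrier T"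
      by (auto simp: balance_pairs_def)
    then obtain u where u: "u \<in> carrier S" "v = \<phi> u" using surj by auto
    moreover have "\<psi> r \<in> carrier S" using r \<psi> by auto
    then have "v' = \<phi> (\<psi> r \<otimes>\<^bsub>S\<^esub> u)" using r u \<psi>' ring_hom_mult[OF hom] by simp
    moreover have "((m, u), (m', \<psi> r \<otimes>\<^bsub>S\<^esub> u)) \<in> balance_pairs R M \<psi> S"
      using r u by (auto simp: balance_pairs_def)
    ultimately show "\<exists>u u'. v = \<phi> u \<and> v' = \<phi> u' \<and> ((m, u), (m', u')) \<in> balance_pairs R M \<psi> S"
      by blast
  qed (rule hom surj)+
  show "\<exists>\<pi>. reduction S ker \<phi> (base_change R M \<psi> S) (base_change R M \<psi>' T) \<pi>"
    using reduction by (auto simp: base_change_eq B_balance_pairs J_def ker_def)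
qed

lemma scalar_tensor_acted:
  assumes "acted_group S M"
  shows "scalar_tensor M T (balance_pairs S M \<phi> T)"
  using surj comm_group_m_closed[OF acted_groupD(1)[OF assms]] acted_groupD(3)[OF assms]
  by (intro scalar_tensor_balance T.ring_axioms) auto

text \<open>If t = \<phi> s, then balancing gives m \<otimes> t = m s \<otimes> 1. The elements y
  \<otimes> 1 form a subgroup, so they are everything once they include the pure tensors.\<close>

lemma base_change_surj:
  assumes M: "acted_group S M" and z: "z \<in> carrier (base_change S M \<phi> T)"
  obtains y where "y \<in> carrier M" "z = tens M (add_group T) (balanced_rels S M \<phi> T) y \<one>\<^bsub>T\<^esub>"
proof -
  interpret B: scalar_tensor M T "balance_pairs S M \<phi> T" by (rule scalar_tensor_acted[OF M])
  have h: "(\<lambda>y. B.tn y \<one>\<^bsub>T\<^esub>) \<in> hom M B.TG"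
    by (rule homI) (simp_all add: B.tens_closed B.tens_add_left)
  interpret group_hom M B.TG "\<lambda>y. B.tn y \<one>\<^bsub>T\<^esub>"
    by (rule group_homI[OF acted_groupD(2)[OF M] B.TG_group h])
  have "carrier B.TG \<subseteq> (\<lambda>y. B.tn y \<one>\<^bsub>T\<^esub>) ` carrier M"
  proof (rule B.tensor_subgroup[OF img_is_subgroup])
    fix m t assume m: "m \<in> carrier M" and t: "t \<in> carrier (add_group T)"
    then obtain s where s: "s \<in> carrier S" "t = \<phi> s" using surj by auto
    have "((ract M m s, \<one>\<^bsub>T\<^esub>), (m, \<phi> s \<otimes>\<^bsub>T\<^esub> \<one>\<^bsub>T\<^esub>)) \<in> balance_pairs S M \<phi> T"
      using m s by (auto simp: balance_pairs_def)
    moreover have "\<phi> s \<in> carrier T" using s surj by auto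
    ultimately have "B.tn m t = B.tn (ract M m s) \<one>\<^bsub>T\<^esub>"
      using B.tens_rel s by fastforce
    then show "B.tn m t \<in> (\<lambda>y. B.tn y \<one>\<^bsub>T\<^esub>) ` carrier M"
      using acted_groupD(3)[OF M m s(1)] by blast
  qed
  then show thesis
    using z that by (auto simp: base_change_eq B_balance_pairs)
qed

lemma base_change_map_tens:
  assumes M: "acted_group S M" and N: "acted_group S N" and f: "rlinear S M N f"
    and "m \<in> carrier M" "t \<in> carrier T"
  shows "base_change_map S N \<phi> T f (tens M (add_group T) (balanced_rels S M \<phi> T) m t) =
    tens N (add_group T) (balanced_rels S N \<phi> T) (f m) t"
proof -
  interpret B: scalar_tensor M T "balance_pairs S M \<phi> T" by (rule scalar_tensor_acted[OF M])
  interpret B': scalar_tensor N T "balance_pairs S N \<phi> T" by (rule scalar_tensor_acted[OF N])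
  have fh: "f \<in> hom M N" and fr: "f (ract M m r) = ract N (f m) r" if "m \<in> carrier M" "r \<in> carrier S" for m r
    using f that by (auto simp: rlinear_def)
  have fh: "f \<in> hom M N" using f by (simp add: rlinear_def)
  note fc = hom_in_carrier[OF fh]
  have cl: "B'.tn (f m) t \<in> carrier B'.TG" if "m \<in> carrier M" "t \<in> carrier (add_group T)" for m t
    using that fc by (intro B'.tens_closed) auto
  have left: "B'.tn (f (m \<otimes>\<^bsub>M\<^esub> m')) t = B'.tn (f m) t \<otimes>\<^bsub>B'.TG\<^esub> B'.tn (f m') t"
    if "m \<in> carrier M" "m' \<in> carrier M" "t \<in> carrier (add_group T)" for m m' t
    unfolding hom_mult[OF fh that(1,2)] using that fc by (intro B'.tens_add_left) auto
  have right: "B'.tn (f m) (t \<otimes>\<^bsub>add_group T\<^esub> t') = B'.tn (f m) t \<otimes>\<^bsub>B'.TG\<^esub> B'.tn (f m) t'"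
    if "m \<in> carrier M" "t \<in> carrier (add_group T)" "t' \<in> carrier (add_group T)" for m t t'
    using that fc by (intro B'.tens_add_right) auto
  have rel: "B'.tn (f m) t = B'.tn (f m') t'" if "((m, t), (m', t')) \<in> balance_pairs S M \<phi> T" for m t m' t'
  proof (rule B'.tens_rel)
    obtain r where "m = ract M m' r" "t' = \<phi> r \<otimes>\<^bsub>T\<^esub> t" "m' \<in> carrier M" "r \<in> carrier S" "t \<in> carrier T"
      using \<open>((m, t), (m', t')) \<in> _\<close> by (auto simp: balance_pairs_def)
    then show "((f m, t), (f m', t')) \<in> balance_pairs S N \<phi> T"
      using fr fc by (auto simp: balance_pairs_def)
  qed
  have "base_change_map S N \<phi> T f = tensor_lift B'.TG (\<lambda>m t. B'.tn (f m) t)"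
    by (simp add: base_change_map_def Let_def B_balance_pairs)
  then show ?thesis
    using B.tensor_lift(2)[OF B'.TG_comm cl left right rel, of m t] assms(4,5)
    by (simp add: B_balance_pairs)
qed

text \<open>By \<open>base_change_surj\<close> every element has the form y \<otimes> 1, so this
  evaluates the canonical map completely. The module laws \<open>act_add\<close> and
  \<open>act_assoc\<close> of H \<otimes> T make the map well defined, and \<open>act_one\<close>
  gives the value.\<close>

lemma free_base_change_iso_tens:
  assumes H: "comm_group H" and m: "m \<in> carrier (ext_scalars H S)"
  shows "free_base_change_iso H \<phi> T
      (tens (ext_scalars H S) (add_group T) (balanced_rels S (ext_scalars H S) \<phi> T) m \<one>\<^bsub>T\<^esub>) =
    ztensor_map H (add_group T) id \<phi> m"
proof -
  let ?M = "ext_scalars H S" and ?L = "ext_scalars H T" and ?\<pi> = "ztensor_map H (add_group T) id \<phi>"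
  note M = ext_scalars_acted[OF H S.ring_axioms] and L = ext_scalars_acted[OF H T.ring_axioms]
  note red = ext_scalars_reduction(1)[OF H]
  interpret B: scalar_tensor ?M T "balance_pairs S ?M \<phi> T" by (rule scalar_tensor_acted[OF M])
  interpret E: scalar_tensor H T "{}" by (rule scalar_tensor_empty[OF H T.ring_axioms])
  have Lc: "carrier ?L = carrier E.TG" "monoid.mult ?L = monoid.mult E.TG" "?L = E.TM"
    by (simp_all add: ext_scalars_eq B_empty)
  note \<pi>c = hom_in_carrier[OF reductionD(1)[OF red]]
  have cl: "ract ?L (?\<pi> m) t \<in> carrier ?L" if "m \<in> carrier ?M" "t \<in> carrier (add_group T)" for m t
    using that acted_groupD(3)[OF L \<pi>c] by simp
  have left: "ract ?L (?\<pi> (m \<otimes>\<^bsub>?M\<^esub> m')) t = ract ?L (?\<pi> m) t \<otimes>\<^bsub>?L\<^esub> ract ?L (?\<pi> m') t"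
    if "m \<in> carrier ?M" "m' \<in> carrier ?M" "t \<in> carrier (add_group T)" for m m' t
    unfolding hom_mult[OF reductionD(1)[OF red] that(1,2)]
    using hom_mult[OF acted_groupD(4)[OF L] \<pi>c \<pi>c] that by simp
  have right: "ract ?L (?\<pi> m) (t \<otimes>\<^bsub>add_group T\<^esub> t') = ract ?L (?\<pi> m) t \<otimes>\<^bsub>?L\<^esub> ract ?L (?\<pi> m) t'"
    if "m \<in> carrier ?M" "t \<in> carrier (add_group T)" "t' \<in> carrier (add_group T)" for m t t'
    using E.act_add[of "?\<pi> m" t t'] that \<pi>c by (simp add: Lc)
  have rel: "ract ?L (?\<pi> m) t = ract ?L (?\<pi> m') t'"
    if "((m, t), (m', t')) \<in> balance_pairs S ?M \<phi> T" for m t m' t'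
  proof -
    obtain r where r: "m = ract ?M m' r" "t' = \<phi> r \<otimes>\<^bsub>T\<^esub> t" "m' \<in> carrier ?M" "r \<in> carrier S" "t \<in> carrier T"
      using \<open>((m, t), (m', t')) \<in> _\<close> by (auto simp: balance_pairs_def)
    moreover have "\<phi> r \<in> carrier T" using r surj by auto
    ultimately show ?thesis
      using E.act_assoc[of "?\<pi> m'" "\<phi> r" t] \<pi>c[of m'] reductionD(3)[OF red] by (simp add: Lc)
  qed
  have "free_base_change_iso H \<phi> T (B.tn m \<one>\<^bsub>T\<^esub>) = ract ?L (?\<pi> m) \<one>\<^bsub>T\<^esub>"
    using B.tensor_lift(2)[OF acted_groupD(1)[OF L] cl left right rel m, of "\<one>\<^bsub>T\<^esub>"]
    by (simp add: free_base_change_iso_def)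
  also have "\<dots> = ?\<pi> m"
    using E.act_one \<pi>c[OF m] by (simp add: Lc)
  finally show ?thesis by (simp add: B_balance_pairs)
qed

text \<open>The map is defined through \<open>inv_into\<close>, which returns some y \<otimes> 1
  lying over the projection of m. Then y and m have the same projection, so they differ by an
  element of the span of \<open>ker\<close>. By linearity D sends this into the span of
  \<open>ker\<close> in K \<otimes> S, where the projection vanishes. Hence D y and D m have the
  same image, whichever y was returned.\<close>

lemma free_base_change_map_proj:
  assumes H: "comm_group H" and K: "comm_group K"
    and D: "rlinear S (ext_scalars H S) (ext_scalars K S) D"
    and m: "m \<in> carrier (ext_scalars H S)"
  shows "free_base_change_map S \<phi> T H K D (ztensor_map H (add_group T) id \<phi> m) =
    ztensor_map K (add_group T) id \<phi> (D m)"
proof -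
  let ?M = "ext_scalars H S" and ?N = "ext_scalars K S"
  let ?\<pi> = "ztensor_map H (add_group T) id \<phi>" and ?\<sigma> = "ztensor_map K (add_group T) id \<phi>"
  let ?i = "free_base_change_iso H \<phi> T" and ?C = "carrier (base_change S ?M \<phi> T)"
  let ?t = "\<lambda>m. tens ?M (add_group T) (balanced_rels S ?M \<phi> T) m \<one>\<^bsub>T\<^esub>"
  note M = ext_scalars_acted[OF H S.ring_axioms] and N = ext_scalars_acted[OF K S.ring_axioms]
  note M' = ext_scalars_acted[OF H T.ring_axioms] and N' = ext_scalars_acted[OF K T.ring_axioms]
  interpret B: scalar_tensor ?M T "balance_pairs S ?M \<phi> T" by (rule scalar_tensor_acted[OF M])
  have Dh: "D \<in> hom ?M ?N" using D by (simp add: rlinear_def)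
  interpret D: group_hom ?M ?N D by (rule group_homI[OF acted_groupD(2)[OF M] acted_groupD(2)[OF N] Dh])
  define z where "z = inv_into ?C ?i (?\<pi> m)"
  have "?t m \<in> ?C"
    using B.tens_closed[OF m, of "\<one>\<^bsub>T\<^esub>"] by (simp add: base_change_eq B_balance_pairs)
  then have im: "?\<pi> m \<in> ?i ` ?C"
    using free_base_change_iso_tens[OF H m] by (metis imageI)
  have z: "z \<in> ?C" "?i z = ?\<pi> m"
    unfolding z_def using inv_into_into[OF im] f_inv_into_f[OF im] by auto
  obtain y where y: "y \<in> carrier ?M" "z = ?t y"
    using base_change_surj[OF M z(1)] by auto
  then have "?\<pi> y = ?\<pi> m"
    using z free_base_change_iso_tens[OF H y(1)] by simp
  then have "y \<otimes>\<^bsub>?M\<^esub> inv\<^bsub>?M\<^esub> m \<in> act_span ?M ker"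
    using reduction_eq_iff[OF ext_scalars_reduction(1)[OF H] acted_groupD(2)[OF M] acted_groupD(2)[OF M'] y(1) m]
    by simp
  then have "D (y \<otimes>\<^bsub>?M\<^esub> inv\<^bsub>?M\<^esub> m) \<in> act_span ?N ker"
    using rlinear_act_span[OF M N ker_carrier D] by auto
  then have "D y \<otimes>\<^bsub>?N\<^esub> inv\<^bsub>?N\<^esub> D m \<in> act_span ?N ker"
    using y(1) m by simp
  then have eq: "?\<sigma> (D y) = ?\<sigma> (D m)"
    using reduction_eq_iff[OF ext_scalars_reduction(1)[OF K] acted_groupD(2)[OF N] acted_groupD(2)[OF N']]
      y(1) m by simp
  have "free_base_change_map S \<phi> T H K D (?\<pi> m) =
      free_base_change_iso K \<phi> T (base_change_map S ?N \<phi> T D (?t y))"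
    using y by (simp add: free_base_change_map_def z_def)
  also have "\<dots> = ?\<sigma> (D y)"
    using base_change_map_tens[OF M N D y(1)] free_base_change_iso_tens[OF K] y(1) by simp
  finally show ?thesis using eq by simp
qed

text \<open>Every element of H \<otimes> T is the projection of one of H \<otimes> S and every
  scalar of T lifts to S, so the commuting square with D transfers additivity and linearity.\<close>

lemma free_base_change_map_linear:
  assumes H: "comm_group H" and K: "comm_group K"
    and D: "rlinear S (ext_scalars H S) (ext_scalars K S) D"
  shows "rlinear T (ext_scalars H T) (ext_scalars K T) (free_base_change_map S \<phi> T H K D)"
proof -
  let ?M = "ext_scalars H S" and ?N = "ext_scalars K S" and ?M' = "ext_scalars H T" and ?N' = "ext_scalars K T"
  let ?\<pi> = "ztensor_map H (add_group T) id \<phi>" and ?\<sigma> = "ztensor_map K (add_group T) id \<phi>"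
  let ?D = "free_base_change_map S \<phi> T H K D"
  note M = ext_scalars_acted[OF H S.ring_axioms] and N = ext_scalars_acted[OF K S.ring_axioms]
  note \<pi> = ext_scalars_reduction(1)[OF H] and \<sigma> = ext_scalars_reduction(1)[OF K]
  note comm = free_base_change_map_proj[OF H K D]
  have Dh: "D \<in> hom ?M ?N" and Dr: "\<And>m r. m \<in> carrier ?M \<Longrightarrow> r \<in> carrier S \<Longrightarrow> D (ract ?M m r) = ract ?N (D m) r"
    using D by (auto simp: rlinear_def)
  have ex: "\<exists>m\<in>carrier ?M. x = ?\<pi> m" if "x \<in> carrier ?M'" for x
    using that reductionD(2)[OF \<pi>] by blast
  have "?D \<in> hom ?M' ?N'"
  proof (rule homI)
    fix x assume "x \<in> carrier ?M'"
    then obtain m where "m \<in> carrier ?M" "x = ?\<pi> m" using ex by blast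
    then show "?D x \<in> carrier ?N'"
      using comm hom_in_carrier[OF Dh] hom_in_carrier[OF reductionD(1)[OF \<sigma>]] by simp
  next
    fix x y assume "x \<in> carrier ?M'" "y \<in> carrier ?M'"
    then obtain m n where mn: "m \<in> carrier ?M" "x = ?\<pi> m" "n \<in> carrier ?M" "y = ?\<pi> n"
      using ex by metis
    have "m \<otimes>\<^bsub>?M\<^esub> n \<in> carrier ?M"
      using mn by (intro comm_group_m_closed acted_groupD(1)[OF M])
    then have "?D (?\<pi> (m \<otimes>\<^bsub>?M\<^esub> n)) = ?\<sigma> (D m \<otimes>\<^bsub>?N\<^esub> D n)"
      using comm mn by (simp add: hom_mult[OF Dh])
    then show "?D (x \<otimes>\<^bsub>?M'\<^esub> y) = ?D x \<otimes>\<^bsub>?N'\<^esub> ?D y"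
      using mn comm hom_in_carrier[OF Dh]
      by (simp add: hom_mult[OF reductionD(1)[OF \<pi>]] hom_mult[OF reductionD(1)[OF \<sigma>]])
  qed
  moreover have "?D (ract ?M' x t) = ract ?N' (?D x) t" if x: "x \<in> carrier ?M'" and t: "t \<in> carrier T" for x t
  proof -
    obtain m where m: "m \<in> carrier ?M" "x = ?\<pi> m" using ex[OF x] by blast
    obtain r where r: "r \<in> carrier S" "t = \<phi> r" using surj t by auto
    have "?D (ract ?M' x t) = ?D (?\<pi> (ract ?M m r))"
      using reductionD(3)[OF \<pi>] m r by simp
    also have "\<dots> = ?\<sigma> (ract ?N (D m) r)"
      using comm[OF acted_groupD(3)[OF M m(1) r(1)]] Dr[OF m(1) r(1)] by simp
    also have "\<dots> = ract ?N' (?D x) t"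
      using reductionD(3)[OF \<sigma> hom_in_carrier[OF Dh m(1)] r(1)] comm m r by simp
    finally show ?thesis .
  qed
  ultimately show ?thesis by (simp add: rlinear_def)
qed

end

subsection \<open>Filtrations\<close>

text \<open>\<open>gr_ring\<close> and \<open>gr_mod\<close> are quotients of a subgroup obtained by
  overwriting the carrier. The operation is untouched, so cosets taken in \<open>G\<close> and in
  the subgroup coincide.\<close>

lemma sub_quotient:
  assumes "comm_group G" "subgroup U G" "subgroup U' G" "U' \<subseteq> U"
  shows "comm_group (G\<lparr>carrier := U\<rparr>)" "subgroup U' (G\<lparr>carrier := U\<rparr>)"
    and "comm_group (G\<lparr>carrier := U\<rparr> Mod U')" "group (G\<lparr>carrier := U\<rparr> Mod U')"
    and "carrier (G\<lparr>carrier := U\<rparr> Mod U') = (\<lambda>x. U' #>\<^bsub>G\<^esub> x) ` U"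
    and "(\<lambda>x. U' #>\<^bsub>G\<^esub> x) \<in> hom (G\<lparr>carrier := U\<rparr>) (G\<lparr>carrier := U\<rparr> Mod U')"
    and "\<lbrakk>x \<in> U; y \<in> U\<rbrakk> \<Longrightarrow> (U' #>\<^bsub>G\<^esub> x) \<otimes>\<^bsub>G\<lparr>carrier := U\<rparr> Mod U'\<^esub> (U' #>\<^bsub>G\<^esub> y) = U' #>\<^bsub>G\<^esub> (x \<otimes>\<^bsub>G\<^esub> y)"
proof -
  interpret comm_group G by fact
  show 1: "comm_group (G\<lparr>carrier := U\<rparr>)"
    by (rule group.group_comm_groupI[OF subgroup_imp_group[OF assms(2)]])
       (use subgroup.mem_carrier[OF assms(2)] m_comm in auto)
  show 2: "subgroup U' (G\<lparr>carrier := U\<rparr>)"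
    by (rule subgroup_incl[OF assms(3,2,4)])
  show 3: "comm_group (G\<lparr>carrier := U\<rparr> Mod U')"
    by (rule comm_group.abelian_FactGroup[OF 1 2])
  then show "group (G\<lparr>carrier := U\<rparr> Mod U')" by (rule comm_group.axioms(2))
  show "carrier (G\<lparr>carrier := U\<rparr> Mod U') = (\<lambda>x. U' #>\<^bsub>G\<^esub> x) ` U"
    by (simp add: carrier_FactGroup)
  show 4: "(\<lambda>x. U' #>\<^bsub>G\<^esub> x) \<in> hom (G\<lparr>carrier := U\<rparr>) (G\<lparr>carrier := U\<rparr> Mod U')"
    using coset_hom[OF 1 2] by simp
  show "(U' #>\<^bsub>G\<^esub> x) \<otimes>\<^bsub>G\<lparr>carrier := U\<rparr> Mod U'\<^esub> (U' #>\<^bsub>G\<^esub> y) = U' #>\<^bsub>G\<^esub> (x \<otimes>\<^bsub>G\<^esub> y)"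
    if "x \<in> U" "y \<in> U"
    using hom_mult[OF 4, of x y] that by simp
qed

lemma coset_eq_iff:
  assumes "group G" "subgroup U G" "x \<in> carrier G" "y \<in> carrier G"
  shows "U #>\<^bsub>G\<^esub> x = U #>\<^bsub>G\<^esub> y \<longleftrightarrow> x \<otimes>\<^bsub>G\<^esub> inv\<^bsub>G\<^esub> y \<in> U"
proof -
  interpret group G by fact
  show ?thesis
    using subgroup.rcos_module[OF assms(2) group_axioms assms(4,3)] repr_independence[OF _ assms(4,2), of x]
      rcos_self[OF assms(3,2)] by auto
qed

text \<open>Covers all maps between graded pieces: \<open>gr_ring_map\<close> and
  \<open>gr_map\<close> with the steps s and s + 1 on both sides, \<open>E1_map\<close> with the
  steps of the target raised by one.\<close>

lemma coset_map_sub: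
  assumes G: "comm_group G" "subgroup U G" "subgroup U' G" "U' \<subseteq> U"
    and N: "comm_group N" "subgroup V N" "subgroup V' N" "V' \<subseteq> V"
    and f: "f \<in> hom G N" "f ` U \<subseteq> V" "f ` U' \<subseteq> V'"
  shows "coset_map N V' f \<in> hom (G\<lparr>carrier := U\<rparr> Mod U') (N\<lparr>carrier := V\<rparr> Mod V')"
    and "x \<in> U \<Longrightarrow> coset_map N V' f (U' #>\<^bsub>G\<^esub> x) = V' #>\<^bsub>N\<^esub> f x"
proof -
  have U: "U \<subseteq> carrier G" by (rule subgroup.subset[OF G(2)])
  have h: "f \<in> hom (G\<lparr>carrier := U\<rparr>) (N\<lparr>carrier := V\<rparr>)"
    using f(1,2) U by (auto simp: hom_def subset_iff)
  have eq: "coset_map (N\<lparr>carrier := V\<rparr>) V' f = coset_map N V' f"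
    by (simp add: coset_map_def[abs_def])
  note * = coset_map_coset[OF sub_quotient(1,2)[OF G] sub_quotient(1,2)[OF N] h f(3), unfolded eq]
  show "coset_map N V' f \<in> hom (G\<lparr>carrier := U\<rparr> Mod U') (N\<lparr>carrier := V\<rparr> Mod V')"
    by (rule *(1))
  show "x \<in> U \<Longrightarrow> coset_map N V' f (U' #>\<^bsub>G\<^esub> x) = V' #>\<^bsub>N\<^esub> f x"
    using *(2)[of x] by simp
qed

locale filtration = ring S for S :: "('r, 'z) ring_scheme" (structure) and F +
  assumes F_subgroup: "subgroup (F s) (add_group S)" and F_Suc: "F (Suc s) \<subseteq> F s"
begin

lemma F_carrier: "F s \<subseteq> carrier S"
  using subgroup.subset[OF F_subgroup] by simp

lemma F_antimono: "s \<le> t \<Longrightarrow> F t \<subseteq> F s"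
  by (rule lift_Suc_antimono_le[of F, OF F_Suc])

lemma gr_ring_comm: "comm_group (gr_ring S F s)"
  unfolding gr_ring_def by (rule sub_quotient(3)[OF add_group_comm F_subgroup F_subgroup F_Suc])

lemma carrier_gr_ring: "carrier (gr_ring S F s) = (\<lambda>x. F (Suc s) #>\<^bsub>add_group S\<^esub> x) ` F s"
  unfolding gr_ring_def by (rule sub_quotient(5)[OF add_group_comm F_subgroup F_subgroup F_Suc])

context
  fixes M :: "('m, 'r) rmodule"
  assumes M: "acted_group S M"
begin

lemma mod_filt_subgroup: "subgroup (mod_filt M F s) M"
  unfolding mod_filt_def act_span_def[symmetric] by (rule act_span_subgroup[OF M F_carrier])

lemma mod_filt_Suc: "mod_filt M F (Suc s) \<subseteq> mod_filt M F s"
  unfolding mod_filt_def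
  by (rule group.mono_generate[OF acted_groupD(2)[OF M]]) (use F_Suc in blast)

lemma mod_filt_antimono: "s \<le> t \<Longrightarrow> mod_filt M F t \<subseteq> mod_filt M F s"
  by (rule lift_Suc_antimono_le[of "mod_filt M F", OF mod_filt_Suc])

lemma mod_filt_carrier: "mod_filt M F s \<subseteq> carrier M"
  by (rule subgroup.subset[OF mod_filt_subgroup])

lemmas gr_mod_quotient = sub_quotient[OF acted_groupD(1)[OF M] mod_filt_subgroup mod_filt_subgroup mod_filt_Suc,
    folded gr_mod_def]

end

text \<open>A linear map preserves the steps of the filtration, so \<open>gr_map\<close> sends the
  class of x to that of f x, which is trivial exactly when f x lies in the next step. The inclusions
  on the right are what passes to the quotient ring.\<close>

lemma gr_map_zero_iff:
  assumes M: "acted_group S M" and N: "acted_group S N" and f: "rlinear S M N f"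
  shows "gr_map_zero M N F f \<longleftrightarrow> (\<forall>s. f ` mod_filt M F s \<subseteq> mod_filt N F (Suc s))"
proof -
  have fh: "f \<in> hom M N" using f by (simp add: rlinear_def)
  have img: "f ` mod_filt M F s \<subseteq> mod_filt N F s" for s
    unfolding mod_filt_def act_span_def[symmetric] by (rule rlinear_act_span[OF M N F_carrier f])
  have gr: "gr_map N F f s (mod_filt M F (Suc s) #>\<^bsub>M\<^esub> x) = mod_filt N F (Suc s) #>\<^bsub>N\<^esub> f x"
    if "x \<in> mod_filt M F s" for s x
    unfolding gr_map_def
    by (rule coset_map_sub(2)[OF acted_groupD(1)[OF M] mod_filt_subgroup[OF M] mod_filt_subgroup[OF M]
          mod_filt_Suc[OF M] acted_groupD(1)[OF N] mod_filt_subgroup[OF N] mod_filt_subgroup[OF N]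
          mod_filt_Suc[OF N] fh img img that])
  have one: "\<one>\<^bsub>gr_mod N F s\<^esub> = mod_filt N F (Suc s)" for s
    by (simp add: gr_mod_def)
  have mem: "mod_filt N F (Suc s) #>\<^bsub>N\<^esub> f x = mod_filt N F (Suc s) \<longleftrightarrow> f x \<in> mod_filt N F (Suc s)"
    if "x \<in> mod_filt M F s" for s x
    using group.coset_join1[OF acted_groupD(2)[OF N] _ _ mod_filt_subgroup[OF N]]
      subgroup.rcos_const[OF mod_filt_subgroup[OF N] acted_groupD(2)[OF N]]
      mod_filt_carrier[OF M] that hom_in_carrier[OF fh] by blast
  show ?thesis
    unfolding gr_map_zero_def gr_mod_quotient(5)[OF M] one by (auto simp: gr mem)
qed

end

text \<open>The identification is h \<otimes> [r] \<mapsto> [h \<otimes> \<eta> r] in degree s. As a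
  homomorphism it is determined by this formula, so identifications over two rings can be compared
  on such classes.\<close>

lemma gr_ident_hom:
  assumes R: "filtration R G" and S: "filtration S F" and H: "comm_group H"
    and \<eta>: "\<eta> \<in> ring_hom R S" "\<And>s. \<eta> ` G s \<subseteq> F s"
  shows "gr_tensor_map S F H s \<circ> ztensor_map H (gr_ring S F s) id (gr_ring_map S F \<eta> s)
      \<in> hom (ztensor H (gr_ring R G s)) (gr_mod (ext_scalars H S) F s)" (is "?i \<in> _")
    and "\<lbrakk>h \<in> carrier H; r \<in> G s\<rbrakk> \<Longrightarrow>
      (gr_tensor_map S F H s \<circ> ztensor_map H (gr_ring S F s) id (gr_ring_map S F \<eta> s))
        (tens H (gr_ring R G s) {} h (G (Suc s) #>\<^bsub>add_group R\<^esub> r)) =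
      mod_filt (ext_scalars H S) F (Suc s) #>\<^bsub>ext_scalars H S\<^esub> tens H (add_group S) {} h (\<eta> r)"
proof -
  interpret R: filtration R G by fact
  interpret S: filtration S F by fact
  let ?M = "ext_scalars H S" and ?t = "tens H (add_group S) {}"
  interpret E: scalar_tensor H S "{}" by (rule scalar_tensor_empty[OF H S.ring_axioms])
  note M = ext_scalars_acted[OF H S.ring_axioms]
  have Mc: "carrier ?M = carrier E.TG" "monoid.mult ?M = monoid.mult E.TG" "?M = E.TM"
    by (simp_all add: ext_scalars_eq pair_rels_def)
  have tens_eq: "E.tn = ?t" by (simp add: pair_rels_def)
  have th: "(\<lambda>r. ?t h r) \<in> hom (add_group S) ?M" if "h \<in> carrier H" for h
    using E.tens_hom[OF that] by (simp add: ext_scalars_eq pair_rels_def)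
  \<comment> \<open>For r in F s, the equation h \<otimes> r = (h \<otimes> 1) r exhibits the pure
    tensor as a generator of the filtration step.\<close>
  have mem: "?t h r \<in> mod_filt ?M F s" if "h \<in> carrier H" "r \<in> F s" for h r s
  proof -
    have r: "r \<in> carrier S" using that S.F_carrier by auto
    have "ract ?M (?t h \<one>\<^bsub>S\<^esub>) r \<in> mod_filt ?M F s"
      unfolding mod_filt_def act_span_def[symmetric]
      using that E.tens_closed[of h "\<one>\<^bsub>S\<^esub>"] by (intro act_span_incl) (auto simp: Mc tens_eq)
    then show ?thesis
      using E.act(2)[OF r that(1), of "\<one>\<^bsub>S\<^esub>"] r by (simp add: Mc tens_eq)
  qed
  note cm = coset_map_sub[OF S.add_group_comm S.F_subgroup S.F_subgroup S.F_Suc acted_groupD(1)[OF M]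
      S.mod_filt_subgroup[OF M] S.mod_filt_subgroup[OF M] S.mod_filt_Suc[OF M] th, folded gr_ring_def gr_mod_def]
  have cm1: "coset_map ?M (mod_filt ?M F (Suc s)) (\<lambda>r. ?t h r) \<in> hom (gr_ring S F s) (gr_mod ?M F s)"
    and cm2: "r \<in> F s \<Longrightarrow> coset_map ?M (mod_filt ?M F (Suc s)) (\<lambda>r. ?t h r) (F (Suc s) #>\<^bsub>add_group S\<^esub> r) =
      mod_filt ?M F (Suc s) #>\<^bsub>?M\<^esub> ?t h r"
    if "h \<in> carrier H" for h r
    using cm[OF that] mem[OF that] by blast+
  let ?f = "\<lambda>h c. coset_map ?M (mod_filt ?M F (Suc s)) (\<lambda>r. ?t h r) c"
  note gc = S.gr_ring_comm[of s] and mc = S.gr_mod_quotient(3)[OF M, of s]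
  interpret A: tensor_pair H "gr_ring S F s" "{}"
    by (rule tensor_pair_empty) (auto intro: comm_group_m_closed[OF H] comm_group_m_closed[OF gc])
  have Ae: "A.TG = ztensor H (gr_ring S F s)" "A.tn = tens H (gr_ring S F s) {}"
    by (simp_all add: pair_rels_def)
  have cl: "?f h c \<in> carrier (gr_mod ?M F s)" if "h \<in> carrier H" "c \<in> carrier (gr_ring S F s)" for h c
    by (rule hom_in_carrier[OF cm1[OF that(1)] that(2)])
  have left: "?f (h \<otimes>\<^bsub>H\<^esub> h') c = ?f h c \<otimes>\<^bsub>gr_mod ?M F s\<^esub> ?f h' c"
    if h: "h \<in> carrier H" "h' \<in> carrier H" and c: "c \<in> carrier (gr_ring S F s)" for h h' c
  proof -
    obtain r where r: "r \<in> F s" "c = F (Suc s) #>\<^bsub>add_group S\<^esub> r"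
      using c by (auto simp: S.carrier_gr_ring)
    have rc: "r \<in> carrier (add_group S)" using r(1) S.F_carrier by auto
    have "?t (h \<otimes>\<^bsub>H\<^esub> h') r = ?t h r \<otimes>\<^bsub>?M\<^esub> ?t h' r"
      using E.tens_add_left[OF h rc] by (simp add: Mc tens_eq)
    then show ?thesis
      using r h comm_group_m_closed[OF H h] mem[OF h(1) r(1)] mem[OF h(2) r(1)]
      by (simp add: cm2 S.gr_mod_quotient(7)[OF M])
  qed
  have right: "?f h (c \<otimes>\<^bsub>gr_ring S F s\<^esub> d) = ?f h c \<otimes>\<^bsub>gr_mod ?M F s\<^esub> ?f h d"
    if "h \<in> carrier H" "c \<in> carrier (gr_ring S F s)" "d \<in> carrier (gr_ring S F s)" for h c d
    by (rule hom_mult[OF cm1[OF that(1)] that(2,3)])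
  have tl: "gr_tensor_map S F H s \<in> hom (ztensor H (gr_ring S F s)) (gr_mod ?M F s)"
    and tl2: "h \<in> carrier H \<Longrightarrow> c \<in> carrier (gr_ring S F s) \<Longrightarrow>
      gr_tensor_map S F H s (tens H (gr_ring S F s) {} h c) = ?f h c" for h c
    using A.tensor_lift[OF mc cl left right, simplified] unfolding gr_tensor_map_def Ae by blast+
  have \<eta>h: "\<eta> \<in> hom (add_group R) (add_group S)"
    using \<eta>(1) by (auto simp: ring_hom_def hom_def)
  have rm: "gr_ring_map S F \<eta> s \<in> hom (gr_ring R G s) (gr_ring S F s)"
    and rm2: "r \<in> G s \<Longrightarrow> gr_ring_map S F \<eta> s (G (Suc s) #>\<^bsub>add_group R\<^esub> r) = F (Suc s) #>\<^bsub>add_group S\<^esub> \<eta> r" for r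
    unfolding gr_ring_map_def gr_ring_def
    using coset_map_sub[OF R.add_group_comm R.F_subgroup R.F_subgroup R.F_Suc S.add_group_comm S.F_subgroup
      S.F_subgroup S.F_Suc \<eta>h \<eta>(2) \<eta>(2)] by blast+
  interpret A': tensor_pair H "gr_ring R G s" "{}"
    by (rule tensor_pair_empty) (auto intro: comm_group_m_closed[OF H] comm_group_m_closed[OF R.gr_ring_comm])
  have Ae': "A'.TG = ztensor H (gr_ring R G s)" "A'.tn = tens H (gr_ring R G s) {}"
    by (simp_all add: pair_rels_def)
  let ?g = "\<lambda>h c. tens H (gr_ring S F s) {} (id h) (gr_ring_map S F \<eta> s c)"
  note rc = hom_in_carrier[OF rm]
  have cl': "?g h c \<in> carrier A.TG" if "h \<in> carrier H" "c \<in> carrier (gr_ring R G s)" for h c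
    using A.tens_closed[OF that(1) rc[OF that(2)]] by (simp add: Ae)
  have left': "?g (h \<otimes>\<^bsub>H\<^esub> h') c = ?g h c \<otimes>\<^bsub>A.TG\<^esub> ?g h' c"
    if "h \<in> carrier H" "h' \<in> carrier H" "c \<in> carrier (gr_ring R G s)" for h h' c
    using A.tens_add_left[OF that(1,2) rc[OF that(3)]] by (simp add: Ae)
  have right': "?g h (c \<otimes>\<^bsub>gr_ring R G s\<^esub> d) = ?g h c \<otimes>\<^bsub>A.TG\<^esub> ?g h d"
    if "h \<in> carrier H" "c \<in> carrier (gr_ring R G s)" "d \<in> carrier (gr_ring R G s)" for h c d
    unfolding hom_mult[OF rm that(2,3)]
    using A.tens_add_right[OF that(1) rc[OF that(2)] rc[OF that(3)]] by (simp add: Ae)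
  have zm: "ztensor_map H (gr_ring S F s) id (gr_ring_map S F \<eta> s) \<in> hom (ztensor H (gr_ring R G s)) (ztensor H (gr_ring S F s))"
    and zm2: "h \<in> carrier H \<Longrightarrow> c \<in> carrier (gr_ring R G s) \<Longrightarrow>
      ztensor_map H (gr_ring S F s) id (gr_ring_map S F \<eta> s) (tens H (gr_ring R G s) {} h c) = ?g h c" for h c
    using A'.tensor_lift[OF A.TG_comm cl' left' right', simplified] unfolding ztensor_map_def Ae Ae' id_apply by blast+
  show "?i \<in> hom (ztensor H (gr_ring R G s)) (gr_mod ?M F s)"
    by (rule hom_compose[OF zm tl])
  show "?i (tens H (gr_ring R G s) {} h (G (Suc s) #>\<^bsub>add_group R\<^esub> r)) =
      mod_filt ?M F (Suc s) #>\<^bsub>?M\<^esub> ?t h (\<eta> r)" if h: "h \<in> carrier H" and r: "r \<in> G s"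
  proof -
    have c: "G (Suc s) #>\<^bsub>add_group R\<^esub> r \<in> carrier (gr_ring R G s)"
      using r by (auto simp: R.carrier_gr_ring)
    have "\<eta> r \<in> F s" using \<eta>(2) r by auto
    then show ?thesis
      using h r c rc[OF c] by (simp add: zm2 tl2 rm2 cm2)
  qed
qed

text \<open>Used for two sources with the same target R / I^q: the group ring itself and its
  completion. By \<open>F_q\<close> the kernel is the step q; so the graded pieces of S survive
  unchanged in T below degree q, and those of T vanish from degree q on.\<close>

locale filtered_quotient = scalar_quotient S T \<phi> + S: filtration S F + T: filtration T F'
  for S :: "('r, 'y) ring_scheme" and T :: "('s, 'z) ring_scheme" and \<phi> F F' +
  fixes q :: nat
  assumes F'_eq: "F' s = \<phi> ` F s" and F_q: "F q = ker"
begin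

abbreviation "\<pi> H \<equiv> ztensor_map H (add_group T) id \<phi>"

lemmas MS = ext_scalars_acted[OF _ S.ring_axioms]
lemmas MT = ext_scalars_acted[OF _ T.ring_axioms]
lemmas red = ext_scalars_reduction(1)

lemma mod_filt_image:
  assumes "comm_group H"
  shows "\<pi> H ` mod_filt (ext_scalars H S) F s = mod_filt (ext_scalars H T) F' s"
  unfolding mod_filt_def act_span_def[symmetric] F'_eq
  by (rule act_span_image[OF MS[OF assms] MT[OF assms] S.F_carrier])
     (use reductionD[OF red[OF assms]] in auto)

lemma \<pi>_coset:
  assumes "comm_group H" "x \<in> carrier (ext_scalars H S)"
  shows "\<pi> H ` (mod_filt (ext_scalars H S) F s #>\<^bsub>ext_scalars H S\<^esub> x) =
    mod_filt (ext_scalars H T) F' s #>\<^bsub>ext_scalars H T\<^esub> \<pi> H x"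
  using image_coset[OF reductionD(1)[OF red[OF assms(1)]] S.mod_filt_carrier[OF MS[OF assms(1)]] assms(2)]
  by (simp add: mod_filt_image[OF assms(1)])

lemma \<pi>_image_hom:
  assumes H: "comm_group H"
  shows "(\<lambda>c. \<pi> H ` c) \<in> hom (gr_mod (ext_scalars H S) F s) (gr_mod (ext_scalars H T) F' s)"
proof -
  let ?M = "ext_scalars H S" and ?M' = "ext_scalars H T"
  have fc: "x \<in> carrier ?M" "\<pi> H x \<in> mod_filt ?M' F' s" if "x \<in> mod_filt ?M F s" for x
    using that S.mod_filt_carrier[OF MS[OF H]] mod_filt_image[OF H] by blast+
  show ?thesis
  proof (rule homI)
    fix c assume "c \<in> carrier (gr_mod ?M F s)"
    then obtain x where x: "x \<in> mod_filt ?M F s" "c = mod_filt ?M F (Suc s) #>\<^bsub>?M\<^esub> x"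
      by (auto simp: S.gr_mod_quotient(5)[OF MS[OF H]])
    then show "\<pi> H ` c \<in> carrier (gr_mod ?M' F' s)"
      using fc by (simp add: \<pi>_coset[OF H] T.gr_mod_quotient(5)[OF MT[OF H]])
  next
    fix c d assume "c \<in> carrier (gr_mod ?M F s)" "d \<in> carrier (gr_mod ?M F s)"
    then obtain x y where x: "x \<in> mod_filt ?M F s" "c = mod_filt ?M F (Suc s) #>\<^bsub>?M\<^esub> x"
      and y: "y \<in> mod_filt ?M F s" "d = mod_filt ?M F (Suc s) #>\<^bsub>?M\<^esub> y"
      by (auto simp: S.gr_mod_quotient(5)[OF MS[OF H]])
    have "x \<otimes>\<^bsub>?M\<^esub> y \<in> carrier ?M"
      using x y fc by (intro comm_group_m_closed acted_groupD(1)[OF MS[OF H]])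
    then show "\<pi> H ` (c \<otimes>\<^bsub>gr_mod ?M F s\<^esub> d) = \<pi> H ` c \<otimes>\<^bsub>gr_mod ?M' F' s\<^esub> \<pi> H ` d"
      using x y fc
      by (simp add: S.gr_mod_quotient(7)[OF MS[OF H]] \<pi>_coset[OF H] T.gr_mod_quotient(7)[OF MT[OF H]]
          hom_mult[OF reductionD(1)[OF red[OF H]]])
  qed
qed

text \<open>If x and y become equal modulo step s + 1 over T, then x - y has the same projection as
  some z in step s + 1 over S. The difference x - y - z lies in the span of \<open>ker\<close>, that
  is in step q, which is contained in step s + 1 as long as s + 1 \<le> q.\<close>

lemma \<pi>_image_inj:
  assumes H: "comm_group H" and s: "Suc s \<le> q"
    and "c \<in> carrier (gr_mod (ext_scalars H S) F s)" "d \<in> carrier (gr_mod (ext_scalars H S) F s)"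
    and eq: "\<pi> H ` c = \<pi> H ` d"
  shows "c = d"
proof -
  let ?M = "ext_scalars H S" and ?M' = "ext_scalars H T"
  note M = MS[OF H] and M' = MT[OF H]
  note Mg = acted_groupD(2)[OF M] and Mg' = acted_groupD(2)[OF M']
  interpret \<pi>: group_hom ?M ?M' "\<pi> H" by (rule group_homI[OF Mg Mg' reductionD(1)[OF red[OF H]]])
  obtain x y where x: "x \<in> mod_filt ?M F s" "c = mod_filt ?M F (Suc s) #>\<^bsub>?M\<^esub> x"
    and y: "y \<in> mod_filt ?M F s" "d = mod_filt ?M F (Suc s) #>\<^bsub>?M\<^esub> y"
    using assms(3,4) by (auto simp: S.gr_mod_quotient(5)[OF M])
  have xy: "x \<in> carrier ?M" "y \<in> carrier ?M" using x y S.mod_filt_carrier[OF M] by auto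
  have "\<pi> H x \<otimes>\<^bsub>?M'\<^esub> inv\<^bsub>?M'\<^esub> \<pi> H y \<in> mod_filt ?M' F' (Suc s)"
    using eq coset_eq_iff[OF Mg' T.mod_filt_subgroup[OF M'], of "\<pi> H x" "\<pi> H y"] xy x y
    by (simp add: \<pi>_coset[OF H])
  then obtain z where z: "z \<in> mod_filt ?M F (Suc s)" "\<pi> H (x \<otimes>\<^bsub>?M\<^esub> inv\<^bsub>?M\<^esub> y) = \<pi> H z"
    using xy unfolding mod_filt_image[OF H, symmetric] by auto
  have zc: "z \<in> carrier ?M" using z(1) S.mod_filt_carrier[OF M] by auto
  have "x \<otimes>\<^bsub>?M\<^esub> inv\<^bsub>?M\<^esub> y \<in> carrier ?M" using xy by simp
  from reduction_eq_iff[OF red[OF H] Mg Mg' this zc]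
  have "(x \<otimes>\<^bsub>?M\<^esub> inv\<^bsub>?M\<^esub> y) \<otimes>\<^bsub>?M\<^esub> inv\<^bsub>?M\<^esub> z \<in> mod_filt ?M F q"
    unfolding mod_filt_def act_span_def[symmetric] F_q using z(2) by blast
  then have "(x \<otimes>\<^bsub>?M\<^esub> inv\<^bsub>?M\<^esub> y) \<otimes>\<^bsub>?M\<^esub> inv\<^bsub>?M\<^esub> z \<in> mod_filt ?M F (Suc s)"
    using S.mod_filt_antimono[OF M s] by auto
  then have "((x \<otimes>\<^bsub>?M\<^esub> inv\<^bsub>?M\<^esub> y) \<otimes>\<^bsub>?M\<^esub> inv\<^bsub>?M\<^esub> z) \<otimes>\<^bsub>?M\<^esub> z \<in> mod_filt ?M F (Suc s)"
    using z(1) by (rule subgroup.m_closed[OF S.mod_filt_subgroup[OF M]])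
  then have "x \<otimes>\<^bsub>?M\<^esub> inv\<^bsub>?M\<^esub> y \<in> mod_filt ?M F (Suc s)"
    using xy zc by (simp add: \<pi>.G.m_assoc)
  then show ?thesis
    using coset_eq_iff[OF Mg S.mod_filt_subgroup[OF M] xy] x y by simp
qed

text \<open>Both sides are homomorphisms in \<open>y\<close>, so pure tensors decide; on h \<otimes>
  [r] both give the class of h \<otimes> \<phi> (\<eta> r).\<close>

lemma gr_ident_compat:
  assumes R: "filtration R (ideal_pow R I)" and H: "comm_group H"
    and \<eta>: "\<eta> \<in> ring_hom R S" "\<And>s. \<eta> ` ideal_pow R I s \<subseteq> F s"
  shows "gr_ident S F \<eta> H s \<in> hom (ztensor H (gr_ring R (ideal_pow R I) s)) (gr_mod (ext_scalars H S) F s)"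
    and "y \<in> carrier (ztensor H (gr_ring R (ideal_pow R I) s)) \<Longrightarrow>
      gr_ident T F' (\<phi> \<circ> \<eta>) H s y = \<pi> H ` gr_ident S F \<eta> H s y"
proof -
  interpret R: filtration R "ideal_pow R I" by fact
  let ?G = "gr_ring R (ideal_pow R I) s" and ?M = "ext_scalars H S" and ?M' = "ext_scalars H T"
  have \<eta>': "\<phi> \<circ> \<eta> \<in> ring_hom R T" "(\<phi> \<circ> \<eta>) ` ideal_pow R I s \<subseteq> F' s" for s
    using ring_hom_trans[OF \<eta>(1) hom] \<eta>(2)[of s] by (auto simp: F'_eq)
  note i = gr_ident_hom[OF R S.filtration_axioms H \<eta>, where s = s, folded gr_ident_def]
  note i' = gr_ident_hom[OF R T.filtration_axioms H \<eta>', where s = s, folded gr_ident_def]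
  show ih: "gr_ident S F \<eta> H s \<in> hom (ztensor H ?G) (gr_mod ?M F s)" by (rule i(1))
  interpret A: tensor_pair H ?G "{}"
    by (rule tensor_pair_empty) (auto intro: comm_group_m_closed[OF H] comm_group_m_closed[OF R.gr_ring_comm])
  have Ae: "A.TG = ztensor H ?G" "A.tn = tens H ?G {}"
    by (simp_all add: pair_rels_def)
  have gen: "gr_ident T F' (\<phi> \<circ> \<eta>) H s (tens H ?G {} h c) = ((\<lambda>c. \<pi> H ` c) \<circ> gr_ident S F \<eta> H s) (tens H ?G {} h c)"
    if h: "h \<in> carrier H" and c: "c \<in> carrier ?G" for h c
  proof -
    obtain r where r: "r \<in> ideal_pow R I s" "c = ideal_pow R I (Suc s) #>\<^bsub>add_group R\<^esub> r"
      using c by (auto simp: R.carrier_gr_ring)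
    have rc: "r \<in> carrier R" using r(1) R.F_carrier by auto
    have \<eta>r: "\<eta> r \<in> carrier S" using ring_hom_closed[OF \<eta>(1) rc] .
    have tc: "tens H (add_group S) {} h (\<eta> r) \<in> carrier ?M"
    proof -
      interpret E: scalar_tensor H S "{}" by (rule scalar_tensor_empty[OF H S.ring_axioms])
      show ?thesis
        using E.tens_closed[OF h, of "\<eta> r"] \<eta>r by (simp add: ext_scalars_eq pair_rels_def)
    qed
    show ?thesis
      using i(2)[OF h r(1)] i'(2)[OF h r(1)] ext_scalars_reduction(2)[OF H h \<eta>r] \<pi>_coset[OF H tc] r(2)
      by simp
  qed
  show "gr_ident T F' (\<phi> \<circ> \<eta>) H s y = \<pi> H ` gr_ident S F \<eta> H s y" if "y \<in> carrier (ztensor H ?G)"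
    using A.tensor_hom_eq[OF T.gr_mod_quotient(4)[OF MT[OF H]], of "gr_ident T F' (\<phi> \<circ> \<eta>) H s" s
        "(\<lambda>c. \<pi> H ` c) \<circ> gr_ident S F \<eta> H s" y] gen i'(1) hom_compose[OF ih \<pi>_image_hom[OF H]] that
    unfolding Ae by auto
qed

context
  fixes H :: "('h, 'a) monoid_scheme" and K :: "('k, 'b) monoid_scheme" and D
  assumes H: "comm_group H" and K: "comm_group K"
    and D: "rlinear S (ext_scalars H S) (ext_scalars K S) D"
    and D0: "gr_map_zero (ext_scalars H S) (ext_scalars K S) F D"
begin

abbreviation "D' \<equiv> free_base_change_map S \<phi> T H K D"

lemma D_filt: "D ` mod_filt (ext_scalars H S) F s \<subseteq> mod_filt (ext_scalars K S) F (Suc s)"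
  using S.gr_map_zero_iff[OF MS[OF H] MS[OF K] D] D0 by auto

lemma D'_filt: "D' ` mod_filt (ext_scalars H T) F' s \<subseteq> mod_filt (ext_scalars K T) F' (Suc s)"
proof -
  have "D' (\<pi> H x) = \<pi> K (D x)" if "x \<in> mod_filt (ext_scalars H S) F s" for x
    using that S.mod_filt_carrier[OF MS[OF H]] by (intro free_base_change_map_proj[OF H K D]) auto
  then have "D' ` mod_filt (ext_scalars H T) F' s = \<pi> K ` D ` mod_filt (ext_scalars H S) F s"
    unfolding mod_filt_image[OF H, symmetric] image_image by (intro image_cong) auto
  also have "\<dots> \<subseteq> \<pi> K ` mod_filt (ext_scalars K S) F (Suc s)"
    using D_filt by (intro image_mono)
  finally show ?thesis by (simp add: mod_filt_image[OF K])
qed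

lemma D'_gr_map_zero: "gr_map_zero (ext_scalars H T) (ext_scalars K T) F' D'"
  using T.gr_map_zero_iff[OF MT[OF H] MT[OF K] free_base_change_map_linear[OF H K D]] D'_filt by auto

lemma E1_map_coset:
  shows "x \<in> mod_filt (ext_scalars H S) F s \<Longrightarrow>
      E1_map (ext_scalars K S) F D s (mod_filt (ext_scalars H S) F (Suc s) #>\<^bsub>ext_scalars H S\<^esub> x) =
      mod_filt (ext_scalars K S) F (Suc (Suc s)) #>\<^bsub>ext_scalars K S\<^esub> D x" (is "PROP ?S")
    and "x' \<in> mod_filt (ext_scalars H T) F' s \<Longrightarrow>
      E1_map (ext_scalars K T) F' D' s (mod_filt (ext_scalars H T) F' (Suc s) #>\<^bsub>ext_scalars H T\<^esub> x') =
      mod_filt (ext_scalars K T) F' (Suc (Suc s)) #>\<^bsub>ext_scalars K T\<^esub> D' x'" (is "PROP ?T")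
proof -
  have Dh: "D \<in> hom (ext_scalars H S) (ext_scalars K S)"
    and Dh': "D' \<in> hom (ext_scalars H T) (ext_scalars K T)"
    using D free_base_change_map_linear[OF H K D] by (simp_all add: rlinear_def)
  show "PROP ?S"
    unfolding E1_map_def
    by (rule coset_map_sub(2)[OF acted_groupD(1)[OF MS[OF H]] S.mod_filt_subgroup[OF MS[OF H]]
          S.mod_filt_subgroup[OF MS[OF H]] S.mod_filt_Suc[OF MS[OF H]] acted_groupD(1)[OF MS[OF K]]
          S.mod_filt_subgroup[OF MS[OF K]] S.mod_filt_subgroup[OF MS[OF K]] S.mod_filt_Suc[OF MS[OF K]]
          Dh D_filt D_filt])
  show "PROP ?T"
    unfolding E1_map_def
    by (rule coset_map_sub(2)[OF acted_groupD(1)[OF MT[OF H]] T.mod_filt_subgroup[OF MT[OF H]]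
          T.mod_filt_subgroup[OF MT[OF H]] T.mod_filt_Suc[OF MT[OF H]] acted_groupD(1)[OF MT[OF K]]
          T.mod_filt_subgroup[OF MT[OF K]] T.mod_filt_subgroup[OF MT[OF K]] T.mod_filt_Suc[OF MT[OF K]]
          Dh' D'_filt D'_filt])
qed

text \<open>On the class of x both sides are the class of the projection of D x, by the commuting
  square for D. The membership is stated along with it because \<open>\<pi>_image_inj\<close>
  compares elements of the graded piece only.\<close>

lemma E1_map_compat:
  assumes c: "c \<in> carrier (gr_mod (ext_scalars H S) F s)"
  shows "E1_map (ext_scalars K S) F D s c \<in> carrier (gr_mod (ext_scalars K S) F (Suc s))"
    and "E1_map (ext_scalars K T) F' D' s (\<pi> H ` c) = \<pi> K ` E1_map (ext_scalars K S) F D s c"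
proof -
  let ?M = "ext_scalars H S"
  obtain x where x: "x \<in> mod_filt ?M F s" "c = mod_filt ?M F (Suc s) #>\<^bsub>?M\<^esub> x"
    using c by (auto simp: S.gr_mod_quotient(5)[OF MS[OF H]])
  have xc: "x \<in> carrier ?M" using x(1) S.mod_filt_carrier[OF MS[OF H]] by auto
  have Dx: "D x \<in> mod_filt (ext_scalars K S) F (Suc s)" using D_filt x(1) by auto
  have Dxc: "D x \<in> carrier (ext_scalars K S)" using Dx S.mod_filt_carrier[OF MS[OF K]] by auto
  have \<pi>x: "\<pi> H x \<in> mod_filt (ext_scalars H T) F' s" using x(1) mod_filt_image[OF H] by auto
  show "E1_map (ext_scalars K S) F D s c \<in> carrier (gr_mod (ext_scalars K S) F (Suc s))"
    unfolding x(2) E1_map_coset(1)[OF x(1)] S.gr_mod_quotient(5)[OF MS[OF K]] using Dx by simp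
  show "E1_map (ext_scalars K T) F' D' s (\<pi> H ` c) = \<pi> K ` E1_map (ext_scalars K S) F D s c"
    unfolding x(2) E1_map_coset(1)[OF x(1)] \<pi>_coset[OF H xc] \<pi>_coset[OF K Dxc] E1_map_coset(2)[OF \<pi>x]
      free_base_change_map_proj[OF H K D xc] ..
qed

text \<open>
  Neither \<open>H\<close> nor \<open>K\<close> has to be free: below degree \<open>q\<close>, the two identifications that
  \<open>E1_tensor\<close> inverts have the same fibres, so \<open>inv_into\<close> picks the same element in both.
\<close>

lemma E1_tensor_eq:
  assumes R: "filtration R (ideal_pow R I)"
    and \<eta>: "\<eta> \<in> ring_hom R S" "\<And>s. \<eta> ` ideal_pow R I s \<subseteq> F s"
    and s: "Suc s < q" and y: "y \<in> carrier (ztensor H (gr_ring R (ideal_pow R I) s))"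
  shows "E1_tensor R I T F' (\<phi> \<circ> \<eta>) H K D' s y = E1_tensor R I S F \<eta> H K D s y"
proof -
  let ?A = "carrier (ztensor K (gr_ring R (ideal_pow R I) (Suc s)))"
  let ?v = "E1_map (ext_scalars K S) F D s (gr_ident S F \<eta> H s y)"
  note cH = gr_ident_compat[OF R H \<eta>, where s = s] and cK = gr_ident_compat[OF R K \<eta>, where s = "Suc s"]
  have iy: "gr_ident S F \<eta> H s y \<in> carrier (gr_mod (ext_scalars H S) F s)"
    by (rule hom_in_carrier[OF cH(1) y])
  note v = E1_map_compat[OF iy]
  \<comment> \<open>Injectivity is used in the target degree \<open>Suc s\<close>, where
    \<open>\<pi>_image_inj\<close> asks for \<open>Suc (Suc s) \<le> q\<close>. This is the source
    of the strict bound on \<open>s\<close>.\<close>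
  have "gr_ident T F' (\<phi> \<circ> \<eta>) K (Suc s) x = \<pi> K ` ?v \<longleftrightarrow> gr_ident S F \<eta> K (Suc s) x = ?v" if "x \<in> ?A" for x
    using \<pi>_image_inj[OF K _ hom_in_carrier[OF cK(1) that] v(1)] s cK(2)[OF that] by auto
  then have "inv_into ?A (gr_ident T F' (\<phi> \<circ> \<eta>) K (Suc s)) (\<pi> K ` ?v) = inv_into ?A (gr_ident S F \<eta> K (Suc s)) ?v"
    unfolding inv_into_def by (metis (no_types, lifting))
  then show ?thesis
    unfolding E1_tensor_def comp_apply[of _ _ y] using v(2) cH(2)[OF y] by simp
qed

end

end

section \<open>Graded pieces of the quotient ring and the top degree\<close>

context filtered_quotient
begin

text \<open>Onto because F' s is the image of F s. Injective because an x whose image lies in F' (s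
  + 1) differs from some z in F (s + 1) by an element of \<open>ker\<close>, which is F q and hence
  inside F (s + 1).\<close>

lemma gr_ring_map_iso:
  assumes "Suc s \<le> q"
  shows "gr_ring_map T F' \<phi> s \<in> iso (gr_ring S F s) (gr_ring T F' s)"
proof -
  have \<phi>: "\<phi> \<in> hom (add_group S) (add_group T)"
    using hom by (auto simp: ring_hom_def hom_def)
  interpret \<phi>: group_hom "add_group S" "add_group T" \<phi>
    by (rule group_homI[OF comm_group.axioms(2)[OF S.add_group_comm] comm_group.axioms(2)[OF T.add_group_comm] \<phi>])
  have img: "\<phi> ` F s \<subseteq> F' s" for s by (simp add: F'_eq)
  note cm = coset_map_sub[OF S.add_group_comm S.F_subgroup S.F_subgroup S.F_Suc T.add_group_comm
      T.F_subgroup T.F_subgroup T.F_Suc \<phi> img img, folded gr_ring_def gr_ring_map_def]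
  interpret m: group_hom "gr_ring S F s" "gr_ring T F' s" "gr_ring_map T F' \<phi> s"
    by (rule group_homI[OF comm_group.axioms(2)[OF S.gr_ring_comm] comm_group.axioms(2)[OF T.gr_ring_comm] cm(1)])
  have "carrier (gr_ring T F' s) \<subseteq> gr_ring_map T F' \<phi> s ` carrier (gr_ring S F s)"
  proof
    fix c assume "c \<in> carrier (gr_ring T F' s)"
    then obtain x where x: "x \<in> F s" "c = F' (Suc s) #>\<^bsub>add_group T\<^esub> \<phi> x"
      by (auto simp: T.carrier_gr_ring F'_eq)
    then have "c = gr_ring_map T F' \<phi> s (F (Suc s) #>\<^bsub>add_group S\<^esub> x)"
      using cm(2) by simp
    then show "c \<in> gr_ring_map T F' \<phi> s ` carrier (gr_ring S F s)"
      using x(1) by (auto simp: S.carrier_gr_ring)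
  qed
  moreover have "c = \<one>\<^bsub>gr_ring S F s\<^esub>"
    if c: "c \<in> carrier (gr_ring S F s)" and eq: "gr_ring_map T F' \<phi> s c = \<one>\<^bsub>gr_ring T F' s\<^esub>" for c
  proof -
    obtain x where x: "x \<in> F s" "c = F (Suc s) #>\<^bsub>add_group S\<^esub> x"
      using c by (auto simp: S.carrier_gr_ring)
    have xc: "x \<in> carrier S" using x(1) S.F_carrier by auto
    have "F' (Suc s) #>\<^bsub>add_group T\<^esub> \<phi> x = F' (Suc s)"
      using eq x cm(2) by (simp add: gr_ring_def)
    then have "\<phi> x \<in> F' (Suc s)"
      using \<phi>.H.coset_join1[OF _ _ T.F_subgroup] xc \<phi>.hom_closed by simp
    then obtain z where z: "z \<in> F (Suc s)" "\<phi> x = \<phi> z" by (auto simp: F'_eq)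
    have zc: "z \<in> carrier S" using z(1) S.F_carrier by auto
    have d: "x \<otimes>\<^bsub>add_group S\<^esub> inv\<^bsub>add_group S\<^esub> z \<in> carrier (add_group S)"
      by (intro \<phi>.G.m_closed \<phi>.G.inv_closed) (use xc zc in auto)
    moreover have "\<phi> (x \<otimes>\<^bsub>add_group S\<^esub> inv\<^bsub>add_group S\<^esub> z) = \<phi> x \<otimes>\<^bsub>add_group T\<^esub> inv\<^bsub>add_group T\<^esub> \<phi> z"
      using xc zc \<phi>.hom_mult[of x "inv\<^bsub>add_group S\<^esub> z"] \<phi>.hom_inv[of z] \<phi>.G.inv_closed[of z] by simp
    then have "\<phi> (x \<otimes>\<^bsub>add_group S\<^esub> inv\<^bsub>add_group S\<^esub> z) = \<zero>\<^bsub>T\<^esub>"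
      using z(2) zc \<phi>.H.r_inv[of "\<phi> z"] \<phi>.hom_closed[of z] by simp
    ultimately have "x \<otimes>\<^bsub>add_group S\<^esub> inv\<^bsub>add_group S\<^esub> z \<in> F (Suc s)"
      using S.F_antimono[OF assms] by (auto simp: F_q ker_def)
    then have "(x \<otimes>\<^bsub>add_group S\<^esub> inv\<^bsub>add_group S\<^esub> z) \<otimes>\<^bsub>add_group S\<^esub> z \<in> F (Suc s)"
      using z(1) by (rule subgroup.m_closed[OF S.F_subgroup])
    moreover have "(x \<otimes>\<^bsub>add_group S\<^esub> inv\<^bsub>add_group S\<^esub> z) \<otimes>\<^bsub>add_group S\<^esub> z = x"
      using xc zc \<phi>.G.m_assoc[of x "inv\<^bsub>add_group S\<^esub> z" z] \<phi>.G.l_inv[of z] \<phi>.G.r_one[of x] \<phi>.G.inv_closed[of z]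
      by simp
    ultimately show ?thesis
      using subgroup.rcos_const[OF S.F_subgroup \<phi>.G.is_group] x(2) by (simp add: gr_ring_def)
  qed
  ultimately show ?thesis unfolding m.iso_iff by blast
qed

lemma F'_zero:
  assumes "q \<le> s"
  shows "F' s = {\<zero>\<^bsub>T\<^esub>}"
proof -
  have "\<zero>\<^bsub>T\<^esub> \<in> F' s" using subgroup.one_closed[OF T.F_subgroup] by simp
  moreover have "F' s \<subseteq> {\<zero>\<^bsub>T\<^esub>}"
    using S.F_antimono[OF assms] by (auto simp: F'_eq F_q ker_def)
  ultimately show ?thesis by blast
qed

lemma gr_ring_trivial:
  assumes "q \<le> s"
  shows "trivial_group (gr_ring T F' s)"
proof -
  have "\<zero>\<^bsub>T\<^esub> \<in> F' (Suc s)" using subgroup.one_closed[OF T.F_subgroup, of "Suc s"] by simp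
  then have "F' (Suc s) #>\<^bsub>add_group T\<^esub> \<zero>\<^bsub>T\<^esub> = F' (Suc s)"
    by (rule subgroup.rcos_const[OF T.F_subgroup comm_group.axioms(2)[OF T.add_group_comm]])
  then show ?thesis
    using comm_group.axioms(2)[OF T.gr_ring_comm, of s]
    by (simp add: trivial_group_def T.carrier_gr_ring F'_zero[OF assms]) (simp add: gr_ring_def)
qed

lemma mod_filt_trivial:
  assumes "comm_group H" "q \<le> s"
  shows "mod_filt (ext_scalars H T) F' s = {\<one>\<^bsub>ext_scalars H T\<^esub>}"
proof
  have "\<pi> H x = \<one>\<^bsub>ext_scalars H T\<^esub>" if "x \<in> mod_filt (ext_scalars H S) F s" for x
  proof -
    have "x \<in> carrier (ext_scalars H S)" "x \<in> act_span (ext_scalars H S) ker"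
      using that S.mod_filt_carrier[OF MS[OF assms(1)]] S.mod_filt_antimono[OF MS[OF assms(1)] assms(2)]
      by (auto simp: F_q[symmetric] mod_filt_def act_span_def)
    then show ?thesis using reductionD(4)[OF red[OF assms(1)]] by simp
  qed
  then show "mod_filt (ext_scalars H T) F' s \<subseteq> {\<one>\<^bsub>ext_scalars H T\<^esub>}"
    unfolding mod_filt_image[OF assms(1), symmetric] by auto
  show "{\<one>\<^bsub>ext_scalars H T\<^esub>} \<subseteq> mod_filt (ext_scalars H T) F' s"
    using subgroup.one_closed[OF T.mod_filt_subgroup[OF MT[OF assms(1)]]] by simp
qed

text \<open>From degree q - 1 the map lands in step q of the filtration of K \<otimes> T, and that
  step is trivial.\<close>

lemma E1_map_last:
  assumes H: "comm_group H" and K: "comm_group K"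
    and D: "rlinear S (ext_scalars H S) (ext_scalars K S) D"
    and D0: "gr_map_zero (ext_scalars H S) (ext_scalars K S) F D"
    and s: "Suc s = q" and c: "c \<in> carrier (gr_mod (ext_scalars H T) F' s)"
  shows "E1_map (ext_scalars K T) F' (free_base_change_map S \<phi> T H K D) s c =
    \<one>\<^bsub>gr_mod (ext_scalars K T) F' (Suc s)\<^esub>"
proof -
  let ?M' = "ext_scalars H T" and ?N' = "ext_scalars K T" and ?D' = "free_base_change_map S \<phi> T H K D"
  note N' = MT[OF K]
  obtain x where x: "x \<in> mod_filt ?M' F' s" "c = mod_filt ?M' F' (Suc s) #>\<^bsub>?M'\<^esub> x"
    using c by (auto simp: T.gr_mod_quotient(5)[OF MT[OF H]])
  have "?D' x \<in> mod_filt ?N' F' (Suc s)"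
    using D'_filt[OF H K D D0] x(1) by blast
  then have "?D' x = \<one>\<^bsub>?N'\<^esub>" using mod_filt_trivial[OF K, of "Suc s"] s by auto
  then show ?thesis
    unfolding x(2) E1_map_coset(2)[OF H K D D0 x(1)]
    using group.coset_mult_one[OF acted_groupD(2)[OF N'] T.mod_filt_carrier[OF N']] by (simp add: gr_mod_def)
qed

end

subsection \<open>Adic completions\<close>

lemma (in scalar_quotient) filtration_image:
  assumes "filtration S F"
  shows "filtration T (\<lambda>s. \<phi> ` F s)"
proof -
  interpret F: filtration S F by fact
  have \<phi>: "\<phi> \<in> hom (add_group S) (add_group T)"
    using hom by (auto simp: ring_hom_def hom_def)
  interpret \<phi>: group_hom "add_group S" "add_group T" \<phi>
    by (rule group_homI[OF comm_group.axioms(2)[OF S.add_group_comm] comm_group.axioms(2)[OF T.add_group_comm] \<phi>])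
  show ?thesis
    by (intro filtration.intro filtration_axioms.intro T.ring_axioms image_mono F.F_Suc
        \<phi>.subgroup_img_is_subgroup[OF F.F_subgroup])
qed

context ideal
begin

abbreviation "Q n \<equiv> R Quot ideal_pow R I n"
abbreviation "C \<equiv> adic_completion R I"

lemma ideal_pow_ideal: "ideal (ideal_pow R I n) R"
  by (induction n) (simp_all add: oneideal ideal_prod_is_ideal ideal_axioms)

lemma ideal_pow_Suc: "ideal_pow R I (Suc n) \<subseteq> ideal_pow R I n"
  using ideal_prod_inter[OF ideal_pow_ideal ideal_axioms] by auto

lemma ideal_pow_zero: "\<zero> \<in> ideal_pow R I n"
  by (rule additive_subgroup.zero_closed[OF ideal.axioms(1)[OF ideal_pow_ideal]])

lemma Q_ring: "ring (Q n)"
  by (rule ideal.quotient_is_ring[OF ideal_pow_ideal])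

lemma to_quot_hom: "to_quot R I n \<in> ring_hom R (Q n)"
  using ideal.rcos_ring_hom[OF ideal_pow_ideal] by (simp add: to_quot_def[abs_def])

lemma carrier_Q: "carrier (Q n) = to_quot R I n ` carrier R"
  by (auto simp: FactRing_def A_RCOSETS_def' a_r_coset_def' to_quot_def)

lemma Q_zero: "\<zero>\<^bsub>Q n\<^esub> = ideal_pow R I n"
  by (simp add: FactRing_def)

lemma coset_eq_to_quot:
  assumes "c \<in> carrier (Q n)" "r \<in> c"
  shows "r \<in> carrier R" "c = to_quot R I n r"
proof -
  interpret J: ideal "ideal_pow R I n" R by (rule ideal_pow_ideal)
  obtain s where s: "s \<in> carrier R" "c = ideal_pow R I n +> s"
    using assms(1) by (auto simp: carrier_Q to_quot_def)
  show "r \<in> carrier R" using assms(2) s J.a_elemrcos_carrier by blast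
  show "c = to_quot R I n r"
    using assms(2) s J.a_repr_independence' by (simp add: to_quot_def)
qed

lemma to_quot_mem: "r \<in> carrier R \<Longrightarrow> r \<in> to_quot R I n r"
proof -
  interpret J: ideal "ideal_pow R I n" R by (rule ideal_pow_ideal)
  show "r \<in> carrier R \<Longrightarrow> r \<in> to_quot R I n r"
    unfolding to_quot_def by (rule J.a_rcos_self)
qed

lemma to_quot_zero_iff: "r \<in> carrier R \<Longrightarrow> to_quot R I n r = \<zero>\<^bsub>Q n\<^esub> \<longleftrightarrow> r \<in> ideal_pow R I n"
  using to_quot_mem[of r n] coset_eq_to_quot(2)[of "\<zero>\<^bsub>Q n\<^esub>" n r] ring.ring_simprules(2)[OF Q_ring]
  by (auto simp: Q_zero)

lemma Q_nonempty: "c \<in> carrier (Q n) \<Longrightarrow> c \<noteq> {}"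
  using to_quot_mem by (auto simp: carrier_Q)

lemma C_simps:
  "x \<in> carrier C \<longleftrightarrow> (\<forall>n. x n \<in> carrier (Q n) \<and> x (Suc n) \<subseteq> x n)"
  "x \<otimes>\<^bsub>C\<^esub> y = (\<lambda>n. x n \<otimes>\<^bsub>Q n\<^esub> y n)" "x \<oplus>\<^bsub>C\<^esub> y = (\<lambda>n. x n \<oplus>\<^bsub>Q n\<^esub> y n)"
  "\<one>\<^bsub>C\<^esub> = (\<lambda>n. \<one>\<^bsub>Q n\<^esub>)" "\<zero>\<^bsub>C\<^esub> = (\<lambda>n. \<zero>\<^bsub>Q n\<^esub>)"
  by (simp_all add: adic_completion_def)

lemma C_antimono: "x \<in> carrier C \<Longrightarrow> m \<le> n \<Longrightarrow> x n \<subseteq> x m"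
  by (rule lift_Suc_antimono_le) (auto simp: C_simps)

lemma to_completion_closed: "r \<in> carrier R \<Longrightarrow> to_completion R I r \<in> carrier C"
proof -
  have "to_quot R I (Suc n) r \<subseteq> to_quot R I n r" for n
    unfolding to_quot_def a_r_coset_def' using ideal_pow_Suc[of n] by blast
  then show "r \<in> carrier R \<Longrightarrow> to_completion R I r \<in> carrier C"
    using ring_hom_closed[OF to_quot_hom] by (simp add: C_simps to_completion_def)
qed

text \<open>Compatibility of coordinates is inclusion of cosets. The product of two cosets in a
  quotient ring is a union of cosets of products of representatives, hence monotone both in the two
  cosets and in the ideal.\<close>

lemma C_mult_closed:
  assumes "x \<in> carrier C" "y \<in> carrier C"
  shows "x \<otimes>\<^bsub>C\<^esub> y \<in> carrier C"
proof -
  have "x (Suc n) \<otimes>\<^bsub>Q (Suc n)\<^esub> y (Suc n) \<subseteq> x n \<otimes>\<^bsub>Q n\<^esub> y n" for n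
  proof -
    have "x (Suc n) \<subseteq> x n" "y (Suc n) \<subseteq> y n" using assms by (auto simp: C_simps)
    moreover have "ideal_pow R I (Suc n) +> r \<subseteq> ideal_pow R I n +> r" for r
      using ideal_pow_Suc by (auto simp: a_r_coset_def' simp del: ideal_pow.simps)
    ultimately show ?thesis
      unfolding FactRing_def rcoset_mult_def by (simp del: ideal_pow.simps) blast
  qed
  then show ?thesis
    using assms ring.ring_simprules(5)[OF Q_ring] by (auto simp: C_simps simp del: ideal_pow.simps)
qed

lemma C_add_closed:
  assumes "x \<in> carrier C" "y \<in> carrier C"
  shows "x \<oplus>\<^bsub>C\<^esub> y \<in> carrier C"
proof -
  have "x (Suc n) \<oplus>\<^bsub>Q (Suc n)\<^esub> y (Suc n) \<subseteq> x n \<oplus>\<^bsub>Q n\<^esub> y n" for n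
  proof -
    have "x (Suc n) \<subseteq> x n" "y (Suc n) \<subseteq> y n" using assms by (auto simp: C_simps)
    then show ?thesis
      unfolding FactRing_def set_add_def by (simp del: ideal_pow.simps add: mono_set_mult)
  qed
  then show ?thesis
    using assms ring.ring_simprules(1)[OF Q_ring] by (auto simp: C_simps simp del: ideal_pow.simps)
qed

lemma to_completion_one: "to_completion R I \<one> = \<one>\<^bsub>C\<^esub>"
  using ring_hom_one[OF to_quot_hom] by (simp add: C_simps to_completion_def)

lemma to_completion_zero: "to_completion R I \<zero> = \<zero>\<^bsub>C\<^esub>"
  using to_quot_zero_iff[OF zero_closed] ideal_pow_zero by (simp add: C_simps to_completion_def)

text \<open>The negative is taken as (-1) x with -1 coming from R, so that compatibility of its
  coordinates is already given by \<open>C_mult_closed\<close>.\<close>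

lemma C_inverse:
  assumes x: "x \<in> carrier C"
  shows "\<exists>y\<in>carrier C. y \<oplus>\<^bsub>C\<^esub> x = \<zero>\<^bsub>C\<^esub>"
proof
  let ?y = "to_completion R I (\<ominus> \<one>) \<otimes>\<^bsub>C\<^esub> x"
  show "?y \<in> carrier C" by (intro C_mult_closed to_completion_closed x) simp
  have "(?y \<oplus>\<^bsub>C\<^esub> x) n = \<zero>\<^bsub>Q n\<^esub>" for n
  proof -
    interpret Q: ring "Q n" by (rule Q_ring)
    have xn: "x n \<in> carrier (Q n)" using x by (simp add: C_simps)
    have c: "to_quot R I n (\<ominus> \<one>) \<in> carrier (Q n)" using ring_hom_closed[OF to_quot_hom] by simp
    have "(?y \<oplus>\<^bsub>C\<^esub> x) n = (to_quot R I n (\<ominus> \<one>) \<oplus>\<^bsub>Q n\<^esub> to_quot R I n \<one>) \<otimes>\<^bsub>Q n\<^esub> x n"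
      using xn c ring_hom_one[OF to_quot_hom] by (simp add: C_simps to_completion_def Q.l_distr)
    also have "to_quot R I n (\<ominus> \<one>) \<oplus>\<^bsub>Q n\<^esub> to_quot R I n \<one> = \<zero>\<^bsub>Q n\<^esub>"
      using ring_hom_add[OF to_quot_hom, of "\<ominus> \<one>" \<one>, symmetric] to_quot_zero_iff[OF zero_closed] ideal_pow_zero
      by (simp add: l_neg)
    finally show ?thesis using xn by simp
  qed
  then show "?y \<oplus>\<^bsub>C\<^esub> x = \<zero>\<^bsub>C\<^esub>" by (auto simp: C_simps)
qed

lemma C_ring: "ring C"
proof (intro ringI abelian_groupI monoidI)
  show "\<one>\<^bsub>C\<^esub> \<in> carrier C" "\<zero>\<^bsub>C\<^esub> \<in> carrier C"
    using to_completion_closed by (simp_all flip: to_completion_one to_completion_zero)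
  fix x y assume x: "x \<in> carrier C" and y: "y \<in> carrier C"
  show "x \<otimes>\<^bsub>C\<^esub> y \<in> carrier C" "x \<oplus>\<^bsub>C\<^esub> y \<in> carrier C"
    by (rule C_mult_closed[OF x y], rule C_add_closed[OF x y])
  show "x \<oplus>\<^bsub>C\<^esub> y = y \<oplus>\<^bsub>C\<^esub> x"
    using x y ring.ring_simprules(10)[OF Q_ring] by (auto simp: C_simps)
next
  fix x y z assume "x \<in> carrier C" "y \<in> carrier C" "z \<in> carrier C"
  then have c: "x n \<in> carrier (Q n)" "y n \<in> carrier (Q n)" "z n \<in> carrier (Q n)" for n
    by (auto simp: C_simps)
  show "(x \<oplus>\<^bsub>C\<^esub> y) \<oplus>\<^bsub>C\<^esub> z = x \<oplus>\<^bsub>C\<^esub> (y \<oplus>\<^bsub>C\<^esub> z)"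
    using c unfolding C_simps
    by (intro ext) (rule abelian_monoid.a_assoc[OF abelian_group.axioms(1)[OF ring.axioms(1)[OF Q_ring]]])
  show "(x \<otimes>\<^bsub>C\<^esub> y) \<otimes>\<^bsub>C\<^esub> z = x \<otimes>\<^bsub>C\<^esub> (y \<otimes>\<^bsub>C\<^esub> z)"
    using c unfolding C_simps by (intro ext) (rule monoid.m_assoc[OF ring.axioms(2)[OF Q_ring]])
  show "(x \<oplus>\<^bsub>C\<^esub> y) \<otimes>\<^bsub>C\<^esub> z = x \<otimes>\<^bsub>C\<^esub> z \<oplus>\<^bsub>C\<^esub> y \<otimes>\<^bsub>C\<^esub> z"
    using c unfolding C_simps by (intro ext) (rule ring.ring_simprules(13)[OF Q_ring])
  show "z \<otimes>\<^bsub>C\<^esub> (x \<oplus>\<^bsub>C\<^esub> y) = z \<otimes>\<^bsub>C\<^esub> x \<oplus>\<^bsub>C\<^esub> z \<otimes>\<^bsub>C\<^esub> y"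
    unfolding C_simps
  proof
    fix n
    interpret Q: ring "Q n" by (rule Q_ring)
    show "z n \<otimes>\<^bsub>Q n\<^esub> (x n \<oplus>\<^bsub>Q n\<^esub> y n) = z n \<otimes>\<^bsub>Q n\<^esub> x n \<oplus>\<^bsub>Q n\<^esub> z n \<otimes>\<^bsub>Q n\<^esub> y n"
      using c by (rule Q.r_distr)
  qed
next
  fix x assume x: "x \<in> carrier C"
  then have c: "x n \<in> carrier (Q n)" for n by (simp add: C_simps)
  show "\<zero>\<^bsub>C\<^esub> \<oplus>\<^bsub>C\<^esub> x = x" "\<one>\<^bsub>C\<^esub> \<otimes>\<^bsub>C\<^esub> x = x" "x \<otimes>\<^bsub>C\<^esub> \<one>\<^bsub>C\<^esub> = x"
    unfolding C_simps
    by (intro ext abelian_monoid.l_zero[OF abelian_group.axioms(1)[OF ring.axioms(1)[OF Q_ring]]]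
          monoid.l_one[OF ring.axioms(2)[OF Q_ring]] monoid.r_one[OF ring.axioms(2)[OF Q_ring]] c)+
  show "\<exists>y\<in>carrier C. y \<oplus>\<^bsub>C\<^esub> x = \<zero>\<^bsub>C\<^esub>" by (rule C_inverse[OF x])
qed

lemma to_completion_hom: "to_completion R I \<in> ring_hom R C"
  using to_completion_closed to_completion_one ring_hom_add[OF to_quot_hom] ring_hom_mult[OF to_quot_hom]
  by (intro ring_hom_memI) (auto simp: C_simps(2-4) to_completion_def)

lemma filtration_ideal_pow: "filtration R (ideal_pow R I)"
proof (intro filtration.intro filtration_axioms.intro ring_axioms)
  show "subgroup (ideal_pow R I s) (add_group R)" for s
    using additive_subgroup.a_subgroup[OF ideal.axioms(1)[OF ideal_pow_ideal]]
      a_inv_def[of R] inv_add_group by (simp add: subgroup_def)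
qed (rule ideal_pow_Suc)

lemma scalar_quotient_to_quot: "scalar_quotient R (Q n) (to_quot R I n)"
  by (intro scalar_quotient.intro scalar_quotient_axioms.intro ring_axioms Q_ring to_quot_hom)
     (simp add: carrier_Q)

lemma scalar_quotient_completion: "scalar_quotient C (Q n) (\<lambda>x. x n)"
proof (intro scalar_quotient.intro scalar_quotient_axioms.intro C_ring Q_ring)
  show "(\<lambda>x. x n) \<in> ring_hom C (Q n)"
    by (intro ring_hom_memI) (auto simp: C_simps)
  have "c \<in> (\<lambda>x. x n) ` carrier C" if "c \<in> carrier (Q n)" for c
  proof -
    obtain r where r: "r \<in> carrier R" "c = to_quot R I n r" using \<open>c \<in> carrier (Q n)\<close> by (auto simp: carrier_Q)
    then have "c = to_completion R I r n" by (simp add: to_completion_def)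
    then show ?thesis using to_completion_closed[OF r(1)] by blast
  qed
  then show "(\<lambda>x. x n) ` carrier C = carrier (Q n)"
    by (auto simp: C_simps)
qed

lemma completion_filt_ker: "completion_filt R I n = scalar_quotient.ker C (Q n) (\<lambda>x. x n)"
  by (simp add: completion_filt_def scalar_quotient.ker_def[OF scalar_quotient_completion])

lemma filtration_completion: "filtration C (completion_filt R I)"
proof -
  interpret C: ring C by (rule C_ring)
  show ?thesis
  proof (intro filtration.intro filtration_axioms.intro C_ring)
    fix s
    interpret Q: ring "Q s" by (rule Q_ring)
    interpret h: group_hom "add_group C" "add_group (Q s)" "\<lambda>x. x s"
      by (rule group_homI[OF comm_group.axioms(2)[OF C.add_group_comm] comm_group.axioms(2)[OF Q.add_group_comm]])
         (auto simp: hom_def C_simps)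
    have "completion_filt R I s = kernel (add_group C) (add_group (Q s)) (\<lambda>x. x s)"
      by (simp add: completion_filt_def kernel_def)
    then show "subgroup (completion_filt R I s) (add_group C)"
      using h.subgroup_kernel by simp
    show "completion_filt R I (Suc s) \<subseteq> completion_filt R I s"
    proof
      fix x assume x: "x \<in> completion_filt R I (Suc s)"
      \<comment> \<open>The coordinate at s + 1 is the ideal itself and so contains 0. The
        coordinate at s then contains 0 too and must be the zero coset.\<close>
      then have "x (Suc s) \<subseteq> x s" "x s \<in> carrier (Q s)" "x \<in> carrier C" "\<zero> \<in> x (Suc s)"
        using ideal_pow_zero[of "Suc s"] by (auto simp: completion_filt_def C_simps Q_zero simp del: ideal_pow.simps)
      then have "x s = to_quot R I s \<zero>" using coset_eq_to_quot(2) by blast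
      then show "x \<in> completion_filt R I s"
        using \<open>x \<in> carrier C\<close> to_quot_zero_iff[OF zero_closed] ideal_pow_zero by (simp add: completion_filt_def)
    qed
  qed
qed

lemma to_completion_filt: "to_completion R I ` ideal_pow R I s \<subseteq> completion_filt R I s"
proof
  fix x assume "x \<in> to_completion R I ` ideal_pow R I s"
  then obtain r where r: "r \<in> ideal_pow R I s" "x = to_completion R I r" by auto
  have "r \<in> carrier R" using r(1) ideal.Icarr[OF ideal_pow_ideal] by blast
  then show "x \<in> completion_filt R I s"
    using r to_completion_closed to_quot_zero_iff by (simp add: completion_filt_def to_completion_def)
qed

text \<open>A coordinate x n of an element of step s needs a representative in I^s. For s \<le> n
  any representative will do, as x n lies inside x s = I^s. For n < s one takes 0, which lies in x s
  = I^s and hence in x n. Thanks to this equality both filtered quotients induce the same filtration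
  on R / I^n.\<close>

lemma quot_filt_eq: "quot_filt R I n s = (\<lambda>x. x n) ` completion_filt R I s"
proof
  show "quot_filt R I n s \<subseteq> (\<lambda>x. x n) ` completion_filt R I s"
  proof
    fix c assume "c \<in> quot_filt R I n s"
    then obtain r where "r \<in> ideal_pow R I s" "c = to_completion R I r n"
      by (auto simp: quot_filt_def to_completion_def)
    then show "c \<in> (\<lambda>x. x n) ` completion_filt R I s" using to_completion_filt by blast
  qed
  show "(\<lambda>x. x n) ` completion_filt R I s \<subseteq> quot_filt R I n s"
  proof
    fix c assume "c \<in> (\<lambda>x. x n) ` completion_filt R I s"
    then obtain x where x: "x \<in> carrier C" "x s = ideal_pow R I s" "c = x n"
      by (auto simp: completion_filt_def Q_zero)
    have c: "c \<in> carrier (Q n)" using x by (simp add: C_simps)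
    have "\<exists>r\<in>c. r \<in> ideal_pow R I s"
    proof (cases "s \<le> n")
      case True
      then show ?thesis using C_antimono[OF x(1) True] x Q_nonempty[OF c] by auto
    next
      case False
      then show ?thesis using C_antimono[OF x(1), of n s] x ideal_pow_zero[of s] by auto
    qed
    then show "c \<in> quot_filt R I n s"
      using coset_eq_to_quot(2)[OF c] by (auto simp: quot_filt_def)
  qed
qed

lemma filtered_quotient_to_quot:
  "filtered_quotient R (Q n) (to_quot R I n) (ideal_pow R I) (quot_filt R I n) n"
proof -
  interpret scalar_quotient R "Q n" "to_quot R I n" by (rule scalar_quotient_to_quot)
  have "filtration (Q n) (quot_filt R I n)"
    using filtration_image[OF filtration_ideal_pow] by (simp add: quot_filt_def[abs_def])
  moreover have "ideal_pow R I n = ker"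
    using to_quot_zero_iff ideal.Icarr[OF ideal_pow_ideal] by (auto simp: ker_def)
  ultimately show ?thesis
    by (intro filtered_quotient.intro filtered_quotient_axioms.intro scalar_quotient_axioms filtration_ideal_pow)
       (auto simp: quot_filt_def)
qed

lemma filtered_quotient_completion:
  "filtered_quotient C (Q n) (\<lambda>x. x n) (completion_filt R I) (quot_filt R I n) n"
proof -
  interpret scalar_quotient C "Q n" "\<lambda>x. x n" by (rule scalar_quotient_completion)
  have "filtration (Q n) (quot_filt R I n)"
    using filtration_image[OF filtration_completion] by (simp add: quot_filt_eq[abs_def])
  then show ?thesis
    by (intro filtered_quotient.intro filtered_quotient_axioms.intro scalar_quotient_axioms filtration_completion
          completion_filt_ker quot_filt_eq)
qed

end

subsection \<open>Monoid rings\<close>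

text \<open>The product of \<open>monoid_ring\<close> for an arbitrary binary operation, so that
  bilinearity is available apart from the monoid laws. It is used for classes of loops and for words
  under concatenation.\<close>

definition frag_conv :: "('a \<Rightarrow> 'b \<Rightarrow> 'c) \<Rightarrow> ('a \<Rightarrow>\<^sub>0 int) \<Rightarrow> ('b \<Rightarrow>\<^sub>0 int) \<Rightarrow> ('c \<Rightarrow>\<^sub>0 int)" where
  "frag_conv f x y = frag_extend (\<lambda>g. frag_extend (\<lambda>h. frag_of (f g h)) y) x"

lemma frag_extend_pointwise:
  "frag_extend (\<lambda>g. u g - v g) x = frag_extend u x - frag_extend v x"
  "frag_extend (\<lambda>g. u g + v g) x = frag_extend u x + frag_extend v x"
  "frag_extend (\<lambda>g. frag_cmul n (u g)) x = frag_cmul n (frag_extend u x)"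
proof -
  show add: "frag_extend (\<lambda>g. u g + v g) x = frag_extend u x + frag_extend v x" for u v
    by (simp add: frag_extend_def frag_cmul_distrib2 sum.distrib)
  show cmul: "frag_extend (\<lambda>g. frag_cmul n (u g)) x = frag_cmul n (frag_extend u x)" for n u
    by (simp add: frag_extend_def frag_cmul_sum mult.commute)
  show "frag_extend (\<lambda>g. u g - v g) x = frag_extend u x - frag_extend v x"
    using add[of u "\<lambda>g. - v g"] cmul[of "-1" v] by simp
qed

lemma frag_conv_simps:
  "frag_conv f 0 y = 0" "frag_conv f x 0 = 0"
  "frag_conv f (frag_of a) (frag_of b) = frag_of (f a b)"
  "frag_conv f (x + x') y = frag_conv f x y + frag_conv f x' y"
  "frag_conv f x (y + y') = frag_conv f x y + frag_conv f x y'"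
  "frag_conv f (x - x') y = frag_conv f x y - frag_conv f x' y"
  "frag_conv f x (y - y') = frag_conv f x y - frag_conv f x y'"
  "frag_conv f (frag_cmul n x) y = frag_cmul n (frag_conv f x y)"
  "frag_conv f x (frag_cmul n y) = frag_cmul n (frag_conv f x y)"
  by (simp_all add: frag_conv_def frag_extend_add frag_extend_diff frag_extend_cmul frag_extend_pointwise
      frag_extend_eq_0)

lemma frag_conv_assoc:
  assumes "\<And>a b c. a \<in> S \<Longrightarrow> b \<in> S \<Longrightarrow> c \<in> S \<Longrightarrow> f (f a b) c = f a (f b c)"
    and "Poly_Mapping.keys x \<subseteq> S" "Poly_Mapping.keys y \<subseteq> S" "Poly_Mapping.keys z \<subseteq> S"
  shows "frag_conv f (frag_conv f x y) z = frag_conv f x (frag_conv f y z)"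
  using assms(2)
proof (induction x rule: frag_induction)
  case (one a)
  show ?case using assms(3)
  proof (induction y rule: frag_induction)
    case (one b)
    show ?case using assms(4)
      by (induction z rule: frag_induction) (use one assms(1) \<open>a \<in> S\<close> in \<open>auto simp: frag_conv_simps\<close>)
  qed (auto simp: frag_conv_simps)
qed (auto simp: frag_conv_simps)

lemma keys_frag_conv:
  assumes "Poly_Mapping.keys x \<subseteq> A" "Poly_Mapping.keys y \<subseteq> B" "\<And>a b. a \<in> A \<Longrightarrow> b \<in> B \<Longrightarrow> f a b \<in> C"
  shows "Poly_Mapping.keys (frag_conv f x y) \<subseteq> C"
proof
  fix w assume "w \<in> Poly_Mapping.keys (frag_conv f x y)"
  then obtain a where a: "a \<in> Poly_Mapping.keys x" "w \<in> Poly_Mapping.keys (frag_extend (\<lambda>h. frag_of (f a h)) y)"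
    unfolding frag_conv_def using keys_frag_extend[of "\<lambda>g. frag_extend (\<lambda>h. frag_of (f g h)) y" x] by blast
  then obtain b where "b \<in> Poly_Mapping.keys y" "w = f a b"
    using keys_frag_extend[of "\<lambda>h. frag_of (f a h)" y] by (auto simp: keys_frag_of)
  then show "w \<in> C" using a assms by auto
qed

lemma monoid_ring_simps:
  "carrier (monoid_ring G) = {c. Poly_Mapping.keys c \<subseteq> carrier G}"
  "monoid.mult (monoid_ring G) = frag_conv (monoid.mult G)"
  "one (monoid_ring G) = frag_of \<one>\<^bsub>G\<^esub>" "zero (monoid_ring G) = 0" "add (monoid_ring G) = (+)"
  by (simp_all add: monoid_ring_def frag_conv_def[abs_def])

lemma frag_conv_one:
  assumes "Poly_Mapping.keys x \<subseteq> S"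
  shows "(\<And>a. a \<in> S \<Longrightarrow> f e a = a) \<Longrightarrow> frag_conv f (frag_of e) x = x"
    and "(\<And>a. a \<in> S \<Longrightarrow> f a e = a) \<Longrightarrow> frag_conv f x (frag_of e) = x"
  using assms by (induction x rule: frag_induction) (auto simp: frag_conv_simps)

lemma monoid_ring_ring:
  assumes "Group.monoid G"
  shows "ring (monoid_ring G)"
proof -
  interpret Group.monoid G by fact
  show ?thesis
  proof (intro ringI abelian_groupI monoidI)
    fix x y z assume "x \<in> carrier (monoid_ring G)" "y \<in> carrier (monoid_ring G)" "z \<in> carrier (monoid_ring G)"
    then show "x \<otimes>\<^bsub>monoid_ring G\<^esub> y \<otimes>\<^bsub>monoid_ring G\<^esub> z = x \<otimes>\<^bsub>monoid_ring G\<^esub> (y \<otimes>\<^bsub>monoid_ring G\<^esub> z)"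
      unfolding monoid_ring_simps by (intro frag_conv_assoc[of "carrier G"]) (auto simp: m_assoc)
  next
    fix x y assume "x \<in> carrier (monoid_ring G)" "y \<in> carrier (monoid_ring G)"
    then show "x \<otimes>\<^bsub>monoid_ring G\<^esub> y \<in> carrier (monoid_ring G)" "x \<oplus>\<^bsub>monoid_ring G\<^esub> y \<in> carrier (monoid_ring G)"
      using keys_add[of x y] keys_frag_conv[of x "carrier G" y "carrier G" "monoid.mult G" "carrier G"]
      by (auto simp: monoid_ring_simps)
  next
    fix x assume x: "x \<in> carrier (monoid_ring G)"
    then show "\<exists>y\<in>carrier (monoid_ring G). y \<oplus>\<^bsub>monoid_ring G\<^esub> x = \<zero>\<^bsub>monoid_ring G\<^esub>"
      by (intro bexI[of _ "- x"]) (auto simp: monoid_ring_simps)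
    show "\<one>\<^bsub>monoid_ring G\<^esub> \<otimes>\<^bsub>monoid_ring G\<^esub> x = x" "x \<otimes>\<^bsub>monoid_ring G\<^esub> \<one>\<^bsub>monoid_ring G\<^esub> = x"
      using x by (auto simp: monoid_ring_simps intro!: frag_conv_one[of _ "carrier G"])
  qed (auto simp: monoid_ring_simps frag_conv_simps keys_frag_of algebra_simps)
qed

lemma a_inv_monoid_ring:
  assumes "Group.monoid G" "x \<in> carrier (monoid_ring G)"
  shows "inv\<^bsub>add_monoid (monoid_ring G)\<^esub> x = - x"
proof -
  interpret ring "monoid_ring G" by (rule monoid_ring_ring[OF assms(1)])
  have "\<ominus>\<^bsub>monoid_ring G\<^esub> x = - x"
    by (rule minus_equality) (use assms(2) in \<open>auto simp: monoid_ring_simps\<close>)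
  then show ?thesis by (simp add: a_inv_def)
qed

text \<open>Expresses the ideal axioms through +, - and \<open>frag_conv\<close>, which keeps record
  operations out of later checks. It serves the augmentation ideal and the ideals of the tensor
  algebra.\<close>

lemma monoid_ring_ideal:
  assumes G: "Group.monoid G" and sub: "U \<subseteq> carrier (monoid_ring G)"
    and "0 \<in> U" "\<And>x y. x \<in> U \<Longrightarrow> y \<in> U \<Longrightarrow> x + y \<in> U" "\<And>x. x \<in> U \<Longrightarrow> - x \<in> U"
    and "\<And>r x. r \<in> carrier (monoid_ring G) \<Longrightarrow> x \<in> U \<Longrightarrow> frag_conv (monoid.mult G) r x \<in> U"
    and "\<And>r x. r \<in> carrier (monoid_ring G) \<Longrightarrow> x \<in> U \<Longrightarrow> frag_conv (monoid.mult G) x r \<in> U"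
  shows "ideal U (monoid_ring G)"
proof (rule idealI)
  show "ring (monoid_ring G)" by (rule monoid_ring_ring[OF G])
  show "subgroup U (add_monoid (monoid_ring G))"
    by (rule subgroup.intro) (use assms a_inv_monoid_ring[OF G] in \<open>auto simp: monoid_ring_simps(3-)\<close>)
qed (use assms in \<open>auto simp: monoid_ring_simps(2)\<close>)

text \<open>The augmentation as the linear extension of the map to a one-point set, which makes the
  rules for \<open>frag_extend\<close> applicable to it.\<close>

lemma augmentation_sum:
  "(\<Sum>g\<in>Poly_Mapping.keys c. Poly_Mapping.lookup c g) = Poly_Mapping.lookup (frag_extend (\<lambda>_. frag_of ()) c) ()"
  by (simp add: frag_extend_def lookup_sum)

text \<open>Multiplying y by a generator on either side only relabels its support, which leaves the
  sum of coefficients unchanged; linearity in x does the rest.\<close>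

lemma augmentation_conv:
  assumes "frag_extend (\<lambda>_. frag_of ()) y = 0"
  shows "frag_extend (\<lambda>_. frag_of ()) (frag_conv f x y) = 0" "frag_extend (\<lambda>_. frag_of ()) (frag_conv f y x) = 0"
proof -
  have c: "frag_extend (\<lambda>_. frag_of ()) (frag_extend (\<lambda>h. frag_of (g h)) y) = 0" for g
    using frag_extend_compose[of "\<lambda>_. frag_of ()" g y] assms by (simp add: comp_def)
  have "frag_extend (\<lambda>_. frag_of ()) (frag_conv f x y) = 0 \<and> frag_extend (\<lambda>_. frag_of ()) (frag_conv f y x) = 0"
    using subset_UNIV
  proof (induction x rule: frag_induction)
    case (one a)
    then show ?case using c[of "f a"] c[of "\<lambda>g. f g a"] by (simp add: frag_conv_def)
  qed (auto simp: frag_conv_simps frag_extend_diff)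
  then show "frag_extend (\<lambda>_. frag_of ()) (frag_conv f x y) = 0" "frag_extend (\<lambda>_. frag_of ()) (frag_conv f y x) = 0"
    by auto
qed

lemma augmentation_ideal_ideal:
  assumes "Group.monoid G"
  shows "ideal (augmentation_ideal G) (monoid_ring G)"
proof -
  let ?\<epsilon> = "frag_extend (\<lambda>_. frag_of ())"
  have zero: "t = 0 \<longleftrightarrow> Poly_Mapping.lookup t () = 0" for t :: "unit \<Rightarrow>\<^sub>0 int"
    by (metis lookup_zero poly_mapping_eqI unit.exhaust)
  have eq: "augmentation_ideal G = {c \<in> carrier (monoid_ring G). ?\<epsilon> c = 0}"
    by (simp add: augmentation_ideal_def augmentation_sum zero)
  interpret ring "monoid_ring G" by (rule monoid_ring_ring[OF assms])
  show ?thesis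
    unfolding eq
  proof (rule monoid_ring_ideal[OF assms])
    show "x + y \<in> {c \<in> carrier (monoid_ring G). ?\<epsilon> c = 0}"
      if "x \<in> {c \<in> carrier (monoid_ring G). ?\<epsilon> c = 0}" "y \<in> {c \<in> carrier (monoid_ring G). ?\<epsilon> c = 0}" for x y
      using that a_closed[of x y] by (simp add: monoid_ring_simps(4,5) frag_extend_add)
    show "- x \<in> {c \<in> carrier (monoid_ring G). ?\<epsilon> c = 0}"
      if "x \<in> {c \<in> carrier (monoid_ring G). ?\<epsilon> c = 0}" for x
      using that by (simp add: monoid_ring_simps(1) frag_extend_minus)
    fix r x assume "r \<in> carrier (monoid_ring G)" "x \<in> {c \<in> carrier (monoid_ring G). ?\<epsilon> c = 0}"
    then show "frag_conv (monoid.mult G) r x \<in> {c \<in> carrier (monoid_ring G). ?\<epsilon> c = 0}"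
      "frag_conv (monoid.mult G) x r \<in> {c \<in> carrier (monoid_ring G). ?\<epsilon> c = 0}"
      using m_closed[of r x] m_closed[of x r] by (simp_all add: monoid_ring_simps(2) augmentation_conv)
  qed (auto simp: monoid_ring_simps(1))
qed

subsection \<open>The quadratic Orlik-Solomon algebra in low degrees\<close>

abbreviation "word_monoid S \<equiv> \<lparr>carrier = lists S, monoid.mult = (@), one = []\<rparr>"

lemma word_monoid: "Group.monoid (word_monoid S)"
  by unfold_locales auto

lemma tensor_algebra_simps:
  "carrier (tensor_algebra S) = {c. Poly_Mapping.keys c \<subseteq> lists S}"
  "monoid.mult (tensor_algebra S) = frag_conv (@)"
  "one (tensor_algebra S) = frag_of []" "zero (tensor_algebra S) = 0" "add (tensor_algebra S) = (+)"
  by (simp_all add: tensor_algebra_def monoid_ring_simps)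

lemma tensor_algebra_ring: "ring (tensor_algebra S)"
  unfolding tensor_algebra_def by (rule monoid_ring_ring[OF word_monoid])

lemma word_deriv_Nil [simp]: "word_deriv [] = 0"
  by (simp add: word_deriv_def)

text \<open>Splits off the summand that deletes the first letter. All other deletions happen in
  \<open>w\<close>, one position further to the right, whence the sign.\<close>

lemma word_deriv_Cons: "word_deriv (a # w) = frag_of w - frag_conv (@) (frag_of [a]) (word_deriv w)"
proof -
  have "frag_conv (@) (frag_of [a]) (\<Sum>i\<in>I. frag_cmul (n i) (frag_of (g i))) =
      (\<Sum>i\<in>I. frag_cmul (n i) (frag_of (a # g i)))" if "finite I" for I :: "nat set" and n g
    using that by (induction I) (simp_all add: frag_conv_simps)
  then have *: "frag_conv (@) (frag_of [a]) (word_deriv w) =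
      (\<Sum>i<length w. frag_cmul ((-1) ^ i) (frag_of (a # take i w @ drop (Suc i) w)))"
    unfolding word_deriv_def by simp
  show ?thesis
    unfolding * by (simp add: word_deriv_def sum.lessThan_Suc_shift sum_negf del: sum.lessThan_Suc flip: minus_frag_cmul)
qed

text \<open>The grading automorphism, multiplying degree k by (-1)^k. It supplies the sign in the
  graded Leibniz rule \<open>deriv_ext_conv\<close>, also for inhomogeneous elements.\<close>

definition word_sign :: "('h list \<Rightarrow>\<^sub>0 int) \<Rightarrow> ('h list \<Rightarrow>\<^sub>0 int)" where
  "word_sign = frag_extend (\<lambda>w. frag_cmul ((-1) ^ length w) (frag_of w))"

abbreviation "deriv_ext \<equiv> frag_extend word_deriv"

lemma frag_conv_append_assoc:
  "frag_conv (@) (frag_conv (@) x y) z = frag_conv (@) x (frag_conv (@) y z)"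
  by (rule frag_conv_assoc[of UNIV]) auto

lemma word_deriv_append:
  "word_deriv (u @ v) = frag_conv (@) (word_deriv u) (frag_of v) +
     frag_cmul ((-1) ^ length u) (frag_conv (@) (frag_of u) (word_deriv v))"
proof (induction u)
  case Nil
  then show ?case by (simp add: frag_conv_simps frag_conv_one(1)[OF subset_UNIV])
next
  case (Cons a u)
  have "frag_conv (@) (frag_of [a]) (frag_conv (@) (frag_of u) (word_deriv v)) =
      frag_conv (@) (frag_of (a # u)) (word_deriv v)"
    by (simp add: frag_conv_simps flip: frag_conv_append_assoc)
  then show ?case
    by (simp add: word_deriv_Cons Cons frag_conv_simps frag_conv_append_assoc algebra_simps flip: minus_frag_cmul)
qed

lemma deriv_ext_conv:
  "deriv_ext (frag_conv (@) x y) = frag_conv (@) (deriv_ext x) y + frag_conv (@) (word_sign x) (deriv_ext y)"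
  using subset_UNIV
proof (induction x rule: frag_induction)
  case (one u)
  show ?case using subset_UNIV
  proof (induction y rule: frag_induction)
    case (one v)
    show ?case by (simp add: frag_conv_simps word_sign_def word_deriv_append)
  qed (auto simp: frag_conv_simps frag_extend_diff algebra_simps)
qed (auto simp: frag_conv_simps frag_extend_diff word_sign_def algebra_simps)

lemma word_sign_conv: "word_sign (frag_conv (@) x y) = frag_conv (@) (word_sign x) (word_sign y)"
  using subset_UNIV
proof (induction x rule: frag_induction)
  case (one u)
  show ?case using subset_UNIV
    by (induction y rule: frag_induction)
       (auto simp: frag_conv_simps word_sign_def frag_extend_diff power_add mult.commute)
qed (auto simp: frag_conv_simps frag_extend_diff word_sign_def)

lemma keys_word_deriv: "Poly_Mapping.keys (word_deriv w) \<subseteq> {v \<in> lists (set w). Suc (length v) = length w}"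
proof -
  have "Poly_Mapping.keys (word_deriv w) \<subseteq> (\<Union>i<length w. Poly_Mapping.keys (frag_cmul ((-1) ^ i) (frag_of (take i w @ drop (Suc i) w))))"
    unfolding word_deriv_def by (rule keys_sum)
  also have "\<dots> \<subseteq> {v \<in> lists (set w). Suc (length v) = length w}"
  proof
    fix v assume "v \<in> (\<Union>i<length w. Poly_Mapping.keys (frag_cmul ((-1) ^ i) (frag_of (take i w @ drop (Suc i) w))))"
    then obtain i where "i < length w" "v = take i w @ drop (Suc i) w" by (auto simp: keys_frag_of)
    then show "v \<in> {v \<in> lists (set w). Suc (length v) = length w}"
      using in_set_takeD[of _ i w] in_set_dropD[of _ "Suc i" w] by auto
  qed
  finally show ?thesis .
qed

lemma deriv_ext_closed:
  assumes "Poly_Mapping.keys x \<subseteq> lists S"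
  shows "Poly_Mapping.keys (deriv_ext x) \<subseteq> lists S" "Poly_Mapping.keys (word_sign x) \<subseteq> lists S"
proof -
  have "Poly_Mapping.keys (word_deriv w) \<subseteq> lists S" if "w \<in> Poly_Mapping.keys x" for w
    using keys_word_deriv[of w] that assms by auto
  then show "Poly_Mapping.keys (deriv_ext x) \<subseteq> lists S"
    using keys_frag_extend[of word_deriv x] by blast
  have "Poly_Mapping.keys (frag_cmul ((-1) ^ length w) (frag_of w)) \<subseteq> lists S" if "w \<in> Poly_Mapping.keys x" for w
    using that assms by (auto simp: keys_frag_of)
  then show "Poly_Mapping.keys (word_sign x) \<subseteq> lists S"
    unfolding word_sign_def using keys_frag_extend[of "\<lambda>w. frag_cmul ((-1) ^ length w) (frag_of w)" x] by blast
qed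

abbreviation "ext_gens S \<equiv>
  {frag_of [a, a] |a. a \<in> S} \<union> {frag_of [a, b] + frag_of [b, a] |a b. a \<in> S \<and> b \<in> S}"

lemma ext_gens_keys: "x \<in> ext_gens S \<Longrightarrow> Poly_Mapping.keys x \<subseteq> {w \<in> lists S. length w = 2}"
proof (elim UnE CollectE exE conjE)
  fix a b assume "x = frag_of [a, b] + frag_of [b, a]" "a \<in> S" "b \<in> S"
  then show "Poly_Mapping.keys x \<subseteq> {w \<in> lists S. length w = 2}"
    using keys_add[of "frag_of [a, b]" "frag_of [b, a]"] by (auto simp: keys_frag_of)
qed (simp add: keys_frag_of)

lemma ext_gens_carrier: "ext_gens S \<subseteq> carrier (tensor_algebra S)"
proof
  fix x assume "x \<in> ext_gens S"
  from ext_gens_keys[OF this] show "x \<in> carrier (tensor_algebra S)"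
    by (auto simp: tensor_algebra_simps(1))
qed

lemma ext_rels_ideal: "ideal (ext_rels S) (tensor_algebra S)"
  unfolding ext_rels_def
  by (rule ring.genideal_ideal[OF tensor_algebra_ring ext_gens_carrier])

lemma ext_rels_minimal: "ideal U (tensor_algebra S) \<Longrightarrow> ext_gens S \<subseteq> U \<Longrightarrow> ext_rels S \<subseteq> U"
  unfolding ext_rels_def by (rule ring.genideal_minimal[OF tensor_algebra_ring])

lemma tensor_algebra_ideal:
  assumes "U \<subseteq> carrier (tensor_algebra S)"
    and "0 \<in> U" "\<And>x y. x \<in> U \<Longrightarrow> y \<in> U \<Longrightarrow> x + y \<in> U" "\<And>x. x \<in> U \<Longrightarrow> - x \<in> U"
    and "\<And>r x. r \<in> carrier (tensor_algebra S) \<Longrightarrow> x \<in> U \<Longrightarrow> frag_conv (@) r x \<in> U"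
    and "\<And>r x. r \<in> carrier (tensor_algebra S) \<Longrightarrow> x \<in> U \<Longrightarrow> frag_conv (@) x r \<in> U"
  shows "ideal U (tensor_algebra S)"
  using monoid_ring_ideal[OF word_monoid, of U S] assms unfolding tensor_algebra_def[symmetric] by simp

lemma ideal_frag:
  assumes "ideal U (tensor_algebra S)"
  shows "0 \<in> U" "x \<in> U \<Longrightarrow> y \<in> U \<Longrightarrow> x + y \<in> U" "x \<in> U \<Longrightarrow> - x \<in> U" "x \<in> U \<Longrightarrow> x \<in> carrier (tensor_algebra S)"
    and "r \<in> carrier (tensor_algebra S) \<Longrightarrow> x \<in> U \<Longrightarrow> frag_conv (@) r x \<in> U"
    and "r \<in> carrier (tensor_algebra S) \<Longrightarrow> x \<in> U \<Longrightarrow> frag_conv (@) x r \<in> U"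
proof -
  interpret ideal U "tensor_algebra S" by fact
  show "0 \<in> U" using additive_subgroup.zero_closed[OF is_additive_subgroup] by (simp add: tensor_algebra_simps)
  show "x \<in> U \<Longrightarrow> y \<in> U \<Longrightarrow> x + y \<in> U"
    using additive_subgroup.a_closed[OF is_additive_subgroup, of x y] by (simp add: tensor_algebra_simps)
  show c: "x \<in> U \<Longrightarrow> x \<in> carrier (tensor_algebra S)" by (rule Icarr)
  show "x \<in> U \<Longrightarrow> - x \<in> U"
    using subgroup.m_inv_closed[OF a_subgroup, of x] a_inv_monoid_ring[OF word_monoid, of x S] c
    by (simp add: tensor_algebra_def)
  show "r \<in> carrier (tensor_algebra S) \<Longrightarrow> x \<in> U \<Longrightarrow> frag_conv (@) r x \<in> U"
    "r \<in> carrier (tensor_algebra S) \<Longrightarrow> x \<in> U \<Longrightarrow> frag_conv (@) x r \<in> U"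
    using I_l_closed[of x r] I_r_closed[of x r] by (simp_all add: tensor_algebra_simps(2))
qed

text \<open>The derivation vanishes on the generating relations: the terms of [a, a] cancel, and so
  do those of [a, b] + [b, a]. To pass to the ideal, the elements x for which both the derivative
  and \<open>word_sign x\<close> stay in it are shown to form an ideal. The sign is carried along
  because the Leibniz rule for x r contains \<open>word_sign x\<close> times the derivative of r; on
  words of length 2 it is trivial.\<close>

lemma deriv_ext_rels:
  assumes "x \<in> ext_rels S"
  shows "deriv_ext x \<in> ext_rels S"
proof -
  let ?X = "ext_rels S" and ?Z = "{x \<in> ext_rels S. deriv_ext x \<in> ext_rels S \<and> word_sign x \<in> ext_rels S}"
  note X = ideal_frag[OF ext_rels_ideal[of S]]
  have gens: "ext_gens S \<subseteq> ?X"
    unfolding ext_rels_def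
    by (rule ring.genideal_self[OF tensor_algebra_ring ext_gens_carrier])
  have "ideal ?Z (tensor_algebra S)"
  proof (rule tensor_algebra_ideal)
    fix r x assume r: "r \<in> carrier (tensor_algebra S)" and x: "x \<in> ?Z"
    then have "deriv_ext r \<in> carrier (tensor_algebra S)" "word_sign r \<in> carrier (tensor_algebra S)"
      using deriv_ext_closed[of r S] by (simp_all add: tensor_algebra_simps(1))
    then show "frag_conv (@) r x \<in> ?Z" "frag_conv (@) x r \<in> ?Z"
      using r x X by (auto simp: deriv_ext_conv word_sign_conv)
  qed (use X in \<open>auto simp: frag_extend_add frag_extend_minus word_sign_def\<close>)
  moreover have "ext_gens S \<subseteq> ?Z"
  proof
    fix x assume x: "x \<in> ext_gens S"
    then have "deriv_ext x = 0 \<and> word_sign x = x"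
      by (auto simp: word_deriv_Cons frag_conv_simps word_sign_def frag_extend_add)
    then show "x \<in> ?Z" using x gens X(1) by auto
  qed
  ultimately have "?X \<subseteq> ?Z" by (rule ext_rels_minimal)
  then show ?thesis using assms by auto
qed

lemma ext_algebra_ring: "ring (ext_algebra S)"
  unfolding ext_algebra_def by (rule ideal.quotient_is_ring[OF ext_rels_ideal])

lemma ext_class_hom: "ext_class S \<in> ring_hom (tensor_algebra S) (ext_algebra S)"
  using ideal.rcos_ring_hom[OF ext_rels_ideal[of S]] by (simp add: ext_class_def[abs_def] ext_algebra_def)

lemma carrier_ext_algebra: "carrier (ext_algebra S) = ext_class S ` carrier (tensor_algebra S)"
  by (auto simp: ext_algebra_def FactRing_def A_RCOSETS_def' a_r_coset_def' ext_class_def)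

lemma ext_class_eq: "ext_class S t = {x + t |x. x \<in> ext_rels S}"
  by (auto simp: ext_class_def a_r_coset_def' tensor_algebra_simps(5))

lemma ext_class_eqI:
  assumes "t - t' \<in> ext_rels S"
  shows "ext_class S t = ext_class S t'"
proof -
  note X = ideal_frag[OF ext_rels_ideal[of S]]
  have "x + t \<in> ext_class S t'" if "x \<in> ext_rels S" for x
    unfolding ext_class_eq using X(2)[OF that assms] by (auto intro!: exI[of _ "x + (t - t')"])
  moreover have "x + t' \<in> ext_class S t" if "x \<in> ext_rels S" for x
    unfolding ext_class_eq using X(2)[OF that X(3)[OF assms]] by (auto intro!: exI[of _ "x + - (t - t')"])
  ultimately show ?thesis by (auto simp: ext_class_eq[of S t] ext_class_eq[of S t'])
qed

lemma ext_deriv_class: "ext_deriv S (ext_class S t) = ext_class S (deriv_ext t)"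
proof -
  have "ext_class S (deriv_ext x) = ext_class S (deriv_ext t)" if "x \<in> ext_class S t" for x
  proof (rule ext_class_eqI)
    obtain r where "r \<in> ext_rels S" "x = r + t" using \<open>x \<in> ext_class S t\<close> by (auto simp: ext_class_eq)
    then show "deriv_ext x - deriv_ext t \<in> ext_rels S"
      using deriv_ext_rels by (simp add: frag_extend_add)
  qed
  moreover have "t \<in> ext_class S t"
    using ideal_frag(1)[OF ext_rels_ideal[of S]] by (force simp: ext_class_eq)
  ultimately have "(\<lambda>x. ext_class S (deriv_ext x)) ` ext_class S t = {ext_class S (deriv_ext t)}"
    by blast
  then show ?thesis by (simp add: ext_deriv_def)
qed

section \<open>The ideal of elements of degree at least two\<close>

definition deg2 :: "'h set \<Rightarrow> ('h list \<Rightarrow>\<^sub>0 int) set" where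
  "deg2 S = {t. Poly_Mapping.keys t \<subseteq> {w \<in> lists S. 2 \<le> length w}}"

lemma deg2_ideal: "ideal (deg2 S) (tensor_algebra S)"
proof (rule tensor_algebra_ideal)
  fix x y assume "x \<in> deg2 S" "y \<in> deg2 S"
  then show "x + y \<in> deg2 S" using keys_add[of x y] by (auto simp: deg2_def)
next
  fix r x assume "r \<in> carrier (tensor_algebra S)" "x \<in> deg2 S"
  then show "frag_conv (@) r x \<in> deg2 S" "frag_conv (@) x r \<in> deg2 S"
    unfolding deg2_def tensor_algebra_simps(1) mem_Collect_eq
    by - (rule keys_frag_conv[of _ "lists S" _ "{w \<in> lists S. 2 \<le> length w}"]
            keys_frag_conv[of _ "{w \<in> lists S. 2 \<le> length w}" _ "lists S"]; auto)+
qed (auto simp: deg2_def tensor_algebra_simps(1))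

lemma ext_rels_deg2: "ext_rels S \<subseteq> deg2 S"
proof (rule ext_rels_minimal[OF deg2_ideal], rule subsetI)
  fix x assume "x \<in> ext_gens S"
  from ext_gens_keys[OF this] show "x \<in> deg2 S" by (auto simp: deg2_def)
qed

text \<open>The exterior relations themselves have degree at least 2, so adding them does not change
  membership. The degree bound on the exterior algebra can therefore be written as an inclusion of
  the coset, as in \<open>deg2_ext_ideal\<close>.\<close>

lemma ext_class_deg2: "ext_class S t \<subseteq> deg2 S \<longleftrightarrow> t \<in> deg2 S"
proof
  note X = ideal_frag[OF ext_rels_ideal[of S]] and U = ideal_frag[OF deg2_ideal[of S]]
  show "ext_class S t \<subseteq> deg2 S \<Longrightarrow> t \<in> deg2 S"
    using X(1) by (force simp: ext_class_eq)
  show "t \<in> deg2 S \<Longrightarrow> ext_class S t \<subseteq> deg2 S"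
    using U(2) ext_rels_deg2 by (auto simp: ext_class_eq)
qed

lemma deg2_ext_ideal: "ideal {c \<in> carrier (ext_algebra S). c \<subseteq> deg2 S} (ext_algebra S)" (is "ideal ?U _")
proof (rule idealI)
  interpret E: ring "ext_algebra S" by (rule ext_algebra_ring)
  interpret h: ring_hom_ring "tensor_algebra S" "ext_algebra S" "ext_class S"
    by (rule ring_hom_ringI2[OF tensor_algebra_ring ext_algebra_ring ext_class_hom])
  note U = ideal_frag[OF deg2_ideal[of S]]
  have ex: "\<exists>t\<in>deg2 S. c = ext_class S t" if "c \<in> ?U" for c
    using that ext_class_deg2 by (auto simp: carrier_ext_algebra)
  have mem: "ext_class S t \<in> ?U" if "t \<in> deg2 S" for t
    using that U(4)[OF that] by (simp add: ext_class_deg2)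
  show "ring (ext_algebra S)" by (rule ext_algebra_ring)
  show "subgroup ?U (add_monoid (ext_algebra S))"
  proof (rule subgroup.intro)
    show "?U \<subseteq> carrier (add_monoid (ext_algebra S))" by auto
    show "\<one>\<^bsub>add_monoid (ext_algebra S)\<^esub> \<in> ?U"
      using mem[OF U(1)] h.hom_zero by (simp add: tensor_algebra_simps)
  next
    fix c d assume "c \<in> ?U" "d \<in> ?U"
    from ex[OF this(1)] ex[OF this(2)]
    obtain t s where ts: "t \<in> deg2 S" "c = ext_class S t" "s \<in> deg2 S" "d = ext_class S s"
      by blast
    then show "c \<otimes>\<^bsub>add_monoid (ext_algebra S)\<^esub> d \<in> ?U"
      using mem[OF U(2)[OF ts(1,3)]] h.hom_add[of t s] U(4) by (simp add: tensor_algebra_simps(5))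
  next
    fix c assume "c \<in> ?U"
    from ex[OF this] obtain t where t: "t \<in> deg2 S" "c = ext_class S t" by blast
    have "\<ominus>\<^bsub>tensor_algebra S\<^esub> t = - t"
      using a_inv_monoid_ring[OF word_monoid, of t S] U(4)[OF t(1)] by (simp add: tensor_algebra_def a_inv_def)
    then show "inv\<^bsub>add_monoid (ext_algebra S)\<^esub> c \<in> ?U"
      using mem[OF U(3)[OF t(1)]] h.hom_a_inv[OF U(4)[OF t(1)]] t(2) by (simp add: a_inv_def)
  qed
  fix c d assume "c \<in> ?U" "d \<in> carrier (ext_algebra S)"
  from ex[OF this(1)] this(2)
  obtain t s where ts: "t \<in> deg2 S" "c = ext_class S t" "s \<in> carrier (tensor_algebra S)" "d = ext_class S s"
    unfolding carrier_ext_algebra by blast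
  show "d \<otimes>\<^bsub>ext_algebra S\<^esub> c \<in> ?U" "c \<otimes>\<^bsub>ext_algebra S\<^esub> d \<in> ?U"
    using mem[OF U(5)[OF ts(3,1)]] mem[OF U(6)[OF ts(3,1)]] h.hom_mult[of t s] h.hom_mult[of s t] U(4)[OF ts(1)] ts
    by (simp_all add: tensor_algebra_simps(2))
qed

lemma ext_degree_carrier: "ext_degree S k \<subseteq> carrier (ext_algebra S)"
  unfolding ext_degree_def carrier_ext_algebra tensor_algebra_simps(1) by auto

text \<open>The words of the homogeneous representative have length k < 2 and also length at least
  2, so its support is empty.\<close>

lemma ext_degree_deg2:
  assumes "c \<in> ext_degree S k" "k < 2" "c \<subseteq> deg2 S"
  shows "c = \<zero>\<^bsub>ext_algebra S\<^esub>"
proof -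
  interpret h: ring_hom_ring "tensor_algebra S" "ext_algebra S" "ext_class S"
    by (rule ring_hom_ringI2[OF tensor_algebra_ring ext_algebra_ring ext_class_hom])
  obtain t where t: "c = ext_class S t" "Poly_Mapping.keys t \<subseteq> {w \<in> lists S. length w = k}"
    using assms(1) by (auto simp: ext_degree_def)
  then have "t \<in> deg2 S" using assms(3) ext_class_deg2 by blast
  then have "Poly_Mapping.keys t = {}" using t(2) assms(2) by (fastforce simp: deg2_def)
  then have "t = 0" by simp
  then show ?thesis using t(1) h.hom_zero by (simp add: tensor_algebra_simps)
qed

lemma ext_degree_subgroup:
  fixes S :: "'h set"
  shows "subgroup (ext_degree S k) (add_group (ext_algebra S))"
proof -
  let ?D = "{t :: 'h list \<Rightarrow>\<^sub>0 int. Poly_Mapping.keys t \<subseteq> {w \<in> lists S. length w = k}}"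
  interpret T: ring "tensor_algebra S" by (rule tensor_algebra_ring)
  interpret E: ring "ext_algebra S" by (rule ext_algebra_ring)
  interpret h: group_hom "add_group (tensor_algebra S)" "add_group (ext_algebra S)" "ext_class S"
    by (rule group_homI[OF comm_group.axioms(2)[OF T.add_group_comm] comm_group.axioms(2)[OF E.add_group_comm]])
       (use ext_class_hom[of S] in \<open>auto simp: ring_hom_def hom_def\<close>)
  have inv: "inv\<^bsub>add_group (tensor_algebra S)\<^esub> t = - t" if "t \<in> carrier (tensor_algebra S)" for t
    using a_inv_monoid_ring[OF word_monoid, of t S] that T.inv_add_group[of t] by (simp add: tensor_algebra_def a_inv_def)
  have "subgroup ?D (add_group (tensor_algebra S))"
  proof (rule subgroup.intro)
    fix x y assume "x \<in> ?D"
      "y \<in> ?D"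
    then show "x \<otimes>\<^bsub>add_group (tensor_algebra S)\<^esub> y \<in> ?D"
      using keys_add[of x y] by (simp add: tensor_algebra_simps(5)) blast
  next
    fix x assume "x \<in> ?D"
    moreover from this have "x \<in> carrier (tensor_algebra S)" by (auto simp: tensor_algebra_simps(1))
    ultimately show "inv\<^bsub>add_group (tensor_algebra S)\<^esub> x \<in> ?D" by (simp add: inv)
  qed (auto simp: tensor_algebra_simps)
  then show ?thesis unfolding ext_degree_def by (rule h.subgroup_img_is_subgroup)
qed

section \<open>Ranks of graded pieces of quotient algebras\<close>

lemma hom_finprod:
  assumes "comm_group G" "comm_group L" "h \<in> hom G L" "finite S" "\<And>x. x \<in> S \<Longrightarrow> f x \<in> carrier G"
  shows "h (finprod G f S) = finprod L (\<lambda>x. h (f x)) S"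
proof -
  interpret G: comm_group G by fact
  interpret L: comm_group L by fact
  interpret h: group_hom G L h by (rule group_homI[OF G.is_group L.is_group assms(3)])
  show ?thesis using assms(4,5)
  proof (induction S)
    case (insert a S)
    have "f a \<in> carrier G" "f \<in> S \<rightarrow> carrier G" using insert.prems by auto
    moreover have "h (f a) \<in> carrier L" "(\<lambda>x. h (f x)) \<in> S \<rightarrow> carrier L"
      using insert.prems by (auto intro!: h.hom_closed)
    ultimately show ?case
      using insert by (simp add: G.finprod_insert L.finprod_insert)
  qed simp
qed

text \<open>A relation among the images with exponents \<open>c\<close> is the image of the relation
  with exponents c \<circ> h. Injectivity of h pulls its triviality back to G, where independence
  applies.\<close>

lemma independent_image:
  assumes G: "comm_group G" and L: "comm_group L" and h: "h \<in> iso G L"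
    and S: "finite S" "S \<subseteq> carrier G"
    and ind: "\<And>c :: 'g \<Rightarrow> int. finprod G (\<lambda>x. x [^]\<^bsub>G\<^esub> c x) S = \<one>\<^bsub>G\<^esub> \<Longrightarrow> (\<forall>x\<in>S. c x = 0)"
  shows "finite (h ` S) \<and> h ` S \<subseteq> carrier L \<and> card (h ` S) = card S \<and>
    (\<forall>c :: 'l \<Rightarrow> int. finprod L (\<lambda>x. x [^]\<^bsub>L\<^esub> c x) (h ` S) = \<one>\<^bsub>L\<^esub> \<longrightarrow> (\<forall>x\<in>h ` S. c x = 0))"
proof -
  interpret G: comm_group G by fact
  interpret L: comm_group L by fact
  have hh: "h \<in> hom G L" and bij: "bij_betw h (carrier G) (carrier L)"
    using h by (auto simp: iso_def)
  interpret h: group_hom G L h by (rule group_homI[OF G.is_group L.is_group hh])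
  have inj: "inj_on h S" using bij S(2) by (meson bij_betw_imp_inj_on inj_on_subset)
  have "\<forall>x\<in>h ` S. c x = 0" if c: "finprod L (\<lambda>x. x [^]\<^bsub>L\<^esub> c x) (h ` S) = \<one>\<^bsub>L\<^esub>" for c :: "'l \<Rightarrow> int"
  proof -
    have cl: "(\<lambda>x. x [^]\<^bsub>G\<^esub> c (h x)) \<in> S \<rightarrow> carrier G" using S(2) by auto
    have "h (finprod G (\<lambda>x. x [^]\<^bsub>G\<^esub> c (h x)) S) = finprod L (\<lambda>x. h (x [^]\<^bsub>G\<^esub> c (h x))) S"
      by (rule hom_finprod[OF G L hh S(1)]) (use S(2) in auto)
    also have "\<dots> = finprod L (\<lambda>x. h x [^]\<^bsub>L\<^esub> c (h x)) S"
      using S(2) by (intro L.finprod_cong') (auto simp: h.hom_int_pow)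
    also have "\<dots> = finprod L (\<lambda>x. x [^]\<^bsub>L\<^esub> c x) (h ` S)"
      using S inj by (subst L.finprod_reindex) (auto simp: comp_def)
    finally have "h (finprod G (\<lambda>x. x [^]\<^bsub>G\<^esub> c (h x)) S) = h \<one>\<^bsub>G\<^esub>" using c by simp
    then have "finprod G (\<lambda>x. x [^]\<^bsub>G\<^esub> c (h x)) S = \<one>\<^bsub>G\<^esub>"
      using bij cl by (auto simp: bij_betw_def inj_on_def)
    then show ?thesis using ind[of "\<lambda>x. c (h x)"] by auto
  qed
  then show ?thesis
    using S hh card_image[OF inj] by (auto simp: hom_def)
qed

lemma ab_rank_iso:
  assumes G: "comm_group G" and L: "comm_group L" and h: "h \<in> iso G L"
  shows "ab_rank G = ab_rank L"
proof -
  let ?P = "\<lambda>G S. finite S \<and> S \<subseteq> carrier G \<and>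
     (\<forall>c. finprod G (\<lambda>x. x [^]\<^bsub>G\<^esub> (c x :: int)) S = \<one>\<^bsub>G\<^esub> \<longrightarrow> (\<forall>x\<in>S. c x = 0))"
  have h': "inv_into (carrier G) h \<in> iso L G"
    by (rule group.iso_set_sym[OF comm_group.axioms(2)[OF G] h])
  have 1: "card S \<in> {card S |S. ?P L S}" if "?P G S" for S
  proof -
    have "?P L (h ` S) \<and> card S = card (h ` S)"
      using independent_image[OF G L h, of S] that by simp
    then show ?thesis by (intro CollectI exI[of _ "h ` S"]) simp
  qed
  have 2: "card S \<in> {card S |S. ?P G S}" if "?P L S" for S
  proof -
    have "?P G (inv_into (carrier G) h ` S) \<and> card S = card (inv_into (carrier G) h ` S)"
      using independent_image[OF L G h', of S] that by simp
    then show ?thesis by (intro CollectI exI[of _ "inv_into (carrier G) h ` S"]) simp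
  qed
  have "{card S |S. ?P G S} = {card S |S. ?P L S}"
  proof (intro equalityI subsetI)
    fix n assume "n \<in> {card S |S. ?P G S}"
    then show "n \<in> {card S |S. ?P L S}" using 1 by (elim CollectE exE conjE) simp
  next
    fix n assume "n \<in> {card S |S. ?P L S}"
    then show "n \<in> {card S |S. ?P G S}" using 2 by (elim CollectE exE conjE) simp
  qed
  then show ?thesis unfolding ab_rank_def by simp
qed

lemma quot_degree_group:
  assumes "ideal J (ext_algebra S)"
  shows "comm_group (quot_degree S J k)"
    and "(\<lambda>x. J +>\<^bsub>ext_algebra S\<^esub> x) \<in> hom ((add_group (ext_algebra S))\<lparr>carrier := ext_degree S k\<rparr>) (quot_degree S J k)"
proof -
  interpret J: ideal J "ext_algebra S" by fact
  interpret Q: ring "ext_algebra S Quot J" by (rule J.quotient_is_ring)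
  have hh: "(\<lambda>x. J +>\<^bsub>ext_algebra S\<^esub> x) \<in> hom (add_group (ext_algebra S)) (add_group (ext_algebra S Quot J))"
    using J.rcos_ring_hom by (auto simp: ring_hom_def hom_def)
  interpret h: group_hom "add_group (ext_algebra S)" "add_group (ext_algebra S Quot J)" "\<lambda>x. J +>\<^bsub>ext_algebra S\<^esub> x"
    by (rule group_homI[OF comm_group.axioms(2)[OF J.add_group_comm] comm_group.axioms(2)[OF Q.add_group_comm] hh])
  have sg: "subgroup ((\<lambda>x. J +>\<^bsub>ext_algebra S\<^esub> x) ` ext_degree S k) (add_group (ext_algebra S Quot J))"
    by (rule h.subgroup_img_is_subgroup[OF ext_degree_subgroup])
  show "comm_group (quot_degree S J k)"
    unfolding quot_degree_def by (rule sub_quotient(1)[OF Q.add_group_comm sg sg subset_refl])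
  show "(\<lambda>x. J +>\<^bsub>ext_algebra S\<^esub> x) \<in> hom ((add_group (ext_algebra S))\<lparr>carrier := ext_degree S k\<rparr>) (quot_degree S J k)"
    using hh ext_degree_carrier[of S k] unfolding quot_degree_def by (auto simp: hom_def subset_iff)
qed

text \<open>The ideals agree in degree k, so the two quotient maps on that part of the exterior
  algebra have the same kernel. One factors through the other by an isomorphism, under which the
  rank is invariant.\<close>

lemma ab_rank_quot_degree:
  assumes J1: "ideal J1 (ext_algebra S)" and J2: "ideal J2 (ext_algebra S)"
    and sub: "J2 \<subseteq> J1" "J1 \<inter> ext_degree S k \<subseteq> J2"
  shows "ab_rank (quot_degree S J1 k) = ab_rank (quot_degree S J2 k)"
proof -
  let ?E = "ext_algebra S"
  let ?q1 = "\<lambda>x. J1 +>\<^bsub>?E\<^esub> x" and ?q2 = "\<lambda>x. J2 +>\<^bsub>?E\<^esub> x"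
  let ?G = "(add_group ?E)\<lparr>carrier := ext_degree S k\<rparr>" and ?L1 = "quot_degree S J1 k" and ?L2 = "quot_degree S J2 k"
  interpret J1: ideal J1 ?E by fact
  interpret J2: ideal J2 ?E by fact
  have G: "group ?G"
    by (rule comm_group.axioms(2)[OF sub_quotient(1)[OF J1.add_group_comm ext_degree_subgroup ext_degree_subgroup subset_refl]])
  note L1 = comm_group.axioms(2)[OF quot_degree_group(1)[OF J1]]
    and L2 = comm_group.axioms(2)[OF quot_degree_group(1)[OF J2]]
  have im: "?q1 ` carrier ?G = carrier ?L1" "?q2 ` carrier ?G = carrier ?L2"
    by (simp_all add: quot_degree_def)
  have one: "\<one>\<^bsub>?L1\<^esub> = J1" "\<one>\<^bsub>?L2\<^esub> = J2" by (simp_all add: quot_degree_def FactRing_def)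
  have k: "?q1 x = J1 \<longleftrightarrow> ?q2 x = J2" if "x \<in> ext_degree S k" for x
  proof -
    have x: "x \<in> carrier ?E" using that ext_degree_carrier by auto
    have "?q1 x = J1 \<longleftrightarrow> x \<in> J1" using x J1.a_rcos_self J1.a_rcos_const by blast
    moreover have "?q2 x = J2 \<longleftrightarrow> x \<in> J2" using x J2.a_rcos_self J2.a_rcos_const by blast
    ultimately show ?thesis using that sub by blast
  qed
  obtain g where g: "g \<in> hom ?L1 ?L2" "\<And>x. x \<in> carrier ?G \<Longrightarrow> g (?q1 x) = ?q2 x"
    using hom_factor[OF G L1 L2 quot_degree_group(2)[OF J1] im(1) quot_degree_group(2)[OF J2]] k one by auto
  interpret g: group_hom ?L1 ?L2 g by (rule group_homI[OF L1 L2 g(1)])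
  have "carrier ?L2 \<subseteq> g ` carrier ?L1"
    unfolding im[symmetric] image_image using g(2) by auto
  moreover have "c = \<one>\<^bsub>?L1\<^esub>" if c: "c \<in> carrier ?L1" "g c = \<one>\<^bsub>?L2\<^esub>" for c
  proof -
    obtain x where "x \<in> ext_degree S k" "c = ?q1 x" using c(1) by (auto simp: quot_degree_def)
    then show ?thesis using k g(2)[of x] c(2) one by simp
  qed
  ultimately have "g \<in> iso ?L1 ?L2" unfolding g.iso_iff by blast
  then show ?thesis by (rule ab_rank_iso[OF quot_degree_group(1)[OF J1] quot_degree_group(1)[OF J2]])
qed

text \<open>At most two distinct hyperplanes are always independent. For two of them, H \<inter> H'
  = H would put H inside H' and force equality by dimension, so the intersection has dimension at
  most dim V - 2.\<close>

lemma dependent_card: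
  assumes A: "arrangement V A" and "B \<subseteq> A" and dep: "arr_dependent V B"
  shows "3 \<le> card B"
proof (rule ccontr)
  assume "\<not> 3 \<le> card B"
  then consider "card B = 0" | "card B = 1" | "card B = 2" by linarith
  moreover have hyp: "vec.subspace H" "H \<subseteq> V" "vec.dim H + 1 = vec.dim V" if "H \<in> B" for H
    using subsetD[OF \<open>B \<subseteq> A\<close> that] A unfolding arrangement_def by blast+
  ultimately show False
  proof cases
    case 1
    then show ?thesis using dep by (simp add: arr_dependent_def)
  next
    case 2
    then obtain H where H: "B = {H}" by (meson card_1_singletonE)
    then have "V \<inter> \<Inter>B = H" using hyp[of H] by auto
    then show ?thesis using dep 2 hyp[of H] H by (simp add: arr_dependent_def arr_rank_def codim_in_def)
  next
    case 3
    then obtain H H' where H: "B = {H, H'}" "H \<noteq> H'" by (meson card_2_iff)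
    then have eq: "V \<inter> \<Inter>B = H \<inter> H'" using hyp[of H] by auto
    have "vec.dim (H \<inter> H') < vec.dim H"
    proof (rule ccontr)
      assume "\<not> vec.dim (H \<inter> H') < vec.dim H"
      then have "H \<inter> H' = H"
        using vec.subspace_dim_equal[of "H \<inter> H'" H] vec.subspace_inter[of H H'] hyp[of H] hyp[of H'] H by auto
      then have "H = H'"
        using vec.subspace_dim_equal[of H H'] hyp[of H] hyp[of H'] H by auto
      then show False using H(2) by simp
    qed
    then show ?thesis using dep 3 hyp[of H] H eq by (simp add: arr_dependent_def arr_rank_def codim_in_def)
  qed
qed

text \<open>By \<open>dependent_card\<close> the derivative of the monomial of a dependent set has
  degree at least 2, so both ideals are zero in degrees 0 and 1. In degree 2 the quadratic ideal
  contains that part of \<open>os_ideal\<close> by construction. The ranks thus agree up to 2, and 2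
  is among the values whose supremum is taken.\<close>

lemma os_invariant_ge_2:
  assumes A: "arrangement V A"
  shows "enat 2 \<le> os_invariant V A"
proof -
  let ?E = "ext_algebra A" and ?J1 = "os_ideal V A" and ?J2 = "os_ideal2 V A"
  let ?U = "{c \<in> carrier ?E. c \<subseteq> deg2 A}"
  let ?g = "{ext_deriv A (ext_mon A w) |w. distinct w \<and> set w \<subseteq> A \<and> arr_dependent V (set w)}"
  have g: "?g \<subseteq> ?U"
  proof
    fix c assume "c \<in> ?g"
    then obtain w where w: "distinct w" "set w \<subseteq> A" "arr_dependent V (set w)" and "c = ext_deriv A (ext_mon A w)"
      by blast
    then have c: "c = ext_class A (word_deriv w)" by (simp add: ext_mon_def ext_deriv_class)
    have "3 \<le> length w"
      using dependent_card[OF A w(2,3)] w(1) by (simp add: distinct_card)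
    then have d: "word_deriv w \<in> deg2 A"
      using keys_word_deriv[of w] lists_mono[OF w(2)] unfolding deg2_def by auto
    then have "word_deriv w \<in> carrier (tensor_algebra A)" by (rule ideal_frag(4)[OF deg2_ideal])
    then show "c \<in> ?U" using d c by (simp add: ext_class_deg2 carrier_ext_algebra)
  qed
  interpret E: ring ?E by (rule ext_algebra_ring)
  have J1: "ideal ?J1 ?E" unfolding os_ideal_def by (rule E.genideal_ideal[OF subset_trans[OF g]]) (rule Collect_subset)
  interpret J1: ideal ?J1 ?E by (rule J1)
  have J1U: "?J1 \<subseteq> ?U" unfolding os_ideal_def by (rule E.genideal_minimal[OF deg2_ext_ideal g])
  have sub: "?J1 \<inter> ext_degree A 2 \<subseteq> carrier ?E" using ext_degree_carrier by auto
  have J2: "ideal ?J2 ?E" unfolding os_ideal2_def by (rule E.genideal_ideal[OF sub])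
  have J21: "?J2 \<subseteq> ?J1" unfolding os_ideal2_def by (rule E.genideal_minimal[OF J1]) auto
  have J12: "?J1 \<inter> ext_degree A t \<subseteq> ?J2" if "t \<le> 2" for t
  proof (cases "t = 2")
    case True
    then show ?thesis unfolding os_ideal2_def using E.genideal_self[OF sub] by simp
  next
    case False
    show ?thesis
    proof
      fix c assume c: "c \<in> ?J1 \<inter> ext_degree A t"
      then have "c \<subseteq> deg2 A" using J1U by blast
      then have "c = \<zero>\<^bsub>?E\<^esub>"
        using c False \<open>t \<le> 2\<close> by (intro ext_degree_deg2[of c A t]) auto
      then show "c \<in> ?J2" using additive_subgroup.zero_closed[OF ideal.axioms(1)[OF J2]] by simp
    qed
  qed
  have "\<forall>t\<le>2. ab_rank (quot_degree A ?J1 t) = ab_rank (quot_degree A ?J2 t)"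
    using ab_rank_quot_degree[OF J1 J2 J21 J12] by blast
  then show ?thesis unfolding os_invariant_def by (intro Sup_upper) blast
qed

subsection \<open>Homotopy groups\<close>

text \<open>Concatenation of loops is associative and unital up to homotopy, hence strictly so on
  classes. The monoid laws are the input for \<open>monoid_ring\<close> and its augmentation
  ideal.\<close>

lemma fundamental_group_monoid:
  fixes X :: "'a::real_normed_vector set"
  assumes "x0 \<in> X"
  shows "Group.monoid (fundamental_group X x0)"
proof -
  let ?G = "fundamental_group X x0" and ?cl = "\<lambda>g. {h. homotopic_paths X g h}"
  let ?loop = "\<lambda>g. path g \<and> path_image g \<subseteq> X \<and> pathstart g = x0 \<and> pathfinish g = x0"
  have loop_const: "?loop (\<lambda>_. x0)"
    using assms by (auto simp: path_def path_image_def pathstart_def pathfinish_def)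
  have car: "carrier ?G = ?cl ` {g. ?loop g}" and one: "\<one>\<^bsub>?G\<^esub> = ?cl (\<lambda>_. x0)"
    by (auto simp: fundamental_group_def)
  have cl: "?cl f = ?cl g" if "homotopic_paths X f g" for f g
    using that homotopic_paths_trans homotopic_paths_sym by blast
  have mult: "?cl f \<otimes>\<^bsub>?G\<^esub> ?cl g = ?cl (f +++ g)" if "?loop f" "?loop g" for f g
  proof -
    have "homotopic_paths X (f +++ g) h" if "homotopic_paths X f f'" "homotopic_paths X g g'"
      "homotopic_paths X (f' +++ g') h" for f' g' h
      using homotopic_paths_join[OF that(1,2)] that(3) \<open>?loop f\<close> \<open>?loop g\<close> homotopic_paths_trans by metis
    moreover have "homotopic_paths X f f" "homotopic_paths X g g" using that by auto
    ultimately show ?thesis unfolding fundamental_group_def by (simp, blast)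
  qed
  have join: "?loop (f +++ g)" if "?loop f" "?loop g" for f g
    using that path_image_join_subset[of f g] by auto
  have lin: "linepath x0 x0 = (\<lambda>_. x0)" by (rule linepath_refl)
  show ?thesis
  proof (rule monoidI)
    show "\<one>\<^bsub>?G\<^esub> \<in> carrier ?G" using loop_const by (auto simp: car one)
  next
    fix x y assume "x \<in> carrier ?G" "y \<in> carrier ?G"
    then obtain f g where fg: "?loop f" "?loop g" "x = ?cl f" "y = ?cl g"
      unfolding car by blast
    show "x \<otimes>\<^bsub>?G\<^esub> y \<in> carrier ?G"
      unfolding fg(3,4) mult[OF fg(1,2)] car using join[OF fg(1,2)] by blast
  next
    fix x y z assume "x \<in> carrier ?G" "y \<in> carrier ?G" "z \<in> carrier ?G"
    then obtain f g h where fgh: "?loop f" "?loop g" "?loop h" "x = ?cl f" "y = ?cl g" "z = ?cl h"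
      unfolding car by blast
    have "homotopic_paths X (f +++ (g +++ h)) ((f +++ g) +++ h)"
      using fgh by (intro homotopic_paths_assoc) auto
    then show "x \<otimes>\<^bsub>?G\<^esub> y \<otimes>\<^bsub>?G\<^esub> z = x \<otimes>\<^bsub>?G\<^esub> (y \<otimes>\<^bsub>?G\<^esub> z)"
      using fgh join[OF fgh(1,2)] join[OF fgh(2,3)] cl by (simp add: mult)
  next
    fix x assume "x \<in> carrier ?G"
    then obtain f where f: "?loop f" "x = ?cl f"
      unfolding car by blast
    have "homotopic_paths X ((\<lambda>_. x0) +++ f) f" "homotopic_paths X (f +++ (\<lambda>_. x0)) f"
      using homotopic_paths_lid[of f X] homotopic_paths_rid[of f X] f lin by simp_all
    then show "\<one>\<^bsub>?G\<^esub> \<otimes>\<^bsub>?G\<^esub> x = x" "x \<otimes>\<^bsub>?G\<^esub> \<one>\<^bsub>?G\<^esub> = x"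
      using f cl mult[OF loop_const f(1)] mult[OF f(1) loop_const] by (simp_all add: one)
  qed
qed

text \<open>The product topology on \<open>nat \<Rightarrow> real\<close> is the one of the type
  class, which makes \<open>continuous_on\<close> and its rules available for maps out of
  cubes.\<close>

lemma cube_topology: "subtopology (powertop_real UNIV) (std_cube n) = top_of_set (std_cube n)"
  by (simp add: euclidean_product_topology)

lemma cube_homotopic_iff:
  "cube_homotopic n X x0 f g \<longleftrightarrow>
     (\<exists>h. continuous_on ({0..1} \<times> std_cube n) h \<and> h ` ({0..1} \<times> std_cube n) \<subseteq> X \<and>
        (\<forall>x\<in>std_cube n. h (0, x) = f x) \<and> (\<forall>x\<in>std_cube n. h (1, x) = g x) \<and>
        (\<forall>t\<in>{0..1::real}. \<forall>x\<in>cube_boundary n. h (t, x) = x0))"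
proof -
  have b: "x \<in> std_cube n" if "x \<in> cube_boundary n" for x using that by (simp add: cube_boundary_def)
  have "cube_homotopic n X x0 f g \<longleftrightarrow>
     (\<exists>h. continuous_map (prod_topology (subtopology euclideanreal {0..1}) (top_of_set (std_cube n))) (top_of_set X) h \<and>
        (\<forall>x\<in>topspace (top_of_set (std_cube n)). h (0, x) = f x) \<and> (\<forall>x\<in>topspace (top_of_set (std_cube n)). h (1, x) = g x) \<and>
        (\<forall>t\<in>{0..1}. \<forall>x\<in>cube_boundary n. h (t, x) = x0))"
    unfolding cube_homotopic_def cube_topology by (rule homotopic_with) (metis b topspace_euclidean_subtopology)
  then show ?thesis
    by (simp add: continuous_map_subtopology_eu prod_topology_subtopology_eu image_subset_iff_funcset)
qed

lemma coordinate_continuous: "continuous_on S (\<lambda>p. snd p j)"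
  for S :: "('a::topological_space \<times> ('b \<Rightarrow> 'c::topological_space)) set"
  by (rule continuous_on_product_then_coordinatewise) (intro continuous_intros)

lemma upd_continuous:
  fixes S :: "('a::topological_space \<times> ('b \<Rightarrow> 'c::topological_space)) set"
  assumes "continuous_on S c"
  shows "continuous_on S (\<lambda>p. (snd p)(i := c p))"
proof (rule continuous_on_coordinatewise_then_product)
  show "continuous_on S (\<lambda>p. ((snd p)(i := c p)) j)" for j
    using assms coordinate_continuous[of S j] by (cases "j = i") auto
qed

lemma cube_upd: "x \<in> std_cube n \<Longrightarrow> i < n \<Longrightarrow> 0 \<le> s \<Longrightarrow> s \<le> 1 \<Longrightarrow> x(i := s) \<in> std_cube n"
  by (auto simp: std_cube_def)

lemma boundary_upd: "x \<in> cube_boundary n \<Longrightarrow> i < n \<Longrightarrow> x i \<noteq> 0 \<Longrightarrow> x i \<noteq> 1 \<Longrightarrow> 0 \<le> s \<Longrightarrow> s \<le> 1 \<Longrightarrow>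
    x(i := s) \<in> cube_boundary n"
  by (auto simp: cube_boundary_def intro!: cube_upd)

lemma boundary_end: "x \<in> std_cube n \<Longrightarrow> i < n \<Longrightarrow> s = 0 \<or> s = 1 \<Longrightarrow> x(i := s) \<in> cube_boundary n"
  by (auto simp: cube_boundary_def intro!: cube_upd)

locale spheroids =
  fixes n :: nat and X :: "'a::topological_space set" and x0 :: 'a
  assumes x0: "x0 \<in> X"
begin

abbreviation "homot \<equiv> cube_homotopic n X x0"

text \<open>Maps of pairs from the cube and its boundary to X and its base point. Values outside the
  cube are unconstrained; \<open>homot_eq\<close> absorbs the difference.\<close>

definition "spheroid f \<longleftrightarrow> continuous_on (std_cube n) f \<and> f ` std_cube n \<subseteq> X \<and> (\<forall>x\<in>cube_boundary n. f x = x0)"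

lemma homotI:
  assumes "continuous_on ({0..1} \<times> std_cube n) h" "\<And>t x. t \<in> {0..1} \<Longrightarrow> x \<in> std_cube n \<Longrightarrow> h (t, x) \<in> X"
    and "\<And>x. x \<in> std_cube n \<Longrightarrow> h (0, x) = f x" "\<And>x. x \<in> std_cube n \<Longrightarrow> h (1, x) = g x"
    and "\<And>t x. t \<in> {0..1::real} \<Longrightarrow> x \<in> cube_boundary n \<Longrightarrow> h (t, x) = x0"
  shows "homot f g"
  unfolding cube_homotopic_iff using assms by (intro exI[of _ h]) auto

lemma homotE:
  assumes "homot f g"
  obtains h where "continuous_on ({0..1} \<times> std_cube n) h" "\<And>t x. t \<in> {0..1} \<Longrightarrow> x \<in> std_cube n \<Longrightarrow> h (t, x) \<in> X"
    "\<And>x. x \<in> std_cube n \<Longrightarrow> h (0, x) = f x" "\<And>x. x \<in> std_cube n \<Longrightarrow> h (1, x) = g x"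
    "\<And>t x. t \<in> {0..1::real} \<Longrightarrow> x \<in> cube_boundary n \<Longrightarrow> h (t, x) = x0"
  using assms unfolding cube_homotopic_iff by (auto simp: image_subset_iff)

lemma homot_refl: "homot f f \<longleftrightarrow> spheroid f"
  unfolding cube_homotopic_def cube_topology spheroid_def
  by (simp add: continuous_map_subtopology_eu image_subset_iff_funcset)

lemma homot_sym: "homot f g \<Longrightarrow> homot g f"
  unfolding cube_homotopic_def by (rule homotopic_with_symD)

lemma homot_trans [trans]: "homot f g \<Longrightarrow> homot g h \<Longrightarrow> homot f h"
  unfolding cube_homotopic_def by (rule homotopic_with_trans)

lemma homot_spheroid: "homot f g \<Longrightarrow> spheroid f" "homot f g \<Longrightarrow> spheroid g"
  using homot_sym homot_trans homot_refl by blast+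

lemma homot_eq:
  assumes "spheroid f" "\<And>x. x \<in> std_cube n \<Longrightarrow> g x = f x"
  shows "homot f g"
proof (rule homotI)
  show "continuous_on ({0..1} \<times> std_cube n) (\<lambda>p. f (snd p))"
    by (rule continuous_on_compose2[of "std_cube n" f]) (use assms(1) in \<open>auto simp: spheroid_def intro: continuous_intros\<close>)
qed (use assms in \<open>auto simp: spheroid_def\<close>)

lemma spheroid_const: "spheroid (\<lambda>_. x0)"
  using x0 by (auto simp: spheroid_def)

text \<open>Coordinate 0 gives the multiplication of the homotopy group. A general coordinate is
  allowed because commutativity comes from comparing concatenation along 0 and along 1.\<close>

definition cat :: "nat \<Rightarrow> ((nat \<Rightarrow> real) \<Rightarrow> 'a) \<Rightarrow> ((nat \<Rightarrow> real) \<Rightarrow> 'a) \<Rightarrow> (nat \<Rightarrow> real) \<Rightarrow> 'a" where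
  "cat i f g x = (if x i \<le> 1/2 then f (x(i := 2 * x i)) else g (x(i := 2 * x i - 1)))"

lemma homot_cat:
  assumes i: "i < n" and f: "homot f f'" and g: "homot g g'"
  shows "homot (cat i f g) (cat i f' g')"
proof -
  from f obtain h where h: "continuous_on ({0..1} \<times> std_cube n) h" "\<And>t x. t \<in> {0..1} \<Longrightarrow> x \<in> std_cube n \<Longrightarrow> h (t, x) \<in> X"
    "\<And>x. x \<in> std_cube n \<Longrightarrow> h (0, x) = f x" "\<And>x. x \<in> std_cube n \<Longrightarrow> h (1, x) = f' x"
    "\<And>t x. t \<in> {0..1::real} \<Longrightarrow> x \<in> cube_boundary n \<Longrightarrow> h (t, x) = x0" by (rule homotE) blast
  from g obtain k where k: "continuous_on ({0..1} \<times> std_cube n) k" "\<And>t x. t \<in> {0..1} \<Longrightarrow> x \<in> std_cube n \<Longrightarrow> k (t, x) \<in> X"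
    "\<And>x. x \<in> std_cube n \<Longrightarrow> k (0, x) = g x" "\<And>x. x \<in> std_cube n \<Longrightarrow> k (1, x) = g' x"
    "\<And>t x. t \<in> {0..1::real} \<Longrightarrow> x \<in> cube_boundary n \<Longrightarrow> k (t, x) = x0" by (rule homotE) blast
  have u1: "x(i := 2 * x i) \<in> std_cube n" if "x \<in> std_cube n" "x i \<le> 1/2" for x
    using that i by (intro cube_upd) (auto simp: std_cube_def)
  have u2: "x(i := 2 * x i - 1) \<in> std_cube n" if "x \<in> std_cube n" "1/2 \<le> x i" for x
    using that i by (intro cube_upd) (auto simp: std_cube_def)
  let ?H = "\<lambda>p. if snd p i \<le> 1/2 then h (fst p, (snd p)(i := 2 * snd p i)) else k (fst p, (snd p)(i := 2 * snd p i - 1))"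
  show ?thesis
  proof (rule homotI)
    show "continuous_on ({0..1} \<times> std_cube n) ?H"
    proof (rule continuous_on_cases_le)
      show "continuous_on {p \<in> {0..1} \<times> std_cube n. snd p i \<le> 1/2} (\<lambda>p. h (fst p, (snd p)(i := 2 * snd p i)))"
        by (rule continuous_on_compose2[OF h(1)])
           (use u1 in \<open>auto intro!: continuous_on_Pair upd_continuous continuous_on_fst continuous_on_mult
              continuous_on_const continuous_on_id coordinate_continuous\<close>)
      show "continuous_on {p \<in> {0..1} \<times> std_cube n. 1/2 \<le> snd p i} (\<lambda>p. k (fst p, (snd p)(i := 2 * snd p i - 1)))"
        by (rule continuous_on_compose2[OF k(1)])
           (use u2 in \<open>auto intro!: continuous_on_Pair upd_continuous continuous_on_fst continuous_on_mult
              continuous_on_diff continuous_on_const continuous_on_id coordinate_continuous\<close>)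
      show "continuous_on ({0..1} \<times> std_cube n) (\<lambda>p. snd p i)" by (rule coordinate_continuous)
      fix p :: "real \<times> (nat \<Rightarrow> real)" assume p: "p \<in> {0..1} \<times> std_cube n" "snd p i = 1/2"
      \<comment> \<open>Where the halves meet, x i = 1/2, the rescaled coordinate is 1 on the left
        and 0 on the right. Both points lie on the boundary, so both homotopies take the value
        x0.\<close>
      have bd: "(snd p)(i := 2 * snd p i) \<in> cube_boundary n" "(snd p)(i := 2 * snd p i - 1) \<in> cube_boundary n"
        using p i by (auto intro!: boundary_end)
      have t: "fst p \<in> {0..1}" using p by auto
      show "h (fst p, (snd p)(i := 2 * snd p i)) = k (fst p, (snd p)(i := 2 * snd p i - 1))"
        unfolding h(5)[OF t bd(1)] k(5)[OF t bd(2)] ..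
    qed
  next
    fix t :: real and x assume t: "t \<in> {0..1}" and x: "x \<in> cube_boundary n"
    have xc: "x \<in> std_cube n" using x by (simp add: cube_boundary_def)
    have bd: "x(i := s) \<in> cube_boundary n" if "0 \<le> s" "s \<le> 1" "x i = 0 \<or> x i = 1 \<Longrightarrow> s = 0 \<or> s = 1" for s
    proof (cases "x i = 0 \<or> x i = 1")
      case True
      then show ?thesis using boundary_end[OF xc i] that(3) by blast
    next
      case False
      then show ?thesis using boundary_upd[OF x i] that by blast
    qed
    have "0 \<le> x i" "x i \<le> 1" using xc i by (auto simp: std_cube_def)
    then show "?H (t, x) = x0"
      using t h(5)[OF t bd[of "2 * x i"]] k(5)[OF t bd[of "2 * x i - 1"]] by auto
  qed (use u1 u2 h(2-4) k(2-4) in \<open>auto simp: cat_def\<close>)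
qed

lemma spheroid_cat: "i < n \<Longrightarrow> spheroid f \<Longrightarrow> spheroid g \<Longrightarrow> spheroid (cat i f g)"
  using homot_cat homot_refl by blast

text \<open>The straight-line homotopy between \<open>u\<close> and \<open>v\<close> in coordinate
  i. The shared end values lie in {0, 1}, so the faces x i = 0 and x i = 1 stay in the boundary
  throughout, and the other faces are preserved. The unit, inverse and associativity laws are all
  instances.\<close>

lemma homot_reparam:
  assumes i: "i < n" and f: "spheroid f"
    and u: "continuous_on {0..1} u" "u ` {0..1} \<subseteq> {0..1}" "u 0 \<in> {0, 1}" "u 1 \<in> {0, 1}"
    and v: "continuous_on {0..1} v" "v ` {0..1} \<subseteq> {0..1}" "v 0 = u 0" "v 1 = (u 1 :: real)"
  shows "homot (\<lambda>x. f (x(i := u (x i)))) (\<lambda>x. f (x(i := v (x i))))"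
proof -
  let ?w = "\<lambda>t s. (1 - t) * u s + t * v s"
  have w: "?w t s \<in> {0..1}" if "t \<in> {0..1}" "s \<in> {0..1}" for t s
  proof -
    have "u s \<in> {0..1}" "v s \<in> {0..1}" using that u(2) v(2) by blast+
    then show ?thesis
      using that convex_bound_le[of "u s" 1 "v s" "1 - t" t] by auto
  qed
  have ci: "x i \<in> {0..1}" if "x \<in> std_cube n" for x using that i by (auto simp: std_cube_def)
  have wc: "x(i := ?w t (x i)) \<in> std_cube n" if "t \<in> {0..1}" "x \<in> std_cube n" for t x
    using w[OF that(1) ci[OF that(2)]] that i by (intro cube_upd) auto
  let ?H = "\<lambda>p. f ((snd p)(i := ?w (fst p) (snd p i)))"
  show ?thesis
  proof (rule homotI)
    have cu: "continuous_on ({0..1} \<times> std_cube n) (\<lambda>p. u (snd p i))" "continuous_on ({0..1} \<times> std_cube n) (\<lambda>p. v (snd p i))"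
      using ci by (auto intro!: continuous_on_compose2[OF u(1)] continuous_on_compose2[OF v(1)] coordinate_continuous)
    show "continuous_on ({0..1} \<times> std_cube n) ?H"
    proof (rule continuous_on_compose2[of "std_cube n" f])
      show "continuous_on (std_cube n) f" using f by (simp add: spheroid_def)
      show "continuous_on ({0..1} \<times> std_cube n) (\<lambda>p. (snd p)(i := ?w (fst p) (snd p i)))"
        by (intro upd_continuous continuous_on_add continuous_on_mult continuous_on_diff continuous_on_const
            continuous_on_fst continuous_on_id cu)
      show "(\<lambda>p. (snd p)(i := ?w (fst p) (snd p i))) ` ({0..1} \<times> std_cube n) \<subseteq> std_cube n"
        using wc by auto
    qed
  next
    fix t :: real and x assume t: "t \<in> {0..1}" and x: "x \<in> cube_boundary n"
    have xc: "x \<in> std_cube n" using x by (simp add: cube_boundary_def)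
    have "x(i := ?w t (x i)) \<in> cube_boundary n"
    proof (cases "x i = 0 \<or> x i = 1")
      case True
      then have "?w t (x i) = u (x i)" using v(3,4) by (auto simp: algebra_simps)
      then show ?thesis using True u(3,4) by (intro boundary_end[OF xc i]) auto
    next
      case False
      then show ?thesis using boundary_upd[OF x i] w[OF t ci[OF xc]] by auto
    qed
    then show "?H (t, x) = x0" using f by (simp add: spheroid_def)
  qed (use wc f in \<open>auto simp: spheroid_def\<close>)
qed

lemma homot_cat_const:
  assumes i: "i < n" and f: "spheroid f"
  shows "homot (cat i f (\<lambda>_. x0)) f" "homot (cat i (\<lambda>_. x0) f) f"
proof -
  have fb: "f x = x0" if "x \<in> cube_boundary n" for x using f that by (simp add: spheroid_def)
  have id: "homot (\<lambda>x. f (x(i := x i))) f" using f by (simp add: homot_refl)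
  \<comment> \<open>Followed by the constant map, f is run at double speed and then held on the face
    x i = 1, where it is x0. This is the reparametrisation of f by min (2 s) 1; the mirror case uses
    max (2 s - 1) 0.\<close>
  have "homot (\<lambda>x. f (x(i := min (2 * x i) 1))) (\<lambda>x. f (x(i := x i)))"
    by (rule homot_reparam[OF i f, of "\<lambda>s. min (2 * s) 1" "\<lambda>s. s"]) (auto intro!: continuous_intros)
  then have 1: "homot (\<lambda>x. f (x(i := min (2 * x i) 1))) f" using id homot_trans by blast
  have "homot (\<lambda>x. f (x(i := min (2 * x i) 1))) (cat i f (\<lambda>_. x0))"
  proof (rule homot_eq[OF homot_spheroid(1)[OF 1]])
    fix x assume "x \<in> std_cube n"
    then show "cat i f (\<lambda>_. x0) x = f (x(i := min (2 * x i) 1))"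
      using fb[OF boundary_end[OF _ i, of x 1]] by (auto simp: cat_def min_def)
  qed
  then show "homot (cat i f (\<lambda>_. x0)) f" using 1 homot_sym homot_trans by blast
  have "homot (\<lambda>x. f (x(i := max (2 * x i - 1) 0))) (\<lambda>x. f (x(i := x i)))"
    by (rule homot_reparam[OF i f, of "\<lambda>s. max (2 * s - 1) 0" "\<lambda>s. s"]) (auto intro!: continuous_intros)
  then have 2: "homot (\<lambda>x. f (x(i := max (2 * x i - 1) 0))) f" using id homot_trans by blast
  have "homot (\<lambda>x. f (x(i := max (2 * x i - 1) 0))) (cat i (\<lambda>_. x0) f)"
  proof (rule homot_eq[OF homot_spheroid(1)[OF 2]])
    fix x assume "x \<in> std_cube n"
    then show "cat i (\<lambda>_. x0) f x = f (x(i := max (2 * x i - 1) 0))"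
      using fb[OF boundary_end[OF _ i, of x 0]] by (auto simp: cat_def max_def)
  qed
  then show "homot (cat i (\<lambda>_. x0) f) f" using 2 homot_sym homot_trans by blast
qed

lemma homot_cat_inverse:
  assumes i: "i < n" and f: "spheroid f"
  shows "spheroid (\<lambda>x. f (x(i := 1 - x i)))" "homot (cat i (\<lambda>x. f (x(i := 1 - x i))) f) (\<lambda>_. x0)"
proof -
  have fb: "f x = x0" if "x \<in> cube_boundary n" for x using f that by (simp add: spheroid_def)
  have "homot (\<lambda>x. f (x(i := 1 - x i))) (\<lambda>x. f (x(i := 1 - x i)))"
    by (rule homot_reparam[OF i f, of "\<lambda>s. 1 - s" "\<lambda>s. 1 - s"]) (auto intro!: continuous_intros)
  then show "spheroid (\<lambda>x. f (x(i := 1 - x i)))" by (rule homot_spheroid)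
  \<comment> \<open>The reverse of f followed by f is f reparametrised by |1 - 2 s|, which starts
    and ends at 1 and so deforms to the constant 1; on that face f is x0.\<close>
  have 1: "homot (\<lambda>x. f (x(i := \<bar>1 - 2 * x i\<bar>))) (\<lambda>x. f (x(i := 1)))"
    by (rule homot_reparam[OF i f, of "\<lambda>s. \<bar>1 - 2 * s\<bar>" "\<lambda>s. 1"]) (auto intro!: continuous_intros)
  have 2: "homot (\<lambda>x. f (x(i := 1))) (\<lambda>_. x0)"
    by (rule homot_eq[OF homot_spheroid(2)[OF 1]]) (use fb boundary_end i in auto)
  have "homot (\<lambda>x. f (x(i := \<bar>1 - 2 * x i\<bar>))) (cat i (\<lambda>x. f (x(i := 1 - x i))) f)"
    by (rule homot_eq[OF homot_spheroid(1)[OF 1]]) (auto simp: cat_def abs_if)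
  then show "homot (cat i (\<lambda>x. f (x(i := 1 - x i))) f) (\<lambda>_. x0)"
    using 1 2 homot_sym homot_trans by blast
qed

lemma homot_cat_assoc:
  assumes i: "i < n" and f: "spheroid f" and g: "spheroid g" and k: "spheroid k"
  shows "homot (cat i (cat i f g) k) (cat i f (cat i g k))"
proof -
  \<comment> \<open>The other bracketing is \<open>?c\<close> composed with the piecewise linear map
    that sends the break points 1/4 and 1/2 to 1/2 and 3/4. Its slopes 2, 1, 1/2 decrease, so it is
    the minimum of its three linear pieces.\<close>
  let ?c = "cat i f (cat i g k)" and ?u = "\<lambda>s::real. min (min (2 * s) (s + 1/4)) ((s + 1) / 2)"
  have c: "spheroid ?c" by (intro spheroid_cat i f g k)
  have "homot (\<lambda>x. ?c (x(i := ?u (x i)))) (\<lambda>x. ?c (x(i := x i)))"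
    by (rule homot_reparam[OF i c, of ?u "\<lambda>s. s"]; (intro continuous_intros; simp)?) (auto simp: min_def)
  then have 1: "homot (\<lambda>x. ?c (x(i := ?u (x i)))) ?c" by simp
  have "homot (\<lambda>x. ?c (x(i := ?u (x i)))) (cat i (cat i f g) k)"
  proof (rule homot_eq[OF homot_spheroid(1)[OF 1]])
    fix x :: "nat \<Rightarrow> real" assume "x \<in> std_cube n"
    consider "x i \<le> 1/4" | "1/4 < x i" "x i \<le> 1/2" | "1/2 < x i" by linarith
    then show "cat i (cat i f g) k x = ?c (x(i := ?u (x i)))"
    proof cases
      case 1
      then have "?u (x i) = 2 * x i" by (simp add: min_def)
      then show ?thesis using 1 by (simp add: cat_def)
    next
      case 2
      then have "?u (x i) = x i + 1/4" by (simp add: min_def)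
      then show ?thesis using 2 by (simp add: cat_def algebra_simps)
    next
      case 3
      then have "?u (x i) = (x i + 1) / 2" by (simp add: min_def)
      then show ?thesis using 3 by (simp add: cat_def add_divide_distrib)
    qed
  qed
  then show ?thesis using 1 homot_sym homot_trans by blast
qed

text \<open>The Eckmann-Hilton argument: the concatenations along two coordinates satisfy the interchange law.\<close>

lemma homot_cat_comm:
  assumes "1 < n" and f: "spheroid f" and g: "spheroid g"
  shows "homot (cat 0 f g) (cat 0 g f)"
proof -
  let ?e = "\<lambda>_::nat \<Rightarrow> real. x0"
  have n: "0 < n" "1 < n" using assms by auto
  have inter: "cat 0 (cat 1 a b) (cat 1 c d) = cat 1 (cat 0 a c) (cat 0 b d)" for a b c d
    by (auto simp: cat_def fun_eq_iff fun_upd_twist)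
  have "homot (cat 0 f g) (cat 0 (cat 1 f ?e) (cat 1 ?e g))"
    by (intro homot_cat n homot_sym[OF homot_cat_const(1)] homot_sym[OF homot_cat_const(2)] f g)
  also have "homot \<dots> (cat 1 f g)"
    unfolding inter by (intro homot_cat n homot_cat_const f g)
  also have "homot \<dots> (cat 1 (cat 0 ?e f) (cat 0 g ?e))"
    by (intro homot_cat n homot_sym[OF homot_cat_const(1)] homot_sym[OF homot_cat_const(2)] f g)
  also have "homot \<dots> (cat 0 g f)"
    unfolding inter[symmetric] by (intro homot_cat n homot_cat_const f g)
  finally show ?thesis .
qed

section \<open>The homotopy group as an abelian group, and the action of the fundamental
  group\<close>

definition "cl f = {h. homot f h}"

lemma cl_eq: "homot f g \<Longrightarrow> cl f = cl g"
  unfolding cl_def using homot_sym homot_trans by blast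

abbreviation "HG \<equiv> homotopy_group n X x0"

lemma carrier_HG: "carrier HG = cl ` {f. spheroid f}"
proof -
  have "carrier HG = cl ` {f. homot f f}"
    unfolding cl_def by (auto simp: homotopy_group_def cube_homotopic_def)
  then show ?thesis by (simp add: homot_refl)
qed

lemma one_HG: "\<one>\<^bsub>HG\<^esub> = cl (\<lambda>_. x0)"
  by (simp add: homotopy_group_def cl_def)

lemma mult_HG:
  assumes "0 < n" "spheroid f" "spheroid g"
  shows "cl f \<otimes>\<^bsub>HG\<^esub> cl g = cl (cat 0 f g)"
proof -
  have cc: "cube_concat = cat 0" by (intro ext) (simp add: cube_concat_def cat_def)
  have "homot (cat 0 f g) h" if "homot f f'" "homot g g'" "homot (cat 0 f' g') h" for f' g' h
    using homot_cat[OF assms(1) that(1,2)] that(3) by (rule homot_trans)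
  moreover have "homot f f" "homot g g" using assms by (simp_all add: homot_refl)
  ultimately show ?thesis
    unfolding cl_def by (auto simp: homotopy_group_def cc)
qed

lemma homotopy_group_comm:
  assumes "1 < n"
  shows "comm_group HG"
proof -
  have n: "0 < n" using assms by simp
  note mult = mult_HG[OF n] and cat = spheroid_cat[OF n]
  show ?thesis
  proof (rule comm_groupI)
    show "\<one>\<^bsub>HG\<^esub> \<in> carrier HG" using spheroid_const by (auto simp: one_HG carrier_HG)
  next
    fix x y assume "x \<in> carrier HG" "y \<in> carrier HG"
    then obtain f g where fg: "spheroid f" "spheroid g" "x = cl f" "y = cl g" by (auto simp: carrier_HG)
    then show "x \<otimes>\<^bsub>HG\<^esub> y \<in> carrier HG" using cat by (auto simp: mult carrier_HG)
    show "x \<otimes>\<^bsub>HG\<^esub> y = y \<otimes>\<^bsub>HG\<^esub> x" using fg cl_eq[OF homot_cat_comm[OF assms fg(1,2)]] by (simp add: mult)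
  next
    fix x y z assume "x \<in> carrier HG" "y \<in> carrier HG" "z \<in> carrier HG"
    then obtain f g k where fg: "spheroid f" "spheroid g" "spheroid k" "x = cl f" "y = cl g" "z = cl k"
      by (auto simp: carrier_HG)
    then show "x \<otimes>\<^bsub>HG\<^esub> y \<otimes>\<^bsub>HG\<^esub> z = x \<otimes>\<^bsub>HG\<^esub> (y \<otimes>\<^bsub>HG\<^esub> z)"
      using cl_eq[OF homot_cat_assoc[OF n fg(1-3)]] cat by (simp add: mult)
  next
    fix x assume "x \<in> carrier HG"
    then obtain f where f: "spheroid f" "x = cl f" by (auto simp: carrier_HG)
    show "\<one>\<^bsub>HG\<^esub> \<otimes>\<^bsub>HG\<^esub> x = x"
      using f cl_eq[OF homot_cat_const(2)[OF n f(1)]] by (simp add: one_HG mult spheroid_const)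
    have "cl (\<lambda>x. f (x(0 := 1 - x 0))) \<otimes>\<^bsub>HG\<^esub> x = \<one>\<^bsub>HG\<^esub>"
      using f cl_eq[OF homot_cat_inverse(2)[OF n f(1)]] homot_cat_inverse(1)[OF n f(1)] by (simp add: one_HG mult)
    moreover have "cl (\<lambda>x. f (x(0 := 1 - x 0))) \<in> carrier HG"
      using homot_cat_inverse(1)[OF n f(1)] by (auto simp: carrier_HG)
    ultimately show "\<exists>y\<in>carrier HG. y \<otimes>\<^bsub>HG\<^esub> x = \<one>\<^bsub>HG\<^esub>" by blast
  qed
qed

text \<open>The homotopies of f and g are glued along the sup-norm radius \<open>?r\<close>, which
  is 1 on the boundary of the cube. The two formulas meet at radius 1/2: there the rescaled point
  lies on the boundary, where the homotopy of f is x0, and the loop is at parameter 0. On the outer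
  boundary the loop is at parameter 1, so the result stays based at x0.\<close>

lemma homot_cube_act:
  assumes n: "0 < n" and f: "homot f f'" and g: "homotopic_paths X g g'"
    and gx: "pathstart g = x0" "pathfinish g = x0"
  shows "homot (cube_act n f g) (cube_act n f' g')"
proof -
  from f obtain h where h: "continuous_on ({0..1} \<times> std_cube n) h" "\<And>t x. t \<in> {0..1} \<Longrightarrow> x \<in> std_cube n \<Longrightarrow> h (t, x) \<in> X"
    "\<And>x. x \<in> std_cube n \<Longrightarrow> h (0, x) = f x" "\<And>x. x \<in> std_cube n \<Longrightarrow> h (1, x) = f' x"
    "\<And>t x. t \<in> {0..1::real} \<Longrightarrow> x \<in> cube_boundary n \<Longrightarrow> h (t, x) = x0" by (rule homotE) blast
  from g obtain k where k: "continuous_on ({0..1} \<times> {0..1}) k" "k \<in> ({0..1} \<times> {0..1}) \<rightarrow> X"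
    "\<And>s. s \<in> {0..1} \<Longrightarrow> k (0, s) = g s" "\<And>s. s \<in> {0..1} \<Longrightarrow> k (1, s) = g' s"
    "\<And>t. t \<in> {0..1::real} \<Longrightarrow> k (t, 0) = x0" "\<And>t. t \<in> {0..1::real} \<Longrightarrow> k (t, 1) = x0"
  proof -
    obtain k where "continuous_on ({0..1} \<times> {0..1}) k" "k \<in> ({0..1} \<times> {0..1}) \<rightarrow> X"
      "\<forall>s\<in>{0..1}. k (0, s) = g s" "\<forall>s\<in>{0..1}. k (1, s) = g' s"
      "\<forall>t\<in>{0..1::real}. pathstart (k \<circ> Pair t) = pathstart g \<and> pathfinish (k \<circ> Pair t) = pathfinish g"
      using g unfolding homotopic_paths by blast
    then show thesis by (intro that[of k]) (simp_all add: gx[unfolded pathstart_def pathfinish_def] pathstart_def pathfinish_def)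
  qed
  let ?r = "\<lambda>x::nat \<Rightarrow> real. Max ((\<lambda>i. \<bar>2 * x i - 1\<bar>) ` {..<n})"
  let ?j = "\<lambda>x i. if i < n then 2 * x i - 1/2 else (0::real)"
  have fin: "finite ((\<lambda>i. \<bar>2 * x i - 1\<bar>) ` {..<n})" "(\<lambda>i. \<bar>2 * x i - 1\<bar>) ` {..<n} \<noteq> {}" for x :: "nat \<Rightarrow> real"
    using n by auto
  have r_le: "?r x \<le> c \<longleftrightarrow> (\<forall>i<n. \<bar>2 * x i - 1\<bar> \<le> c)" for x c
    using fin by (subst Max_le_iff) auto
  have r_eq: "\<exists>i<n. ?r x = \<bar>2 * x i - 1\<bar>" for x
    using Max_in[OF fin, of x] by auto
  have r1: "?r x \<le> 1" if "x \<in> std_cube n" for x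
    unfolding r_le using that by (auto simp: std_cube_def abs_le_iff)
  have j: "?j x \<in> std_cube n" if "?r x \<le> 1/2" for x
  proof -
    have "0 \<le> 2 * x i - 1/2 \<and> 2 * x i - 1/2 \<le> 1" if "i < n" for i
    proof -
      have "\<bar>2 * x i - 1\<bar> \<le> 1/2" using \<open>?r x \<le> 1/2\<close> that unfolding r_le by blast
      then show ?thesis by (simp only: abs_le_iff) linarith
    qed
    then show ?thesis by (simp add: std_cube_def)
  qed
  have jb: "?j x \<in> cube_boundary n" if "?r x = 1/2" for x
  proof -
    obtain i where i: "i < n" "\<bar>2 * x i - 1\<bar> = 1/2" using r_eq[of x] unfolding \<open>?r x = 1/2\<close> by metis
    then have "?j x i = 0 \<or> ?j x i = 1" by (auto simp: abs_if split: if_splits)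
    then show ?thesis using i(1) j[of x] that unfolding cube_boundary_def by auto
  qed
  have rb: "?r x = 1" if "x \<in> cube_boundary n" for x
  proof -
    obtain i where i: "i < n" "x i = 0 \<or> x i = 1" using \<open>x \<in> cube_boundary n\<close> by (auto simp: cube_boundary_def)
    have "\<bar>2 * x i - 1\<bar> \<le> ?r x" using i(1) fin(1) by (intro Max_ge) auto
    then show ?thesis using r1[of x] that i(2) by (auto simp: cube_boundary_def)
  qed
  \<comment> \<open>\<open>Max\<close> over n coordinates is unfolded into binary maxima by
    induction on n, starting at n = 1 since the family must be nonempty.\<close>
  have rc: "continuous_on S (\<lambda>p. ?r (snd p))" for S :: "(real \<times> (nat \<Rightarrow> real)) set"
    using n
  proof (induction n rule: nat_induct_non_zero)
    case 1
    have "{..<1} = {0::nat}" by auto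
    then show ?case by (simp add: continuous_intros coordinate_continuous)
  next
    case (Suc m)
    have "Max ((\<lambda>i. \<bar>2 * snd p i - 1\<bar>) ` {..<Suc m}) = max \<bar>2 * snd p m - 1\<bar> (Max ((\<lambda>i. \<bar>2 * snd p i - 1\<bar>) ` {..<m}))"
      for p :: "real \<times> (nat \<Rightarrow> real)"
    proof -
      have "(\<lambda>i. \<bar>2 * snd p i - 1\<bar>) ` {..<m} \<noteq> {}" using Suc(1) by auto
      then show ?thesis by (simp add: lessThan_Suc)
    qed
    then show ?case
      using Suc by (simp add: continuous_intros coordinate_continuous)
  qed
  let ?H = "\<lambda>p. if ?r (snd p) \<le> 1/2 then h (fst p, ?j (snd p)) else k (fst p, 2 * ?r (snd p) - 1)"
  have act: "cube_act n f g x = (if ?r x \<le> 1/2 then f (?j x) else g (2 * ?r x - 1))" for f g and x :: "nat \<Rightarrow> real"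
    by (simp add: cube_act_def Let_def)
  show ?thesis
  proof (rule homotI)
    show "continuous_on ({0..1} \<times> std_cube n) ?H"
    proof (rule continuous_on_cases_le)
      have "continuous_on S (\<lambda>p. ?j (snd p))" for S :: "(real \<times> (nat \<Rightarrow> real)) set"
      proof (rule continuous_on_coordinatewise_then_product)
        show "continuous_on S (\<lambda>p. ?j (snd p) i)" for i
          by (cases "i < n") (simp_all add: continuous_intros coordinate_continuous)
      qed
      then show "continuous_on {p \<in> {0..1} \<times> std_cube n. ?r (snd p) \<le> 1/2} (\<lambda>p. h (fst p, ?j (snd p)))"
        by (intro continuous_on_compose2[OF h(1)] continuous_on_Pair continuous_on_fst continuous_on_id) (use j in auto)
      show "continuous_on {p \<in> {0..1} \<times> std_cube n. 1/2 \<le> ?r (snd p)} (\<lambda>p. k (fst p, 2 * ?r (snd p) - 1))"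
        by (intro continuous_on_compose2[OF k(1)] continuous_on_Pair continuous_on_fst continuous_on_id
            continuous_on_diff continuous_on_mult continuous_on_const rc) (use r1 in auto)
      show "continuous_on ({0..1::real} \<times> std_cube n) (\<lambda>p. ?r (snd p))" by (rule rc)
      show "h (fst p, ?j (snd p)) = k (fst p, 2 * ?r (snd p) - 1)"
        if "p \<in> {0..1} \<times> std_cube n" "?r (snd p) = 1/2" for p
      proof -
        have t: "fst p \<in> {0..1}" using that(1) by auto
        have r0: "2 * ?r (snd p) - 1 = 0" using that(2) by simp
        show ?thesis unfolding h(5)[OF t jb[OF that(2)]] r0 k(5)[OF t] ..
      qed
    qed
  next
    fix t :: real and x assume t: "t \<in> {0..1}" and x: "x \<in> std_cube n"
    show "?H (t, x) \<in> X"
      unfolding fst_conv snd_conv using h(2)[OF t j[of x]] k(2) t r1[OF x] by (auto simp: Pi_iff)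
  next
    fix x assume x: "x \<in> std_cube n"
    show "?H (0, x) = cube_act n f g x" "?H (1, x) = cube_act n f' g' x"
      unfolding act fst_conv snd_conv using h(3,4)[OF j[of x]] k(3,4)[of "2 * ?r x - 1"] r1[OF x] by auto
  next
    fix t :: real and x assume "t \<in> {0..1}" "x \<in> cube_boundary n"
    then show "?H (t, x) = x0" unfolding fst_conv snd_conv using rb k(6) by simp
  qed
qed

text \<open>By homotopy invariance in both arguments the result is the full class of
  \<open>cube_act\<close> on any representatives. That map is a spheroid, being homotopic to
  itself.\<close>

lemma homotopy_act_closed:
  assumes n: "0 < n" and a: "a \<in> carrier HG" and b: "b \<in> carrier (fundamental_group X x0)"
  shows "homotopy_act n X x0 a b \<in> carrier HG"
proof -
  obtain f where f: "spheroid f" "a = cl f" using a by (auto simp: carrier_HG)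
  obtain g where g: "path g" "path_image g \<subseteq> X" "pathstart g = x0" "pathfinish g = x0"
      and b: "b = {h. homotopic_paths X g h}"
    using b by (auto simp: fundamental_group_def)
  have gg: "homotopic_paths X g g" using g by simp
  have ff: "homot f f" using f by (simp add: homot_refl)
  have "homotopy_act n X x0 a b = cl (cube_act n f g)"
  proof (intro equalityI subsetI)
    fix h assume "h \<in> homotopy_act n X x0 a b"
    then obtain f' g' where "homot f f'" "homotopic_paths X g g'" "homot (cube_act n f' g') h"
      using f(2) b by (auto simp: homotopy_act_def cl_def)
    then show "h \<in> cl (cube_act n f g)"
      using homot_cube_act[OF n _ _ g(3,4)] homot_trans unfolding cl_def by blast
  next
    fix h assume "h \<in> cl (cube_act n f g)"
    then show "h \<in> homotopy_act n X x0 a b"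
      using f(2) b gg ff unfolding homotopy_act_def cl_def by blast
  qed
  then show ?thesis
    using homot_spheroid(1)[OF homot_cube_act[OF n ff gg g(3,4)]] by (auto simp: carrier_HG)
qed

lemma homotopy_module_closed:
  assumes n: "1 < n" and a: "a \<in> carrier HG" and r: "r \<in> carrier (monoid_ring (fundamental_group X x0))"
  shows "ract (homotopy_module n X x0) a r \<in> carrier HG"
proof -
  have "free_ext HG (homotopy_act n X x0 a) \<in> hom (free_Abelian_group (carrier (fundamental_group X x0))) HG"
    by (rule free_ext_hom(1)[OF homotopy_group_comm[OF n]]) (use homotopy_act_closed[OF _ a] n in auto)
  then have "free_ext HG (homotopy_act n X x0 a) r \<in> carrier HG"
    using r by (auto simp: monoid_ring_simps intro: hom_in_carrier)
  then show ?thesis by (simp add: homotopy_module_def)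
qed

end

theorem corollary3p4:
  fixes V W :: "(complex ^ 'n) set" and A Ah :: "(complex ^ 'n) set set"
    and p q :: nat and x0 :: "complex ^ 'n"
  assumes "arrangement V A" and "hypersolvable V A" and "\<not> supersolvable V A"
    and "enat p = os_invariant V A"
    and "supersolvable_deformation V A W Ah p"
    and X: "X = arr_complement V A" and Y: "Y = arr_complement W Ah" and "x0 \<in> X"
    and P: "P = homotopy_module p X x0"
    and R: "R = monoid_ring (fundamental_group X x0)"
    and I: "I = augmentation_ideal (fundamental_group X x0)"
    and Rh: "Rh = adic_completion R I" and F: "F = completion_filt R I"
    and Rq: "Rq = R Quot ideal_pow R I q"
    and H: "H = homol (p + 2) Y" and K: "K = rel_homol (p + 1) Y X"
    and "dual_to_multiplication V A W Ah (p + 1) d"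
    and "rlinear Rh (ext_scalars H Rh) (ext_scalars K Rh) D"
    and "rmod_iso Rh (base_change R P (to_completion R I) Rh)
                     (rmod_coker (ext_scalars H Rh) (ext_scalars K Rh) D)"
    and "gr_map_zero (ext_scalars H Rh) (ext_scalars K Rh) F D"
    and "\<forall>x\<in>carrier H.
           E1_tensor R I Rh F (to_completion R I) H K D 0
             (tens H (gr_ring R (ideal_pow R I) 0) {} x (ideal_pow R I 1 +>\<^bsub>R\<^esub> \<one>\<^bsub>R\<^esub>)) =
           ztensor_map K (gr_ring R (ideal_pow R I) 1) id
             (inv_into (carrier (gr_ring R (ideal_pow R I) 1)) (gr1_to_H1 Y))
             (ztensor_map K (homol 1 Y) (rel_proj (p + 1) Y X) id (d x))"
    and "2 \<le> q"
    and Dq: "Dq = free_base_change_map Rh (\<lambda>x. x q) Rq H K D"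
  shows "rlinear Rq (ext_scalars H Rq) (ext_scalars K Rq) Dq
    \<and> rmod_iso Rq (base_change R P (to_quot R I q) Rq)
                  (rmod_coker (ext_scalars H Rq) (ext_scalars K Rq) Dq)
    \<and> gr_map_zero (ext_scalars H Rq) (ext_scalars K Rq) (quot_filt R I q) Dq
    \<and> (\<forall>s<q. gr_ring_map Rq (quot_filt R I q) (to_quot R I q) s
               \<in> iso (gr_ring R (ideal_pow R I) s) (gr_ring Rq (quot_filt R I q) s))
    \<and> (\<forall>s\<ge>q. trivial_group (gr_ring Rq (quot_filt R I q) s))
    \<and> (\<forall>s<q - 1. \<forall>y\<in>carrier (ztensor H (gr_ring R (ideal_pow R I) s)).
          E1_tensor R I Rq (quot_filt R I q) (to_quot R I q) H K Dq s y =
          E1_tensor R I Rh F (to_completion R I) H K D s y)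
    \<and> (\<forall>c\<in>carrier (gr_mod (ext_scalars H Rq) (quot_filt R I q) (q - 1)).
          E1_map (ext_scalars K Rq) (quot_filt R I q) Dq (q - 1) c =
          \<one>\<^bsub>gr_mod (ext_scalars K Rq) (quot_filt R I q) q\<^esub>)"
proof -
  let ?G = "fundamental_group X x0" and ?\<phi> = "\<lambda>x :: nat \<Rightarrow> _. x q"
  interpret X: spheroids p X x0 by unfold_locales (rule \<open>x0 \<in> X\<close>)
  \<comment> \<open>This makes the homotopy group abelian, which the finite product in the action of
    the group ring relies on.\<close>
  have "2 \<le> p"
    using os_invariant_ge_2[OF \<open>arrangement V A\<close>] \<open>enat p = os_invariant V A\<close>
    by (metis enat_ord_simps(1))
  then have p: "1 < p" by simp
  have G: "Group.monoid ?G" by (rule fundamental_group_monoid[OF \<open>x0 \<in> X\<close>])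
  interpret ideal I R unfolding I R by (rule augmentation_ideal_ideal[OF G])
  have HK: "comm_group H" "comm_group K"
    unfolding H K by (rule abelian_relative_homology_group)+
  note lin = \<open>rlinear Rh (ext_scalars H Rh) (ext_scalars K Rh) D\<close>
  note zero = \<open>gr_map_zero (ext_scalars H Rh) (ext_scalars K Rh) F D\<close>
  \<comment> \<open>\<open>Q\<close> starts from the completion, where D lives, and handles the
    cokernel and the maps E1. \<open>RQ\<close> starts from R itself and compares the graded pieces
    of R and R / I^q.\<close>
  interpret Q: filtered_quotient Rh Rq ?\<phi> F "quot_filt R I q" q
    unfolding Rh Rq F by (rule filtered_quotient_completion)
  interpret RQ: filtered_quotient R Rq "to_quot R I q" "ideal_pow R I" "quot_filt R I q" q
    unfolding Rq by (rule filtered_quotient_to_quot)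
  note lin' = Q.free_base_change_map_linear[OF HK lin, folded Dq]
  note proj = Q.free_base_change_map_proj[OF HK lin, folded Dq]

  have Pc: "carrier P = carrier X.HG" "monoid.mult P = monoid.mult X.HG"
    by (simp_all add: P homotopy_module_def)
  have P_mult: "m \<otimes>\<^bsub>P\<^esub> m' \<in> carrier P" if "m \<in> carrier P" "m' \<in> carrier P" for m m'
    using comm_group_m_closed[OF X.homotopy_group_comm[OF p]] that by (simp add: Pc)
  have P_act: "ract P m r \<in> carrier P" if "m \<in> carrier P" "r \<in> carrier R" for m r
    using X.homotopy_module_closed[OF p] that unfolding Pc unfolding P R .
  have \<psi>: "to_completion R I ` carrier R \<subseteq> carrier Rh"
    unfolding Rh using to_completion_closed by auto
  \<comment> \<open>The map from R to the completion followed by evaluation at q is the projection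
    to R / I^q. Hence the base change of \<open>P\<close> to R / I^q is a reduction of its base
    change to the completion.\<close>
  note bc = Q.base_change_reduction[OF P_mult P_act \<psi>, of "to_quot R I q"]
  have bcS: "acted_group Rh (base_change R P (to_completion R I) Rh)"
    and bcT: "acted_group Rq (base_change R P (to_quot R I q) Rq)"
    and "\<exists>\<pi>. reduction Rh Q.ker ?\<phi> (base_change R P (to_completion R I) Rh) (base_change R P (to_quot R I q) Rq) \<pi>"
    using bc by (simp_all add: to_completion_def)
  then obtain \<pi> where
    \<pi>: "reduction Rh Q.ker ?\<phi> (base_change R P (to_completion R I) Rh) (base_change R P (to_quot R I q) Rq) \<pi>"
    by blast
  note MH = Q.MS[OF HK(1)] and MK = Q.MS[OF HK(2)] and MH' = Q.MT[OF HK(1)] and MK' = Q.MT[OF HK(2)]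
  have \<sigma>: "reduction Rh Q.ker ?\<phi> (rmod_coker (ext_scalars H Rh) (ext_scalars K Rh) D)
      (rmod_coker (ext_scalars H Rq) (ext_scalars K Rq) Dq) (\<lambda>c. Q.\<pi> K ` c)"
    by (rule coker_reduction[OF MH MK MH' MK' Q.ker_carrier _ Q.red[OF HK(1)] Q.red[OF HK(2)] lin lin' proj])
       (use Q.surj in auto)
  have iso: "rmod_iso Rq (base_change R P (to_quot R I q) Rq)
      (rmod_coker (ext_scalars H Rq) (ext_scalars K Rq) Dq)"
    by (rule reduction_iso[OF bcS coker_acted[OF MH MK lin] bcT coker_acted[OF MH' MK' lin'] Q.ker_carrier
          Q.surj \<pi> \<sigma>]) fact

  \<comment> \<open>\<open>E1_tensor_eq\<close> speaks of the composite through the completion,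
    while the identifications over R / I^q are taken along \<open>to_quot\<close>.\<close>
  have comp: "?\<phi> \<circ> to_completion R I = to_quot R I q"
    by (simp add: to_completion_def comp_def)
  have E1: "E1_tensor R I Rq (quot_filt R I q) (to_quot R I q) H K Dq s y =
      E1_tensor R I Rh F (to_completion R I) H K D s y"
    if "s < q - 1" "y \<in> carrier (ztensor H (gr_ring R (ideal_pow R I) s))" for s y
    using Q.E1_tensor_eq[OF HK lin zero filtration_ideal_pow _ _ _ that(2), of "to_completion R I"]
      to_completion_hom to_completion_filt that(1) by (simp add: comp Dq Rh F)
  \<comment> \<open>Degree q - 1 is the one with \<open>Suc s = q\<close>; the bound on q excludes
    truncated subtraction at 0.\<close>
  have last: "E1_map (ext_scalars K Rq) (quot_filt R I q) Dq (q - 1) c =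
      \<one>\<^bsub>gr_mod (ext_scalars K Rq) (quot_filt R I q) q\<^esub>"
    if "c \<in> carrier (gr_mod (ext_scalars H Rq) (quot_filt R I q) (q - 1))" for c
    using Q.E1_map_last[OF HK lin zero _ that, folded Dq] \<open>2 \<le> q\<close> by simp
  show ?thesis
    using lin' iso Q.D'_gr_map_zero[OF HK lin zero, folded Dq] RQ.gr_ring_map_iso RQ.gr_ring_trivial E1 last
    by (auto simp: Suc_le_eq)
qed

end
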